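(* Let $(\mathbf{G},\lambda,\mu)$ be a measured groupoid such that $(\mathbf{G},\lambda\star\mu)$ is a ($\sigma$-finite) Lebesgue space, and let $P$ be any invariant Markov operator on $(\mathbf{G},\lambda,\mu)$. Then the Poisson extension $\widetilde{\mathbf{G}}=\mathbf{G}\ltimes\Gamma$, i.e., the measured groupoid associated with the action of $\mathbf{G}$ on the Poisson boundary $\Gamma$ of the operator $P$ (endowed with the harmonic measure class), is amenable.
   Context: Groupoids. A groupoid $\mathbf{G}$ is a small category in which every morphism is invertible; $\mathbf{G}$ also denotes its set of morphisms, $\mathbf{G}^{(0)}$ its set of objects, identified with a subset of $\mathbf{G}$ via $x\mapsto\boldsymbol{\varepsilon}_x$ (identity morphism at $x$), and $\mathsf{s},\mathsf{t}:\mathbf{G}\to\mathbf{G}^{(0)}$ the source and target maps. $\mathbf{G}^{(2)}=\{(g_1,g_2):\mathsf{s}(g_1)=\mathsf{t}(g_2)\}$ is the set of composable pairs, with $\mathsf{s}(g_1g_2)=\mathsf{s}(g_2)$, $\mathsf{t}(g_1g_2)=\mathsf{t}(g_1)$. Put $\mathbf{G}^x=\mathsf{t}^{-1}(x)$. Each $g\in\mathbf{G}$ gives a bijection $\mathbf{G}^{\mathsf{s}(g)}\to\mathbf{G}^{\mathsf{t}(g)}$, $h\mapsto gh$, and $g\theta$ denotes the image of a measure $\theta$ on $\mathbf{G}^{\mathsf{s}(g)}$ under it. $\mathbf{G}$ is Borel if it carries a Borel structure for which all structure maps are Borel. Measured groupoids. A Borel Haar system on a Borel groupoid is a family $\lambda=\{\lambda^x\}_{x\in\mathbf{G}^{(0)}}$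 of measures, $\lambda^x$ concentrated on $\mathbf{G}^x$, which is Borel (for every non-negative Borel $f$ on $\mathbf{G}$ the function $x\mapsto\langle\lambda^x,f\rangle$ is Borel), proper (there is a non-negative Borel $f$ with $\langle\lambda^x,f\rangle=1$ for all $x$) and invariant: $g\lambda^{\mathsf{s}(g)}=\lambda^{\mathsf{t}(g)}$ for all $g\in\mathbf{G}$. For a Borel measure $\mu$ on $\mathbf{G}^{(0)}$, $\lambda\star\mu=\int\lambda^x\,d\mu(x)$; $\mu$ is quasi-invariant if $\lambda\star\mu$ is equivalent to its image under $g\mapsto g^{-1}$. A measured groupoid is a triple $(\mathbf{G},\lambda,\mu)$ with $\mathbf{G}$ a Borel groupoid, $\lambda$ a Borel Haar system, and $\mu$ quasi-invariant; only the measure class of $\mu$ matters, so the term is also used when just a quasi-invariant measure class on $\mathbf{G}^{(0)}$ is given. $\mathbf{G}$-spaces and semi-direct products. A (left) $\mathbf{G}$-space is a set $X$ with a projection $\mathsf{t}:X\to\mathbf{G}^{(0)}$ and an action map $(g,x)\mapsto gx\in X$ defined when $\mathsf{s}(g)=\mathsf{t}(x)$, with $\mathsf{t}(gx)=\mathsf{t}(g)$, $\boldsymbol\varepsilon_{\mathsf{t}(x)}x=x$, $g_1(g_2x)=(g_1g_2)x$. The semi-direct product groupoid $\mathbf{G}\ltimes X$ has object set $X$ and morphisms $(gx,g,x)$, $\mathsf{s}(g)=\mathsf{t}(x)$, with source $x$, target $gx$, and composition $(g_1g_2x,g_1,g_2x)(g_2x,g_2,x)=(g_1g_2x,g_1g_2,x)$.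 The fiber of its target map over $y\in X$ is identified with $\mathbf{G}^{\mathsf{t}(y)}$ by $(y,g,g^{-1}y)\leftrightarrow g$, and $\lambda$ thereby lifts to a Haar system (again denoted $\lambda$) of $\mathbf{G}\ltimes X$. A measure (class) on $X$ is $(\mathbf{G},\lambda)$-quasi-invariant if together with this Haar system it makes $\mathbf{G}\ltimes X$ a measured groupoid. Amenability. For a system $\theta=\{\theta^x\}$ of finite measures on the fibers $\mathbf{G}^x$, absolutely continuous with respect to $\lambda$, put $(\theta*f)(g)=\int f(h^{-1}g)\,d\theta^{\mathsf{t}(g)}(h)$ for functions $f$ on $\mathbf{G}$ and $(\theta*\varphi)(x)=\int\varphi(\mathsf{s}(h))\,d\theta^x(h)$ for functions $\varphi$ on $\mathbf{G}^{(0)}$. $(\mathbf{G},\lambda,\mu)$ is amenable if there is a positive normalized linear map (mean) $\boldsymbol\Pi:L^\infty(\mathbf{G},\lambda\star\mu)\to L^\infty(\mathbf{G}^{(0)},\mu)$ with $\boldsymbol\Pi(\theta*f)=\theta*\boldsymbol\Pi(f)$ for all such $\theta$ and $f$. Equivalently: there is a sequence $\theta_n=\{\theta_n^x\}$ of systems of probability measures on the fibers $\mathbf{G}^x$, absolutely continuous with respect to $\lambda^x$ with density measurable on $\mathbf{G}$, such that $\int\|g\theta_n^{\mathsf{s}(g)}-\theta_n^{\mathsf{t}(g)}\|\,f(g)\,d(\lambda\star\mu)(g)\to0$ for every $f\in L^1(\mathbf{G},\lambda\star\mu)$ (total variation norm). Markov operators and the Poisson boundary. A Markov operator $P$ on a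 Borel space $X$ is given by a Borel family $\{\pi_x\}_{x\in X}$ of Borel probability measures (transition probabilities) via $Pf(x)=\langle\pi_x,f\rangle$; $\theta P=\int\pi_x\,d\theta(x)$ for measures $\theta$. A $\sigma$-finite measure $m$ is $P$-adapted if $mP$ is absolutely continuous with respect to $m$. Let $(X,m)$ be a Lebesgue space with $m$ $P$-adapted. Let $\mathbf{P}_m$ be the measure on the path space $X^{\mathbb{Z}_+}$ of the associated Markov chain with initial distribution $m$, and let $T$ be the time shift on $X^{\mathbb{Z}_+}$. The Poisson boundary $\Gamma=\Gamma(X,m,P)$ is the space of ergodic components of $T$ on $(X^{\mathbb{Z}_+},\mathbf{P}_m)$, i.e., the maximal measurable quotient $\mathbf{bnd}:X^{\mathbb{Z}_+}\to\Gamma$ (mod 0) constant along the orbits of $T$; it is endowed with the harmonic measure class, the image under $\mathbf{bnd}$ of the class of $\mathbf{P}_m$. Invariant operators. A Markov operator on a Borel groupoid $\mathbf{G}$ is invariant if its transition probabilities satisfy $\pi_{g'g}=g'\pi_g$ for all $(g',g)\in\mathbf{G}^{(2)}$; in particular $\pi_g$ is concentrated on $\mathbf{G}^{\mathsf{t}(g)}$. By an invariant Markov operator on a measured groupoid $(\mathbf{G},\lambda,\mu)$ one means one for which $\lambda\star\mu$ is $P$-adapted. Its Poisson boundary $\Gamma$ is taken with respect to $m=\lambda\star\mu$. The map $\mathsf{t}$ is constant along sample paths, and $\mathbf{G}$ acts on sample paths coordinatewise, $g(g_0,g_1,\dots)=(gg_0,gg_1,\dots)$ when $\mathsf{s}(g)=\mathsf{t}(g_0)$;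 this action commutes with $T$ and descends to an action of $\mathbf{G}$ on $\Gamma$ (with projection $\mathsf{t}:\Gamma\to\mathbf{G}^{(0)}$), for which the harmonic measure class is $(\mathbf{G},\lambda)$-quasi-invariant. The resulting measured groupoid $\mathbf{G}\ltimes\Gamma$ is the Poisson extension. *)

theory Defs
  imports "HOL-Probability.Probability"
begin

section \<open>Measure-theoretic preliminaries\<close>

definition mutually_ac :: "'a measure \<Rightarrow> 'a measure \<Rightarrow> bool" where
  "mutually_ac M N \<longleftrightarrow> absolutely_continuous M N \<and> absolutely_continuous N M"

text \<open>A \<open>\<sigma>\<close>-finite Lebesgue space: off a null set, the underlying Borel structure is isomorphic
  to that of a Borel subset of the line.  (It is the completion of such a measure that is isomorphic
  mod 0 to an interval with Lebesgue measure plus atoms.)\<close>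

definition lebesgue_space :: "'a measure \<Rightarrow> bool" where
  "lebesgue_space M \<longleftrightarrow> sigma_finite_measure M \<and>
    (\<exists>X0\<in>sets M. space M - X0 \<in> null_sets M \<and>
      (\<exists>B\<in>sets (borel :: real measure).
        \<exists>\<phi>\<in>measurable (restrict_space M X0) (restrict_space borel B).
        \<exists>\<psi>\<in>measurable (restrict_space borel B) (restrict_space M X0).
          (\<forall>x\<in>X0. \<psi> (\<phi> x) = x) \<and> (\<forall>y\<in>B. \<phi> (\<psi> y) = y)))"

text \<open>Representatives of the elements of \<open>L\<^sup>\<infinity>(M)\<close>.\<close>

definition Linf :: "'a measure \<Rightarrow> ('a \<Rightarrow> real) set" where
  "Linf M = {f \<in> borel_measurable M. \<exists>C. AE x in M. \<bar>f x\<bar> \<le> C}"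


section \<open>Borel groupoids\<close>

text \<open>Only the \<open>\<sigma>\<close>-algebras of \<open>objs\<close> and \<open>arrs\<close> matter.  If \<open>src\<close>, \<open>tgt\<close> and \<open>unit_at\<close> are
  measurable then the \<open>\<sigma>\<close>-algebra of \<open>objs\<close> is necessarily the one induced from \<open>arrs\<close> by the
  embedding \<open>unit_at\<close>.\<close>

record ('o, 'g) groupoid =
  objs :: "'o measure"
  arrs :: "'g measure"
  src :: "'g \<Rightarrow> 'o"
  tgt :: "'g \<Rightarrow> 'o"
  unit_at :: "'o \<Rightarrow> 'g"
  gmult :: "'g \<Rightarrow> 'g \<Rightarrow> 'g"
  ginv :: "'g \<Rightarrow> 'g"

definition composable :: "('o, 'g) groupoid \<Rightarrow> ('g \<times> 'g) set" where
  "composable G = {(g, h). g \<in> space (arrs G) \<and> h \<in> space (arrs G) \<and> src G g = tgt G h}"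

definition fibre :: "('o, 'g) groupoid \<Rightarrow> 'o \<Rightarrow> 'g set" where
  "fibre G x = {g \<in> space (arrs G). tgt G g = x}"

locale groupoid =
  fixes G :: "('o, 'g) groupoid"
  assumes src_in: "g \<in> space (arrs G) \<Longrightarrow> src G g \<in> space (objs G)"
    and tgt_in: "g \<in> space (arrs G) \<Longrightarrow> tgt G g \<in> space (objs G)"
    and unit_in: "x \<in> space (objs G) \<Longrightarrow> unit_at G x \<in> space (arrs G)"
    and src_unit: "x \<in> space (objs G) \<Longrightarrow> src G (unit_at G x) = x"
    and tgt_unit: "x \<in> space (objs G) \<Longrightarrow> tgt G (unit_at G x) = x"
    and mult_in: "(g, h) \<in> composable G \<Longrightarrow> gmult G g h \<in> space (arrs G)"
    and src_mult: "(g, h) \<in> composable G \<Longrightarrow> src G (gmult G g h) = src G h"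
    and tgt_mult: "(g, h) \<in> composable G \<Longrightarrow> tgt G (gmult G g h) = tgt G g"
    and mult_assoc: "(g, h) \<in> composable G \<Longrightarrow> (h, k) \<in> composable G \<Longrightarrow>
      gmult G (gmult G g h) k = gmult G g (gmult G h k)"
    and unit_left: "g \<in> space (arrs G) \<Longrightarrow> gmult G (unit_at G (tgt G g)) g = g"
    and unit_right: "g \<in> space (arrs G) \<Longrightarrow> gmult G g (unit_at G (src G g)) = g"
    and inv_in: "g \<in> space (arrs G) \<Longrightarrow> ginv G g \<in> space (arrs G)"
    and src_inv: "g \<in> space (arrs G) \<Longrightarrow> src G (ginv G g) = tgt G g"
    and tgt_inv: "g \<in> space (arrs G) \<Longrightarrow> tgt G (ginv G g) = src G g"
    and inv_left: "g \<in> space (arrs G) \<Longrightarrow> gmult G (ginv G g) g = unit_at G (src G g)"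
    and inv_right: "g \<in> space (arrs G) \<Longrightarrow> gmult G g (ginv G g) = unit_at G (tgt G g)"

locale borel_groupoid = groupoid G for G :: "('o, 'g) groupoid" +
  assumes measurable_src: "src G \<in> measurable (arrs G) (objs G)"
    and measurable_tgt: "tgt G \<in> measurable (arrs G) (objs G)"
    and measurable_unit: "unit_at G \<in> measurable (objs G) (arrs G)"
    and measurable_mult: "(\<lambda>(g, h). gmult G g h) \<in>
      measurable (restrict_space (arrs G \<Otimes>\<^sub>M arrs G) (composable G)) (arrs G)"
    and measurable_inv: "ginv G \<in> measurable (arrs G) (arrs G)"

text \<open>Measures on a fibre \<open>G\<^sup>x\<close> are represented by measures on \<open>G\<close> concentrated on \<open>G\<^sup>x\<close>.  The fibre
  need not belong to the \<open>\<sigma>\<close>-algebra of \<open>arrs\<close>, and maps such as \<open>h \<mapsto> gh\<close> have no meaning (and no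
  measurability) off the fibre; since its complement is contained in a null set, passing to the
  completion takes care of both.\<close>

definition translate :: "('o, 'g) groupoid \<Rightarrow> 'g \<Rightarrow> 'g measure \<Rightarrow> 'g measure" where
  "translate G g \<theta> =
    distr (restrict_space (completion \<theta>) (fibre G (src G g))) (arrs G) (gmult G g)"


section \<open>Measured groupoids\<close>

definition borel_haar_system :: "('o, 'g) groupoid \<Rightarrow> ('o \<Rightarrow> 'g measure) \<Rightarrow> bool" where
  "borel_haar_system G lam \<longleftrightarrow>
    (\<forall>x\<in>space (objs G). sets (lam x) = sets (arrs G) \<and> (AE g in lam x. tgt G g = x)) \<and>
    (\<forall>f \<in> borel_measurable (arrs G).
      (\<lambda>x. \<integral>\<^sup>+ g. (f g :: ennreal) \<partial>lam x) \<in> borel_measurable (objs G)) \<and>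
    (\<exists>f \<in> borel_measurable (arrs G).
      \<forall>x\<in>space (objs G). (\<integral>\<^sup>+ g. (f g :: ennreal) \<partial>lam x) = 1) \<and>
    (\<forall>g\<in>space (arrs G). translate G g (lam (src G g)) = lam (tgt G g))"

text \<open>The measure \<open>\<lambda> \<star> \<mu> = \<integral> \<lambda>\<^sup>x d\<mu>(x)\<close> on \<open>G\<close>.\<close>

definition haar_star ::
    "('o, 'g) groupoid \<Rightarrow> ('o \<Rightarrow> 'g measure) \<Rightarrow> 'o measure \<Rightarrow> 'g measure" where
  "haar_star G lam \<mu> =
    measure_of (space (arrs G)) (sets (arrs G)) (\<lambda>A. \<integral>\<^sup>+ x. emeasure (lam x) A \<partial>\<mu>)"

definition quasi_invariant ::
    "('o, 'g) groupoid \<Rightarrow> ('o \<Rightarrow> 'g measure) \<Rightarrow> 'o measure \<Rightarrow> bool" where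
  "quasi_invariant G lam \<mu> \<longleftrightarrow>
    mutually_ac (haar_star G lam \<mu>) (distr (haar_star G lam \<mu>) (arrs G) (ginv G))"

definition measured_groupoid ::
    "('o, 'g) groupoid \<Rightarrow> ('o \<Rightarrow> 'g measure) \<Rightarrow> 'o measure \<Rightarrow> bool" where
  "measured_groupoid G lam \<mu> \<longleftrightarrow>
    borel_groupoid G \<and> borel_haar_system G lam \<and> sets \<mu> = sets (objs G) \<and>
    quasi_invariant G lam \<mu>"


section \<open>Amenability\<close>

definition ac_system ::
    "('o, 'g) groupoid \<Rightarrow> ('o \<Rightarrow> 'g measure) \<Rightarrow> ('o \<Rightarrow> 'g measure) \<Rightarrow> bool" where
  "ac_system G lam \<theta> \<longleftrightarrow>
    (\<forall>x\<in>space (objs G). sets (\<theta> x) = sets (arrs G) \<and> finite_measure (\<theta> x) \<and>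
      absolutely_continuous (lam x) (\<theta> x)) \<and>
    (\<forall>A\<in>sets (arrs G). (\<lambda>x. emeasure (\<theta> x) A) \<in> borel_measurable (objs G))"

definition conv_arrs ::
    "('o, 'g) groupoid \<Rightarrow> ('o \<Rightarrow> 'g measure) \<Rightarrow> ('g \<Rightarrow> real) \<Rightarrow> 'g \<Rightarrow> real" where
  "conv_arrs G \<theta> f g = (\<integral>h. f (gmult G (ginv G h) g) \<partial>completion (\<theta> (tgt G g)))"

definition conv_objs ::
    "('o, 'g) groupoid \<Rightarrow> ('o \<Rightarrow> 'g measure) \<Rightarrow> ('o \<Rightarrow> real) \<Rightarrow> 'o \<Rightarrow> real" where
  "conv_objs G \<theta> \<phi> x = (\<integral>h. \<phi> (src G h) \<partial>completion (\<theta> x))"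

text \<open>A mean, acting on representatives of classes.  That it is well defined on classes follows from
  linearity and positivity.  For systems \<open>\<theta>\<close> of unbounded total mass \<open>\<theta> * f\<close> need not be in
  \<open>L\<^sup>\<infinity>\<close>, so that applying the mean to it makes sense only under the corresponding condition.\<close>

definition invariant_mean ::
    "('o, 'g) groupoid \<Rightarrow> ('o \<Rightarrow> 'g measure) \<Rightarrow> 'o measure \<Rightarrow>
      (('g \<Rightarrow> real) \<Rightarrow> 'o \<Rightarrow> real) \<Rightarrow> bool" where
  "invariant_mean G lam \<mu> Mean \<longleftrightarrow>
    (\<forall>f\<in>Linf (haar_star G lam \<mu>). Mean f \<in> Linf \<mu>) \<and>
    (\<forall>f\<in>Linf (haar_star G lam \<mu>). \<forall>f'\<in>Linf (haar_star G lam \<mu>). \<forall>a b.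
      AE x in \<mu>. Mean (\<lambda>g. a * f g + b * f' g) x = a * Mean f x + b * Mean f' x) \<and>
    (\<forall>f\<in>Linf (haar_star G lam \<mu>).
      (AE g in haar_star G lam \<mu>. 0 \<le> f g) \<longrightarrow> (AE x in \<mu>. 0 \<le> Mean f x)) \<and>
    (AE x in \<mu>. Mean (\<lambda>_. 1) x = 1) \<and>
    (\<forall>\<theta> f. ac_system G lam \<theta> \<longrightarrow> f \<in> Linf (haar_star G lam \<mu>) \<longrightarrow>
      conv_arrs G \<theta> f \<in> Linf (haar_star G lam \<mu>) \<longrightarrow>
      (AE x in \<mu>. Mean (conv_arrs G \<theta> f) x = conv_objs G \<theta> (Mean f) x))"

definition amenable ::
    "('o, 'g) groupoid \<Rightarrow> ('o \<Rightarrow> 'g measure) \<Rightarrow> 'o measure \<Rightarrow> bool" where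
  "amenable G lam \<mu> \<longleftrightarrow> (\<exists>Mean. invariant_mean G lam \<mu> Mean)"


section \<open>Groupoid spaces and semi-direct products\<close>

record ('o, 'g, 'y) gspace =
  pts :: "'y measure"
  proj :: "'y \<Rightarrow> 'o"
  act :: "'g \<Rightarrow> 'y \<Rightarrow> 'y"

definition actable :: "('o, 'g) groupoid \<Rightarrow> ('o, 'g, 'y) gspace \<Rightarrow> ('g \<times> 'y) set" where
  "actable G X = {(g, x). g \<in> space (arrs G) \<and> x \<in> space (pts X) \<and> src G g = proj X x}"

locale borel_gspace = borel_groupoid G
  for G :: "('o, 'g) groupoid" and X :: "('o, 'g, 'y) gspace" +
  assumes measurable_proj: "proj X \<in> measurable (pts X) (objs G)"
    and measurable_act: "(\<lambda>(g, x). act X g x) \<in>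
      measurable (restrict_space (arrs G \<Otimes>\<^sub>M pts X) (actable G X)) (pts X)"
    and proj_act: "(g, x) \<in> actable G X \<Longrightarrow> proj X (act X g x) = tgt G g"
    and act_unit: "x \<in> space (pts X) \<Longrightarrow> act X (unit_at G (proj X x)) x = x"
    and act_act: "(g, h) \<in> composable G \<Longrightarrow> (h, x) \<in> actable G X \<Longrightarrow>
      act X g (act X h x) = act X (gmult G g h) x"

definition semidirect ::
    "('o, 'g) groupoid \<Rightarrow> ('o, 'g, 'y) gspace \<Rightarrow> ('y, 'y \<times> 'g \<times> 'y) groupoid" where
  "semidirect G X =
    \<lparr> objs = pts X,
      arrs = restrict_space (pts X \<Otimes>\<^sub>M (arrs G \<Otimes>\<^sub>M pts X))
        ((\<lambda>(g, x). (act X g x, g, x)) ` actable G X),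
      src = (\<lambda>(y, g, x). x),
      tgt = (\<lambda>(y, g, x). y),
      unit_at = (\<lambda>x. (x, unit_at G (proj X x), x)),
      gmult = (\<lambda>(y, g, x) (y', g', x'). (y, gmult G g g', x')),
      ginv = (\<lambda>(y, g, x). (x, ginv G g, y)) \<rparr>"

definition lift_haar :: "('o, 'g) groupoid \<Rightarrow> ('o, 'g, 'y) gspace \<Rightarrow> ('o \<Rightarrow> 'g measure) \<Rightarrow>
    'y \<Rightarrow> ('y \<times> 'g \<times> 'y) measure" where
  "lift_haar G X lam y =
    distr (restrict_space (completion (lam (proj X y))) (fibre G (proj X y)))
      (arrs (semidirect G X)) (\<lambda>g. (y, g, act X (ginv G g) y))"


section \<open>Invariant Markov operators\<close>

text \<open>A Markov operator \<open>P\<close> is represented by its family \<open>\<pi>\<close> of transition probabilities; in this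
  notation \<open>\<theta>P\<close> is \<open>\<theta> \<bind> \<pi>\<close>.\<close>

definition P_adapted :: "('a \<Rightarrow> 'a measure) \<Rightarrow> 'a measure \<Rightarrow> bool" where
  "P_adapted \<pi> m \<longleftrightarrow> sigma_finite_measure m \<and> absolutely_continuous m (m \<bind> \<pi>)"

definition invariant_markov :: "('o, 'g) groupoid \<Rightarrow> ('o \<Rightarrow> 'g measure) \<Rightarrow> 'o measure \<Rightarrow>
    ('g \<Rightarrow> 'g measure) \<Rightarrow> bool" where
  "invariant_markov G lam \<mu> \<pi> \<longleftrightarrow>
    \<pi> \<in> measurable (arrs G) (prob_algebra (arrs G)) \<and>
    (\<forall>g\<in>space (arrs G). AE h in \<pi> g. tgt G h = tgt G g) \<and>
    (\<forall>(g', g)\<in>composable G. \<pi> (gmult G g' g) = translate G g' (\<pi> g)) \<and>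
    P_adapted \<pi> (haar_star G lam \<mu>)"


section \<open>Path measures and the Poisson boundary\<close>

abbreviation paths :: "'a measure \<Rightarrow> (nat \<Rightarrow> 'a) measure" where
  "paths M \<equiv> PiM UNIV (\<lambda>_. M)"

definition chain_step ::
    "'a measure \<Rightarrow> ('a \<Rightarrow> 'a measure) \<Rightarrow> 'a \<Rightarrow> nat \<Rightarrow> (nat \<Rightarrow> 'a) \<Rightarrow> 'a measure" where
  "chain_step M \<pi> x n \<omega> = (case n of 0 \<Rightarrow> return M x | Suc k \<Rightarrow> \<pi> (\<omega> k))"

lemma Ionescu_Tulcea_chain_step:
  assumes \<pi>: "\<pi> \<in> measurable M (prob_algebra M)" and x: "x \<in> space M"
  shows "Ionescu_Tulcea (chain_step M \<pi> x) (\<lambda>_. M)"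
proof -
  have *: "chain_step M \<pi> x i \<in> measurable (PiM {0..<i} (\<lambda>_. M)) (prob_algebra M)" for i
  proof (cases i)
    case 0
    then have "chain_step M \<pi> x i = (\<lambda>_. return M x)"
      by (simp add: chain_step_def fun_eq_iff)
    moreover have "return M x \<in> space (prob_algebra M)"
      using x by (simp add: space_prob_algebra prob_space_return)
    ultimately show ?thesis
      by simp
  next
    case (Suc k)
    then have "chain_step M \<pi> x i = (\<lambda>\<omega>. \<pi> (\<omega> k))"
      by (simp add: chain_step_def fun_eq_iff)
    moreover have "(\<lambda>\<omega>. \<omega> k) \<in> measurable (PiM {0..<i} (\<lambda>_. M)) M"
      using Suc by (intro measurable_component_singleton) simp
    ultimately show ?thesis
      using measurable_compose[OF _ \<pi>] by simp
  qed
  show ?thesis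
  proof (rule Ionescu_Tulcea.intro)
    show "chain_step M \<pi> x i \<in> measurable (PiM {0..<i} (\<lambda>_. M)) (subprob_algebra M)" for i
      using * by (rule measurable_prob_algebraD)
    show "prob_space (chain_step M \<pi> x i \<omega>)" if "\<omega> \<in> space (PiM {0..<i} (\<lambda>_. M))" for i \<omega>
      using measurable_space[OF * that] by (simp add: space_prob_algebra)
  qed
qed

text \<open>The law of the chain started at \<open>x\<close>, i.e. the Ionescu-Tulcea limit of the successive
  transitions, and the measure \<open>P\<^sub>m\<close> on the path space for an arbitrary initial measure \<open>m\<close>.
  The argument \<open>M\<close> only serves to fix the Borel structure of the state space.\<close>

definition path_law :: "'a measure \<Rightarrow> ('a \<Rightarrow> 'a measure) \<Rightarrow> 'a \<Rightarrow> (nat \<Rightarrow> 'a) measure" where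
  "path_law M \<pi> x = projective_family.lim UNIV
    (Ionescu_Tulcea.CI (chain_step M \<pi> x) (\<lambda>_. M)) (\<lambda>_. M)"

definition path_measure :: "'a measure \<Rightarrow> ('a \<Rightarrow> 'a measure) \<Rightarrow> 'a measure \<Rightarrow> (nat \<Rightarrow> 'a) measure" where
  "path_measure M \<pi> m = m \<bind> path_law M \<pi>"

definition time_shift :: "(nat \<Rightarrow> 'a) \<Rightarrow> nat \<Rightarrow> 'a" where
  "time_shift \<omega> = (\<lambda>n. \<omega> (Suc n))"

text \<open>The space of ergodic components of the shift, as the maximal measurable quotient constant
  along its orbits, together with a \<open>\<sigma>\<close>-finite measure \<open>\<nu>\<close> in the harmonic measure class.  A quotient
  of a Lebesgue space is again Lebesgue; as Lebesgue spaces embed into the line mod 0, maximality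
  need only be tested against real-valued quotient maps.\<close>

definition poisson_boundary :: "'a measure \<Rightarrow> 'a measure \<Rightarrow> ('a \<Rightarrow> 'a measure) \<Rightarrow>
    'y measure \<Rightarrow> ((nat \<Rightarrow> 'a) \<Rightarrow> 'y) \<Rightarrow> 'y measure \<Rightarrow> bool" where
  "poisson_boundary M m \<pi> \<Gamma> bnd \<nu> \<longleftrightarrow>
    bnd \<in> measurable (paths M) \<Gamma> \<and>
    (AE \<omega> in path_measure M \<pi> m. bnd (time_shift \<omega>) = bnd \<omega>) \<and>
    (\<forall>f \<in> borel_measurable (paths M).
      (AE \<omega> in path_measure M \<pi> m. f (time_shift \<omega>) = (f \<omega> :: real)) \<longrightarrow>
      (\<exists>F \<in> borel_measurable \<Gamma>. AE \<omega> in path_measure M \<pi> m. f \<omega> = F (bnd \<omega>))) \<and>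
    sets \<nu> = sets \<Gamma> \<and> lebesgue_space \<nu> \<and>
    mutually_ac (distr (path_measure M \<pi> m) \<Gamma> bnd) \<nu>"

text \<open>The \<open>G\<close>-space structure \<open>X\<close> on the boundary descends from the coordinatewise action on paths.
  As \<open>bnd\<close> is only determined mod 0, equivariance is required for almost every \<open>g\<close> and almost every
  path over \<open>src g\<close>.\<close>

definition boundary_action :: "('o, 'g) groupoid \<Rightarrow> ('o \<Rightarrow> 'g measure) \<Rightarrow> 'o measure \<Rightarrow>
    ('g \<Rightarrow> 'g measure) \<Rightarrow> ('o, 'g, 'y) gspace \<Rightarrow> ((nat \<Rightarrow> 'g) \<Rightarrow> 'y) \<Rightarrow> bool" where
  "boundary_action G lam \<mu> \<pi> X bnd \<longleftrightarrow>
    borel_gspace G X \<and>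
    (AE \<omega> in path_measure (arrs G) \<pi> (haar_star G lam \<mu>). proj X (bnd \<omega>) = tgt G (\<omega> 0)) \<and>
    (AE g in haar_star G lam \<mu>. AE \<omega> in path_measure (arrs G) \<pi> (lam (src G g)).
      bnd (\<lambda>n. gmult G g (\<omega> n)) = act X g (bnd \<omega>))"

end

theory Submission
  imports Defs
begin

text \<open>Write \<open>H = G \<ltimes> \<Gamma>\<close> for the Poisson extension and \<open>F(y, g) = f(y, g, g\<^sup>-\<^sup>1 y)\<close> for a bounded function
  \<open>f\<close> on \<open>H\<close>.  An invariant mean is obtained by averaging \<open>F\<close> along the sample paths of the chain:
  let \<open>\<phi>\<^sub>n(\<omega>)\<close> be the integral of \<open>F(bnd \<omega>, \<omega>\<^sub>n k)\<close> over \<open>k\<close> with respect to a probability measure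
  \<open>\<kappa>\<^sup>x\<close> equivalent to \<open>\<lambda>\<^sup>x\<close>, where \<open>x\<close> is the source of \<open>\<omega>\<^sub>n\<close>.  (The extra factor \<open>k\<close> is what makes
  \<open>\<phi>\<^sub>n\<close> depend on the class of \<open>f\<close> only: the pair \<open>(bnd \<omega>, \<omega>\<^sub>n)\<close> itself may live on a null set.)
  Since \<open>bnd\<close> is shift invariant, \<open>\<phi>\<^sub>n \<circ> T = \<phi>\<^sub>n\<^sub>+\<^sub>1\<close>.  A Banach limit of the functionals
  \<open>u \<mapsto> \<integral> u \<phi>\<^sub>n\<close> on \<open>L\<^sup>1\<close> of the path space is represented, by the Radon-Nikodym theorem, by a bounded
  function \<open>\<phi>\<close>; shift invariance of the Banach limit and nonsingularity of \<open>T\<close> give \<open>\<phi> \<circ> T = \<phi>\<close>, so by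
  maximality of the Poisson boundary \<open>\<phi> = \<Phi> \<circ> bnd\<close>, and \<open>f \<mapsto> \<Phi>\<close> is the mean (\<open>mean_lim_exists\<close>).

  The mean is invariant because the whole construction is equivariant.  For a system \<open>\<theta>\<close>, the function
  \<open>\<phi>\<^sub>n\<close> of \<open>\<theta> * f\<close> at \<open>\<omega>\<close> is the \<open>\<theta>\<close>-average of \<open>\<phi>\<^sub>n\<close> of \<open>f\<close> over the translates \<open>h\<^sup>-\<^sup>1 \<omega>\<close>, and this averaging
  operator is weak-star continuous since translation of paths is nonsingular (\<open>mean_lim_translate\<close>).
  Nonsingularity (\<open>AE_inverse_translate\<close>) follows from the equivariance of the path laws, the
  invariance of the Haar system and the quasi-invariance of \<open>\<mu>\<close>; it also yields the
  quasi-invariance of the harmonic measure class on \<open>H\<close>.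

  The set of composable pairs of a general Borel groupoid need not be measurable.  Because \<open>(G, \<lambda> \<star> \<mu>)\<close> is a
  Lebesgue space, however, the measures \<open>\<lambda>\<^sup>x\<close> with \<open>x\<close> in a conull Borel set \<open>U\<close> are
  \<open>\<sigma>\<close>-finite and the Borel structure separates the points of \<open>U\<close> by countably many sets: measures on distinct
  fibres are mutually singular, hence distinguished by countably many numbers (\<open>normalization\<close>).  Over \<open>U\<close> all partial
  operations extend to everywhere defined measurable maps, and the fibre measures become probability kernels.\<close>

section \<open>Banach limits and weak-star limits\<close>

lemma Bseq_lincomb:
  fixes a b :: "nat \<Rightarrow> real"
  assumes "Bseq a" "Bseq b" shows "Bseq (\<lambda>n. c * a n + d * b n)"
proof -
  obtain K K' where "\<And>n. \<bar>a n\<bar> \<le> K" "\<And>n. \<bar>b n\<bar> \<le> K'"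
    using assms by (auto simp: Bseq_def)
  then have "\<bar>c * a n + d * b n\<bar> \<le> \<bar>c\<bar> * K + \<bar>d\<bar> * K'" for n
    by (intro order_trans[OF abs_triangle_ineq] add_mono) (auto simp: abs_mult intro!: mult_left_mono)
  then show ?thesis by (intro BseqI') auto
qed

text \<open>A cluster point, in the compact product of the ranges of all bounded sequences, of the evaluations
  at \<open>n\<close>.  It lies in every closed set that eventually contains these evaluations, so every closed relation
  between the terms of bounded sequences passes to it.\<close>

lemma bounded_seq_cluster:
  "\<exists>L :: (nat \<Rightarrow> real) \<Rightarrow> real. \<forall>S. closed S \<and> (\<forall>\<^sub>F n in sequentially. (\<lambda>a. if Bseq a then a n else 0) \<in> S) \<longrightarrow> L \<in> S"
proof -
  define ev :: "nat \<Rightarrow> (nat \<Rightarrow> real) \<Rightarrow> real" where "ev n a = (if Bseq a then a n else 0)" for n a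
  define r :: "(nat \<Rightarrow> real) \<Rightarrow> real" where "r a = (SOME K. Bseq a \<longrightarrow> (\<forall>n. norm (a n) \<le> K))" for a
  have r: "\<bar>a n\<bar> \<le> r a" if a: "Bseq a" for a n
  proof -
    have "\<exists>K. Bseq a \<longrightarrow> (\<forall>n. norm (a n) \<le> K)"
      using a by (auto simp: Bseq_def)
    from someI_ex[OF this] a show ?thesis
      by (auto simp: r_def)
  qed
  define K where "K = PiE UNIV (\<lambda>a. {- \<bar>r a\<bar> .. \<bar>r a\<bar>})"
  have "compactin (product_topology (\<lambda>_. euclidean) UNIV) K"
    unfolding K_def by (subst compactin_PiE) auto
  then have K: "compact K"
    by (simp add: euclidean_product_topology)
  have evK: "ev n \<in> K" for n
  proof -
    have "\<bar>ev n a\<bar> \<le> \<bar>r a\<bar>" for a using r[of a n] by (cases "Bseq a") (auto simp: ev_def)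
    then show ?thesis by (auto simp: K_def abs_le_iff minus_le_iff)
  qed
  have ne: "filtermap ev sequentially \<noteq> bot"
    by (simp add: filtermap_bot_iff)
  have "\<exists>L\<in>K. inf (nhds L) (filtermap ev sequentially) \<noteq> bot"
    using K ne evK unfolding compact_filter by (auto simp: eventually_filtermap)
  then obtain L where L: "inf (nhds L) (filtermap ev sequentially) \<noteq> bot" by auto
  have "L \<in> S" if "closed S" "\<forall>\<^sub>F n in sequentially. ev n \<in> S" for S
  proof (rule ccontr)
    assume "L \<notin> S"
    then have "eventually (\<lambda>x. x \<in> - S) (nhds L)"
      using that(1) by (intro eventually_nhds_in_open) auto
    moreover have "eventually (\<lambda>x. x \<in> S) (filtermap ev sequentially)"
      using that(2) by (simp add: eventually_filtermap)
    ultimately have "eventually (\<lambda>x. False) (inf (nhds L) (filtermap ev sequentially))"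
      unfolding eventually_inf by (intro exI conjI) (assumption, assumption, auto)
    with L show False by (simp add: trivial_limit_def)
  qed
  then show ?thesis
    unfolding ev_def[abs_def] by (intro exI[of _ L]) (simp add: ev_def[abs_def])
qed

text \<open>Applying a generalized limit to the Cesaro means instead of to the sequence makes it invariant under
  the shift.\<close>

definition cesaro :: "(nat \<Rightarrow> real) \<Rightarrow> nat \<Rightarrow> real" where
  "cesaro a n = (\<Sum>k<n. a k) / real n"

lemma cesaro_bound: "(\<And>n. \<bar>a n\<bar> \<le> C) \<Longrightarrow> \<bar>cesaro a n\<bar> \<le> C"
proof -
  assume a: "\<And>n. \<bar>a n\<bar> \<le> C"
  then have C: "0 \<le> C" using abs_ge_zero order_trans by blast
  have "\<bar>\<Sum>k<n. a k\<bar> \<le> (\<Sum>k<n. \<bar>a k\<bar>)" by (rule sum_abs)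
  also have "\<dots> \<le> (\<Sum>k<n. C)" using a by (intro sum_mono) auto
  finally show ?thesis using C
    by (cases "n = 0") (auto simp: cesaro_def field_simps)
qed

lemma Bseq_cesaro: "Bseq a \<Longrightarrow> Bseq (cesaro a)"
  using cesaro_bound[of a] unfolding Bseq_def by (metis real_norm_def)

definition banach_limit :: "((nat \<Rightarrow> real) \<Rightarrow> real) \<Rightarrow> bool" where
  "banach_limit L \<longleftrightarrow>
    (\<forall>a b c d. Bseq a \<longrightarrow> Bseq b \<longrightarrow> L (\<lambda>n. c * a n + d * b n) = c * L a + d * L b) \<and>
    (\<forall>a. Bseq a \<longrightarrow> (\<forall>n. 0 \<le> a n) \<longrightarrow> 0 \<le> L a) \<and>
    (\<forall>c. L (\<lambda>_. c) = c) \<and>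
    (\<forall>a. Bseq a \<longrightarrow> L (\<lambda>n. a (Suc n)) = L a)"

lemma banach_limit_exists: "\<exists>L. banach_limit L"
proof -
  obtain L0 :: "(nat \<Rightarrow> real) \<Rightarrow> real" where
    L0': "\<forall>S. closed S \<and> (\<forall>\<^sub>F n in sequentially. (\<lambda>a. if Bseq a then a n else 0) \<in> S) \<longrightarrow> L0 \<in> S"
    using bounded_seq_cluster by (elim exE)
  have L0: "L0 \<in> S" if "closed S" "\<forall>\<^sub>F n in sequentially. (\<lambda>a. if Bseq a then a n else 0) \<in> S" for S
    using L0' that by (elim allE[of _ S] impE conjI)
  have cont: "continuous_on UNIV (\<lambda>x :: (nat \<Rightarrow> real) \<Rightarrow> real. x a)" for a
    by (rule continuous_on_product_coordinates)
  have lin: "L0 (\<lambda>n. c * a n + d * b n) = c * L0 a + d * L0 b" if "Bseq a" "Bseq b" for a b c d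
  proof -
    have B: "Bseq (\<lambda>n. c * a n + d * b n)"
      using that by (rule Bseq_lincomb)
    have "L0 \<in> {x. x (\<lambda>n. c * a n + d * b n) = c * x a + d * x b}"
    proof (rule L0)
      show "closed {x :: (nat \<Rightarrow> real) \<Rightarrow> real. x (\<lambda>n. c * a n + d * b n) = c * x a + d * x b}"
        by (intro closed_Collect_eq continuous_on_add continuous_on_mult continuous_on_const cont)
    qed (use that B in simp)
    then show ?thesis by simp
  qed
  have pos: "0 \<le> L0 a" if "Bseq a" "\<And>n. 0 \<le> a n" for a
  proof -
    have "L0 \<in> {x. 0 \<le> x a}"
      using that by (intro L0 closed_Collect_le continuous_intros cont) auto
    then show ?thesis by simp
  qed
  have le: "L0 a \<le> c" if "Bseq a" "\<forall>\<^sub>F n in sequentially. a n \<le> c" for a c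
  proof -
    have "L0 \<in> {x. x a \<le> c}"
      using that by (intro L0 closed_Collect_le continuous_intros cont) auto
    then show ?thesis by simp
  qed
  have ge: "c \<le> L0 a" if "Bseq a" "\<forall>\<^sub>F n in sequentially. c \<le> a n" for a c
  proof -
    have "L0 \<in> {x. c \<le> x a}"
      using that by (intro L0 closed_Collect_le continuous_intros cont) auto
    then show ?thesis by simp
  qed
  have lim: "L0 a = l" if "a \<longlonglongrightarrow> l" for a l
  proof (rule antisym)
    have a: "Bseq a" using that by (intro convergent_imp_Bseq) (auto simp: convergent_def)
    show "L0 a \<le> l"
    proof (rule field_le_epsilon)
      fix e :: real assume "0 < e"
      then have "\<forall>\<^sub>F n in sequentially. a n < l + e"
        using order_tendstoD(2)[OF that, of "l + e"] by simp
      then show "L0 a \<le> l + e"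
        using a by (intro le) (auto elim: eventually_mono)
    qed
    show "l \<le> L0 a"
    proof (rule field_le_epsilon)
      fix e :: real assume "0 < e"
      then have "\<forall>\<^sub>F n in sequentially. l - e < a n"
        using order_tendstoD(1)[OF that, of "l - e"] by simp
      then have "l - e \<le> L0 a"
        using a by (intro ge) (auto elim: eventually_mono)
      then show "l \<le> L0 a + e" by simp
    qed
  qed
  have "banach_limit (\<lambda>a. L0 (cesaro a))"
    unfolding banach_limit_def
  proof (intro conjI allI impI)
    fix a b :: "nat \<Rightarrow> real" and c d assume ab: "Bseq a" "Bseq b"
    have "cesaro (\<lambda>n. c * a n + d * b n) = (\<lambda>n. c * cesaro a n + d * cesaro b n)"
      by (simp add: cesaro_def fun_eq_iff sum.distrib sum_distrib_left add_divide_distrib)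
    then show "L0 (cesaro (\<lambda>n. c * a n + d * b n)) = c * L0 (cesaro a) + d * L0 (cesaro b)"
      using ab by (simp add: lin Bseq_cesaro)
  next
    fix a :: "nat \<Rightarrow> real" assume "Bseq a" "\<forall>n. 0 \<le> a n"
    then show "0 \<le> L0 (cesaro a)"
      by (intro pos Bseq_cesaro) (auto simp: cesaro_def intro!: divide_nonneg_nonneg sum_nonneg)
  next
    fix c :: real
    have "cesaro (\<lambda>_. c) \<longlonglongrightarrow> c"
      by (rule tendsto_eventually)
         (auto simp: cesaro_def eventually_sequentially intro!: exI[of _ 1])
    then show "L0 (cesaro (\<lambda>_. c)) = c" by (rule lim)
  next
    fix a :: "nat \<Rightarrow> real" assume a: "Bseq a"
    have aS: "Bseq (\<lambda>n. a (Suc n))" using a by (simp add: Bseq_Suc_iff)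
    obtain K where K: "\<And>n. \<bar>a n\<bar> \<le> K" using a by (auto simp: Bseq_def)
    have "(\<lambda>n. 1 * cesaro (\<lambda>n. a (Suc n)) n + (-1) * cesaro a n) \<longlonglongrightarrow> 0"
    proof (rule Lim_null_comparison)
      show "(\<lambda>n. (2 * K) / real n) \<longlonglongrightarrow> 0" by (rule lim_const_over_n)
      have "norm (1 * cesaro (\<lambda>n. a (Suc n)) n + (-1) * cesaro a n) \<le> 2 * K / real n" for n
      proof -
        have "1 * cesaro (\<lambda>n. a (Suc n)) n + (-1) * cesaro a n
            = ((\<Sum>k<n. a (Suc k)) - (\<Sum>k<n. a k)) / real n"
          by (simp add: cesaro_def diff_divide_distrib)
        also have "(\<Sum>k<n. a (Suc k)) - (\<Sum>k<n. a k) = a n - a 0"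
          by (simp flip: sum_subtractf add: sum_lessThan_telescope)
        also have "norm ((a n - a 0) / real n) \<le> 2 * K / real n"
          using K[of n] K[of 0] by (auto intro!: divide_right_mono)
        finally show ?thesis .
      qed
      then show "\<forall>\<^sub>F n in sequentially. norm (1 * cesaro (\<lambda>n. a (Suc n)) n + (-1) * cesaro a n) \<le> 2 * K / real n"
        by simp
    qed
    from lim[OF this] show "L0 (cesaro (\<lambda>n. a (Suc n))) = L0 (cesaro a)"
      using lin[OF Bseq_cesaro[OF aS] Bseq_cesaro[OF a], of 1 "-1"] by simp
  qed
  then show ?thesis by blast
qed

context
  fixes L assumes L: "banach_limit L"
begin

lemma banach_limit_lincomb:
  "Bseq a \<Longrightarrow> Bseq b \<Longrightarrow> L (\<lambda>n. c * a n + d * b n) = c * L a + d * L b"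
  using L by (auto simp: banach_limit_def)

lemma banach_limit_add: "Bseq a \<Longrightarrow> Bseq b \<Longrightarrow> L (\<lambda>n. a n + b n) = L a + L b"
  using banach_limit_lincomb[of a b 1 1] by simp

lemma banach_limit_cmult: "Bseq a \<Longrightarrow> L (\<lambda>n. c * a n) = c * L a"
  using banach_limit_lincomb[of a a c 0] by simp

lemma banach_limit_const: "L (\<lambda>_. c) = c"
  using L by (auto simp: banach_limit_def)

lemma banach_limit_Suc: "Bseq a \<Longrightarrow> L (\<lambda>n. a (Suc n)) = L a"
  using L by (auto simp: banach_limit_def)

lemma banach_limit_mono:
  assumes "Bseq a" "Bseq b" "\<And>n. a n \<le> b n" shows "L a \<le> L b"
proof -
  have "Bseq (\<lambda>n. 1 * b n + (-1) * a n)"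
    using assms by (intro Bseq_lincomb)
  then have "0 \<le> L (\<lambda>n. 1 * b n + (-1) * a n)"
    using L assms(3) unfolding banach_limit_def by auto
  then show ?thesis
    using banach_limit_lincomb[of b a 1 "-1"] assms by simp
qed

lemma banach_limit_bound:
  assumes "\<And>n. \<bar>a n\<bar> \<le> C" shows "\<bar>L a\<bar> \<le> C"
proof -
  have a: "Bseq a" using assms by (intro BseqI'[of _ C]) auto
  have "L a \<le> L (\<lambda>_. C)" "L (\<lambda>_. -C) \<le> L a"
    using assms by (auto intro!: banach_limit_mono a Bfun_const simp: abs_le_iff minus_le_iff)
  then show ?thesis by (simp add: banach_limit_const)
qed

end

lemma (in finite_measure) AE_nonneg_of_set_integrals:
  fixes f :: "'a \<Rightarrow> real"
  assumes f: "integrable M f" and nn: "\<And>A. A \<in> sets M \<Longrightarrow> 0 \<le> (\<integral>x. indicator A x * f x \<partial>M)"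
  shows "AE x in M. 0 \<le> f x"
proof -
  have [measurable]: "f \<in> borel_measurable M" using f by auto
  let ?A = "{x\<in>space M. f x < 0}"
  have i: "integrable M (\<lambda>x. - (indicator ?A x * f x))"
    using integrable_mult_indicator[of ?A M f] f by auto
  have "(\<integral>x. - (indicator ?A x * f x) \<partial>M) \<le> 0"
    using nn[of ?A] by simp
  moreover have "0 \<le> (\<integral>x. - (indicator ?A x * f x) \<partial>M)"
    by (rule integral_nonneg_AE) (auto simp: indicator_def)
  ultimately have "(\<integral>x. - (indicator ?A x * f x) \<partial>M) = 0" by simp
  then have "AE x in M. - (indicator ?A x * f x) = 0"
    by (subst (asm) integral_nonneg_eq_0_iff_AE[OF i]) (auto simp: indicator_def)
  then show ?thesis
    by (rule AE_mp) (auto simp: indicator_def intro!: AE_I2)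
qed

lemma (in finite_measure) AE_eq_of_set_integrals:
  fixes f g :: "'a \<Rightarrow> real"
  assumes f: "integrable M f" and g: "integrable M g"
    and eq: "\<And>A. A \<in> sets M \<Longrightarrow> (\<integral>x. indicator A x * f x \<partial>M) = (\<integral>x. indicator A x * g x \<partial>M)"
  shows "AE x in M. f x = g x"
proof -
  have i: "integrable M (\<lambda>x. indicator A x * f x)" "integrable M (\<lambda>x. indicator A x * g x)"
    if "A \<in> sets M" for A
    using integrable_mult_indicator[OF that f] integrable_mult_indicator[OF that g] by auto
  have "AE x in M. 0 \<le> f x - g x" "AE x in M. 0 \<le> g x - f x"
    using eq i f g by (intro AE_nonneg_of_set_integrals; simp add: right_diff_distrib)+
  then show ?thesis by eventually_elim simp
qed

lemma (in finite_measure) integrable_AE_bounded: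
  fixes f :: "'a \<Rightarrow> real"
  assumes "f \<in> borel_measurable M" "AE x in M. \<bar>f x\<bar> \<le> C"
  shows "integrable M f"
  using assms by (intro integrable_const_bound[where B=C]) auto

lemma (in finite_measure) abs_integral_mult_bound:
  fixes f u :: "'a \<Rightarrow> real"
  assumes u: "integrable M u" and f: "f \<in> borel_measurable M" "AE x in M. \<bar>f x\<bar> \<le> C"
  shows "integrable M (\<lambda>x. u x * f x)" "\<bar>\<integral>x. u x * f x \<partial>M\<bar> \<le> C * (\<integral>x. \<bar>u x\<bar> \<partial>M)"
proof -
  have m[measurable]: "u \<in> borel_measurable M" "f \<in> borel_measurable M" using u f by auto
  have iu: "integrable M (\<lambda>x. C * \<bar>u x\<bar>)" using u by auto
  have b: "AE x in M. \<bar>u x * f x\<bar> \<le> C * \<bar>u x\<bar>"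
    using f(2) by eventually_elim (auto simp: abs_mult mult.commute intro!: mult_right_mono)
  show i: "integrable M (\<lambda>x. u x * f x)"
    using iu by (rule Bochner_Integration.integrable_bound) (use b in \<open>auto intro: AE_mp\<close>)
  have "\<bar>\<integral>x. u x * f x \<partial>M\<bar> \<le> (\<integral>x. \<bar>u x * f x\<bar> \<partial>M)" by (rule integral_abs_bound)
  also have "\<dots> \<le> (\<integral>x. C * \<bar>u x\<bar> \<partial>M)"
    using i iu b by (intro integral_mono_AE) auto
  finally show "\<bar>\<integral>x. u x * f x \<partial>M\<bar> \<le> C * (\<integral>x. \<bar>u x\<bar> \<partial>M)" by simp
qed

text \<open>The set function \<open>A \<mapsto> L (\<integral>\<^sub>A \<phi>\<^sub>n)\<close> is dominated by a multiple of the measure and therefore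
  countably additive, although \<open>L\<close> itself commutes with finite sums only; its density is the
  limit.  This is the weak-star compactness of balls in \<open>L\<^sup>\<infinity>\<close>, with a choice of limits that
  is linear in the sequence.\<close>

lemma (in finite_measure) weak_star_limit:
  fixes \<phi> :: "nat \<Rightarrow> 'a \<Rightarrow> real"
  assumes L: "banach_limit L"
    and m[measurable]: "\<And>n. \<phi> n \<in> borel_measurable M" and b: "\<And>n. AE x in M. \<bar>\<phi> n x\<bar> \<le> C"
  obtains \<psi> where "\<psi> \<in> borel_measurable M" "AE x in M. \<bar>\<psi> x\<bar> \<le> C"
    "\<And>u. integrable M u \<Longrightarrow> L (\<lambda>n. \<integral>x. u x * \<phi> n x \<partial>M) = (\<integral>x. u x * \<psi> x \<partial>M)"
proof -
  note I = abs_integral_mult_bound[OF _ m b]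
  define C' where "C' = \<bar>C\<bar>"
  have C': "0 \<le> C'" "C \<le> C'" by (auto simp: C'_def)
  have b': "AE x in M. \<bar>\<phi> n x\<bar> \<le> C'" for n using b[of n] C' by (auto elim!: AE_mp)
  have B: "Bseq (\<lambda>n. \<integral>x. u x * \<phi> n x \<partial>M)" if "integrable M u" for u
    using I(2)[OF that] by (intro BseqI') auto
  define l where "l u = L (\<lambda>n. \<integral>x. u x * \<phi> n x \<partial>M)" for u
  have l_lin: "l (\<lambda>x. u x + v x) = l u + l v" if "integrable M u" "integrable M v" for u v
    using that by (simp add: l_def distrib_right I(1) banach_limit_add[OF L] B)
  have l_cm: "l (\<lambda>x. c * u x) = c * l u" if "integrable M u" for u c
    using that by (simp add: l_def mult.assoc banach_limit_cmult[OF L] B)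
  have l_b: "\<bar>l u\<bar> \<le> C * (\<integral>x. \<bar>u x\<bar> \<partial>M)" if "integrable M u" for u
    unfolding l_def by (rule banach_limit_bound[OF L I(2)[OF that]])
  \<comment> \<open>shift by the bound so that the set function becomes nonnegative\<close>
  define \<nu> where "\<nu> A = l (indicator A) + C' * measure M A" for A
  have int_ind: "integrable M (indicator A :: 'a \<Rightarrow> real)" if "A \<in> sets M" for A
    using that by (auto simp: integrable_indicator_iff emeasure_finite less_top[symmetric])
  have l_ind: "\<bar>l (indicator A)\<bar> \<le> C' * measure M A" if A: "A \<in> sets M" for A
  proof -
    have "\<bar>l (indicator A)\<bar> \<le> C * (\<integral>x. \<bar>indicator A x\<bar> \<partial>M)"
      by (rule l_b[OF int_ind[OF A]])
    also have "(\<integral>x. \<bar>indicator A x\<bar> \<partial>M) = measure M A"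
      using A by simp
    also have "C * measure M A \<le> C' * measure M A" by (intro mult_right_mono C') auto
    finally show ?thesis .
  qed
  have \<nu>_b: "0 \<le> \<nu> A" "\<nu> A \<le> 2 * C' * measure M A" if "A \<in> sets M" for A
    using l_ind[OF that] by (auto simp: \<nu>_def abs_le_iff)
  have \<nu>_add: "\<nu> (A \<union> B) = \<nu> A + \<nu> B" if "A \<in> sets M" "B \<in> sets M" "A \<inter> B = {}" for A B
  proof -
    have "(indicator (A \<union> B) :: 'a \<Rightarrow> real) = (\<lambda>x. indicator A x + indicator B x)"
      using that by (auto simp: indicator_def fun_eq_iff)
    then show ?thesis
      using that by (simp add: \<nu>_def l_lin int_ind finite_measure_Union distrib_left)
  qed
  define N where "N = measure_of (space M) (sets M) (\<lambda>A. ennreal (\<nu> A))"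
  have ca: "countably_additive (sets M) (\<lambda>A. ennreal (\<nu> A))"
  proof (rule sets.empty_continuous_imp_countably_additive)
    show "positive (sets M) (\<lambda>A. ennreal (\<nu> A))"
      using \<nu>_b[of "{}"] by (auto simp: positive_def)
    show "additive (sets M) (\<lambda>A. ennreal (\<nu> A))"
      by (auto simp: additive_def \<nu>_add \<nu>_b ennreal_plus[symmetric] simp del: ennreal_plus)
    fix A :: "nat \<Rightarrow> 'a set" assume A: "range A \<subseteq> sets M" "decseq A" "(\<Inter>i. A i) = {}"
    have "(\<lambda>i. measure M (A i)) \<longlonglongrightarrow> 0"
      using finite_Lim_measure_decseq[of A] A by simp
    then have "(\<lambda>i. 2 * C' * measure M (A i)) \<longlonglongrightarrow> 0"
      by (rule tendsto_mult_right_zero)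
    have "(\<lambda>i. \<nu> (A i)) \<longlonglongrightarrow> 0"
    proof (rule tendsto_sandwich[where f="\<lambda>_. 0" and h="\<lambda>i. 2 * C' * measure M (A i)"])
      show "(\<lambda>i. 2 * C' * measure M (A i)) \<longlonglongrightarrow> 0" by fact
      show "(\<lambda>i. 0 :: real) \<longlonglongrightarrow> 0" by simp
      have "0 \<le> \<nu> (A i) \<and> \<nu> (A i) \<le> 2 * C' * measure M (A i)" for i
        using A \<nu>_b by auto
      then show "\<forall>\<^sub>F i in sequentially. 0 \<le> \<nu> (A i)"
        "\<forall>\<^sub>F i in sequentially. \<nu> (A i) \<le> 2 * C' * measure M (A i)" by auto
    qed
    then show "(\<lambda>i. ennreal (\<nu> (A i))) \<longlonglongrightarrow> 0"
      using tendsto_ennrealI by force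
  qed auto
  have sN[simp, measurable_cong]: "sets N = sets M"
    by (simp add: N_def)
  have eN: "emeasure N A = ennreal (\<nu> A)" if "A \<in> sets M" for A
    using that ca \<nu>_b[of "{}"] unfolding N_def
    by (subst emeasure_measure_of[OF refl sets.space_closed]) (auto simp: positive_def)
  have ac: "absolutely_continuous M N"
    unfolding absolutely_continuous_def
  proof safe
    fix A assume A: "A \<in> null_sets M"
    then have "measure M A = 0" by (simp add: measure_def null_setsD1)
    then show "A \<in> null_sets N"
      using \<nu>_b[of A] A by (intro null_setsI) (auto simp: eN)
  qed
  obtain h where h[measurable]: "h \<in> borel_measurable M" and hN: "density M h = N"
    using Radon_Nikodym[OF ac] by auto
  have hA: "(\<integral>\<^sup>+x. h x * indicator A x \<partial>M) = ennreal (\<nu> A)" if "A \<in> sets M" for A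
    using that by (simp add: eN[symmetric] hN[symmetric] emeasure_density)
  have hfin: "(\<integral>\<^sup>+x. h x \<partial>M) < \<infinity>"
  proof -
    have "(\<integral>\<^sup>+x. h x \<partial>M) = (\<integral>\<^sup>+x. h x * indicator (space M) x \<partial>M)"
      by (intro nn_integral_cong) auto
    also have "\<dots> < \<infinity>" by (subst hA) auto
    finally show ?thesis .
  qed
  have hAE: "AE x in M. h x \<noteq> \<infinity>"
    by (rule nn_integral_PInf_AE) (use hfin in auto)
  define g where "g x = enn2real (h x)" for x
  have [measurable]: "g \<in> borel_measurable M" by (simp add: g_def[abs_def])
  have hg: "AE x in M. h x = ennreal (g x)"
    using hAE by eventually_elim (simp add: g_def less_top)
  have g0: "0 \<le> g x" for x by (simp add: g_def)
  have ig: "integrable M g"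
    using hfin hg g0 by (intro integrableI_nonneg) (auto simp: nn_integral_cong_AE[OF hg, symmetric])
  have igA: "(\<integral>x. indicator A x * g x \<partial>M) = \<nu> A" "integrable M (\<lambda>x. indicator A x * g x)"
    if A[measurable]: "A \<in> sets M" for A
  proof -
    show i: "integrable M (\<lambda>x. indicator A x * g x)"
      using integrable_mult_indicator[OF A ig] by simp
    have "ennreal (\<integral>x. indicator A x * g x \<partial>M) = (\<integral>\<^sup>+x. ennreal (indicator A x * g x) \<partial>M)"
      using i g0 by (intro nn_integral_eq_integral[symmetric]) auto
    also have "\<dots> = (\<integral>\<^sup>+x. h x * indicator A x \<partial>M)"
      using hg by (intro nn_integral_cong_AE) (auto simp: indicator_def elim!: AE_mp)
    also have "\<dots> = ennreal (\<nu> A)" by (rule hA) fact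
    finally show "(\<integral>x. indicator A x * g x \<partial>M) = \<nu> A"
      using \<nu>_b[OF A] g0 by (subst (asm) ennreal_inj) (auto intro!: integral_nonneg_AE)
  qed
  define \<psi> where "\<psi> x = g x - C'" for x
  have m\<psi>[measurable]: "\<psi> \<in> borel_measurable M" by (simp add: \<psi>_def[abs_def])
  have i\<psi>: "integrable M \<psi>" using ig by (simp add: \<psi>_def[abs_def])
  have \<psi>A: "(\<integral>x. indicator A x * \<psi> x \<partial>M) = l (indicator A)" if A: "A \<in> sets M" for A
  proof -
    have "(\<integral>x. indicator A x * \<psi> x \<partial>M) = (\<integral>x. indicator A x * g x - C' * indicator A x \<partial>M)"
      by (simp add: \<psi>_def right_diff_distrib mult.commute)
    also have "\<dots> = \<nu> A - C' * measure M A"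
      using A int_ind[OF A] by (subst Bochner_Integration.integral_diff) (auto simp: igA)
    finally show ?thesis by (simp add: \<nu>_def)
  qed
  have iA\<psi>: "integrable M (\<lambda>x. indicator A x * \<psi> x)" if A: "A \<in> sets M" for A
    using integrable_mult_indicator[OF A i\<psi>] by simp
  have l_indC: "\<bar>l (indicator A)\<bar> \<le> C * measure M A" if A: "A \<in> sets M" for A
    using l_b[OF int_ind[OF A]] A by simp
  have *: "(\<integral>x. indicator A x * C \<partial>M) = C * measure M A" "integrable M (\<lambda>x. indicator A x * C)"
    if "A \<in> sets M" for A
    using that int_ind[OF that] by simp_all
  have "AE x in M. 0 \<le> C - \<psi> x"
  proof (rule AE_nonneg_of_set_integrals)
    fix A assume A: "A \<in> sets M"
    have "(\<integral>x. indicator A x * (C - \<psi> x) \<partial>M) = (\<integral>x. indicator A x * C - indicator A x * \<psi> x \<partial>M)"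
      by (simp add: right_diff_distrib)
    also have "\<dots> = C * measure M A - l (indicator A)"
      by (subst Bochner_Integration.integral_diff) (use A iA\<psi> * \<psi>A in auto)
    finally show "0 \<le> (\<integral>x. indicator A x * (C - \<psi> x) \<partial>M)"
      using l_indC[OF A] by (simp add: abs_le_iff)
  qed (use i\<psi> in simp)
  moreover have "AE x in M. 0 \<le> \<psi> x + C"
  proof (rule AE_nonneg_of_set_integrals)
    fix A assume A: "A \<in> sets M"
    have "(\<integral>x. indicator A x * (\<psi> x + C) \<partial>M) = (\<integral>x. indicator A x * \<psi> x + indicator A x * C \<partial>M)"
      by (simp add: distrib_left)
    also have "\<dots> = l (indicator A) + C * measure M A"
      by (subst Bochner_Integration.integral_add) (use A iA\<psi> * \<psi>A in auto)
    finally show "0 \<le> (\<integral>x. indicator A x * (\<psi> x + C) \<partial>M)"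
      using l_indC[OF A] by (simp add: abs_le_iff)
  qed (use i\<psi> in simp)
  ultimately have b\<psi>: "AE x in M. \<bar>\<psi> x\<bar> \<le> C"
    by eventually_elim auto
  note J = abs_integral_mult_bound[OF _ m\<psi> b\<psi>]
  have "l u = (\<integral>x. u x * \<psi> x \<partial>M)" if "integrable M u" for u
    using that
  proof (induct rule: integrable_induct)
    case (base A c)
    then show ?case
      using l_cm[OF int_ind, of A c] \<psi>A[of A] by (simp add: mult.commute mult.left_commute)
  next
    case (add f g)
    then show ?case by (simp add: l_lin distrib_right J(1))
  next
    \<comment> \<open>both sides are bounded functionals on \<open>L\<^sup>1\<close>, so the identity passes to limits in \<open>L\<^sup>1\<close>\<close>
    case (lim f s)
    have d: "integrable M (\<lambda>x. f x - s i x)" for i using lim by auto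
    have z: "(\<lambda>i. \<integral>x. \<bar>f x - s i x\<bar> \<partial>M) \<longlonglongrightarrow> 0"
    proof -
      have "(\<lambda>i. \<integral>x. \<bar>f x - s i x\<bar> \<partial>M) \<longlonglongrightarrow> (\<integral>x. 0 \<partial>M)"
      proof (rule integral_dominated_convergence[where w="\<lambda>x. 3 * \<bar>f x\<bar>"])
        have "(\<lambda>i. \<bar>f x - s i x\<bar>) \<longlonglongrightarrow> 0" if "x \<in> space M" for x
          using tendsto_diff[OF tendsto_const lim(3)[OF that], of "f x"] by (simp add: tendsto_rabs_zero)
        then show "AE x in M. (\<lambda>i. \<bar>f x - s i x\<bar>) \<longlonglongrightarrow> 0" by auto
        show "AE x in M. norm \<bar>f x - s i x\<bar> \<le> 3 * \<bar>f x\<bar>" for i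
        proof (rule AE_I2)
          fix x assume "x \<in> space M"
          then have "\<bar>s i x\<bar> \<le> 2 * \<bar>f x\<bar>" using lim(4) by simp
          then show "norm \<bar>f x - s i x\<bar> \<le> 3 * \<bar>f x\<bar>"
            using abs_triangle_ineq4[of "f x" "s i x"] by simp
        qed
      qed (use lim d in auto)
      then show ?thesis by simp
    qed
    have 1: "\<bar>l f - (\<integral>x. f x * \<psi> x \<partial>M)\<bar> \<le> 2 * C * (\<integral>x. \<bar>f x - s i x\<bar> \<partial>M)" for i
    proof -
      have "l f = l (\<lambda>x. s i x + (f x - s i x))" by simp
      also have "\<dots> = l (s i) + l (\<lambda>x. f x - s i x)" using lim d by (intro l_lin) auto
      also have "l (s i) = (\<integral>x. s i x * \<psi> x \<partial>M)" by (rule lim)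
      also have "(\<integral>x. s i x * \<psi> x \<partial>M) = (\<integral>x. f x * \<psi> x \<partial>M) - (\<integral>x. (f x - s i x) * \<psi> x \<partial>M)"
        using lim d by (simp add: left_diff_distrib J(1))
      finally have "l f - (\<integral>x. f x * \<psi> x \<partial>M) = l (\<lambda>x. f x - s i x) - (\<integral>x. (f x - s i x) * \<psi> x \<partial>M)"
        by simp
      then show ?thesis using l_b[OF d[of i]] J(2)[OF d[of i]] by linarith
    qed
    have "\<bar>l f - (\<integral>x. f x * \<psi> x \<partial>M)\<bar> \<le> 0"
      by (rule LIMSEQ_le_const[OF tendsto_mult_right_zero[OF z]]) (use 1 in auto)
    then show ?case by simp
  qed
  then show ?thesis
    by (intro that[OF m\<psi> b\<psi>]) (simp add: l_def)
qed

section \<open>Laws of Markov chains\<close>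

text \<open>The expectation of \<open>u\<^sub>0(\<omega>\<^sub>0) u\<^sub>1(\<omega>\<^sub>1) \<dots>\<close> for the chain started at \<open>x\<close>, computed from the first step
  onwards.  The Ionescu-Tulcea construction appends steps at the end; the backward form is the one in
  which the Markov property at time one and equivariance are visible.\<close>

primrec cyl :: "('a \<Rightarrow> 'a measure) \<Rightarrow> ('a \<Rightarrow> ennreal) list \<Rightarrow> 'a \<Rightarrow> ennreal" where
  "cyl \<pi> [] x = 1"
| "cyl \<pi> (u # us) x = u x * (\<integral>\<^sup>+y. cyl \<pi> us y \<partial>\<pi> x)"

locale markov_kernel =
  fixes M :: "'a measure" and \<pi> :: "'a \<Rightarrow> 'a measure"
  assumes pi_prob[measurable]: "\<pi> \<in> measurable M (prob_algebra M)"
begin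

lemma pi_sub[measurable]: "\<pi> \<in> measurable M (subprob_algebra M)"
  using pi_prob by (rule measurable_prob_algebraD)

lemma pi_space: "x \<in> space M \<Longrightarrow> space (\<pi> x) = space M"
  and pi_sets[measurable_cong]: "x \<in> space M \<Longrightarrow> sets (\<pi> x) = sets M"
  using subprob_measurableD[OF pi_sub] by auto

lemma pi_prob_space: "x \<in> space M \<Longrightarrow> prob_space (\<pi> x)"
  using measurable_space[OF pi_prob] by (auto simp: space_prob_algebra)

lemma pi_one: "x \<in> space M \<Longrightarrow> emeasure (\<pi> x) (space M) = 1"
  using prob_space.emeasure_space_1[OF pi_prob_space] pi_space by fastforce

lemma measurable_cyl:
  "(\<And>u. u \<in> set us \<Longrightarrow> u \<in> borel_measurable M) \<Longrightarrow> cyl \<pi> us \<in> borel_measurable M"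
proof (induction us)
  case (Cons u us)
  have [measurable]: "u \<in> borel_measurable M" "cyl \<pi> us \<in> borel_measurable M"
    using Cons by auto
  show ?case by simp
next
  case Nil
  have "cyl \<pi> [] = (\<lambda>_. 1)" by auto
  then show ?case by simp
qed

text \<open>The last factor can be integrated out first, which turns the backward recursion into the forward
  one.\<close>

lemma cyl_snoc2:
  assumes "x \<in> space M"
  shows "cyl \<pi> (us @ [u, v]) x = cyl \<pi> (us @ [\<lambda>y. u y * (\<integral>\<^sup>+z. v z \<partial>\<pi> y)]) x"
  using assms
proof (induction us arbitrary: x)
  case Nil
  have "(\<integral>\<^sup>+z. v z * (\<integral>\<^sup>+w. 1 \<partial>\<pi> z) \<partial>\<pi> x) = (\<integral>\<^sup>+z. v z \<partial>\<pi> x)"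
    using Nil by (intro nn_integral_cong) (simp add: pi_space pi_one)
  moreover have "emeasure (\<pi> x) (space (\<pi> x)) = 1"
    using Nil by (simp add: pi_space pi_one)
  ultimately show ?case by simp
next
  case (Cons w us)
  then have "(\<integral>\<^sup>+y. cyl \<pi> (us @ [u, v]) y \<partial>\<pi> x) = 
    (\<integral>\<^sup>+y. cyl \<pi> (us @ [\<lambda>y. u y * (\<integral>\<^sup>+z. v z \<partial>\<pi> y)]) y \<partial>\<pi> x)"
    by (intro nn_integral_cong) (simp add: pi_space)
  then show ?case by simp
qed

lemma IT: "x \<in> space M \<Longrightarrow> Ionescu_Tulcea (chain_step M \<pi> x) (\<lambda>_. M)"
  by (rule Ionescu_Tulcea_chain_step[OF pi_prob])

context
  fixes x assumes x: "x \<in> space M"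
begin

interpretation IT: Ionescu_Tulcea "chain_step M \<pi> x" "\<lambda>_. M"
  by (rule IT[OF x])

declare IT.C.simps(2) [simp del]

lemma nn_integral_C_cyl:
  assumes us: "\<And>u. u \<in> set us \<Longrightarrow> u \<in> borel_measurable M" and u: "u \<in> borel_measurable M"
  shows "(\<integral>\<^sup>+\<omega>. (\<Prod>i<Suc (length us). ((us @ [u]) ! i) (\<omega> i)) \<partial>IT.C 0 (Suc (length us)) (\<lambda>_. undefined))
    = cyl \<pi> (us @ [u]) x"
  using assms
proof (induction us arbitrary: u rule: rev_induct)
  case Nil
  note [measurable] = Nil(2)
  have s: "(\<lambda>_. undefined) \<in> space (PiM {0..<0::nat} (\<lambda>_. M))" by (simp add: space_PiM)
  have "(\<integral>\<^sup>+\<omega>. u (\<omega> 0) \<partial>IT.C 0 1 (\<lambda>_. undefined)) = (\<integral>\<^sup>+\<omega>. u (\<omega> 0) \<partial>IT.eP 0 (\<lambda>_. undefined))"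
    using s IT.measurable_eP[of 0] by (simp add: bind_return IT.C.simps(2))
  also have "\<dots> = (\<integral>\<^sup>+y. u y \<partial>chain_step M \<pi> x 0 (\<lambda>_. undefined))"
    by (subst IT.nn_integral_eP[OF s]) (auto intro!: measurable_component_singleton measurable_compose[OF _ Nil(2)])
  also have "\<dots> = u x" using x by (simp add: chain_step_def nn_integral_return)
  also have "\<dots> = cyl \<pi> [u] x"
    using x by (simp add: pi_space pi_one)
  finally show ?case by simp
next
  case (snoc w us v)
  let ?n = "Suc (length us)"
  have m[measurable]: "v \<in> borel_measurable M" "w \<in> borel_measurable M" "\<And>i. i < length us \<Longrightarrow> us ! i \<in> borel_measurable M"
    using snoc(2)[of w] snoc(2)[OF in_set_conv_nth[THEN iffD2]] snoc(3) nth_mem[of _ us] snoc(2) by auto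
  have mn: "((us @ [w]) ! i) \<in> borel_measurable M" if "i < ?n" for i
    using that m by (auto simp: nth_append)
  have mn': "((us @ [w, v]) ! i) \<in> borel_measurable M" if "i < Suc ?n" for i
    using that m by (auto simp: nth_append nth_Cons split: nat.split)
  have s: "(\<lambda>_. undefined) \<in> space (PiM {0..<0::nat} (\<lambda>_. M))" by (simp add: space_PiM)
  let ?f = "\<lambda>\<omega>. \<Prod>i<Suc ?n. ((us @ [w, v]) ! i) (\<omega> i)"
  have f: "?f \<in> borel_measurable (PiM {0..<Suc ?n} (\<lambda>_. M))"
  proof (rule borel_measurable_prod_ennreal)
    fix i assume i: "i \<in> {..<Suc ?n}"
    then have "(\<lambda>\<omega>. \<omega> i) \<in> measurable (PiM {0..<Suc ?n} (\<lambda>_. M)) M"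
      by (intro measurable_component_singleton) auto
    then show "(\<lambda>\<omega>. ((us @ [w, v]) ! i) (\<omega> i)) \<in> borel_measurable (PiM {0..<Suc ?n} (\<lambda>_. M))"
      by (rule measurable_compose) (use i in \<open>auto intro!: mn'\<close>)
  qed
  have "(\<integral>\<^sup>+\<omega>. ?f \<omega> \<partial>IT.C 0 (Suc ?n) (\<lambda>_. undefined))
     = (\<integral>\<^sup>+\<omega>. (\<integral>\<^sup>+\<omega>'. ?f \<omega>' \<partial>IT.eP ?n \<omega>) \<partial>IT.C 0 ?n (\<lambda>_. undefined))"
    unfolding IT.C.simps(2)[of 0 ?n]
  proof (subst nn_integral_bind)
    show "?f \<in> borel_measurable (PiM {0..<Suc ?n} (\<lambda>_. M))" by (rule f)
    show "IT.eP (0 + ?n) \<in> measurable (IT.C 0 ?n (\<lambda>_. undefined)) (subprob_algebra (PiM {0..<Suc ?n} (\<lambda>_. M)))"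
    proof -
      have "measurable (IT.C 0 ?n (\<lambda>_. undefined)) N = measurable (PiM {0..<?n} (\<lambda>_. M)) N" for N :: "(nat \<Rightarrow> 'a) measure measure"
        by (rule measurable_cong_sets) (simp_all add: IT.sets_C[OF s])
      then show ?thesis using IT.measurable_eP[of ?n] by (simp del: IT.measurable_eP)
    qed
  qed simp
  also have "\<dots> = (\<integral>\<^sup>+\<omega>. (\<Prod>i<?n. ((us @ [\<lambda>y. w y * (\<integral>\<^sup>+z. v z \<partial>\<pi> y)]) ! i) (\<omega> i)) \<partial>IT.C 0 ?n (\<lambda>_. undefined))"
  proof (rule nn_integral_cong)
    fix \<omega> assume "\<omega> \<in> space (IT.C 0 ?n (\<lambda>_. undefined))"
    then have \<omega>: "\<omega> \<in> space (PiM {0..<?n} (\<lambda>_. M))" using IT.space_C[OF s] by simp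
    then have \<omega>l: "\<omega> (length us) \<in> space M" by (auto simp: space_PiM PiE_iff)
    have "(\<integral>\<^sup>+\<omega>'. ?f \<omega>' \<partial>IT.eP ?n \<omega>) = (\<integral>\<^sup>+y. ?f (fun_upd \<omega> ?n y) \<partial>\<pi> (\<omega> (length us)))"
      by (subst IT.nn_integral_eP[OF \<omega> f]) (simp add: chain_step_def)
    also have "\<dots> = (\<integral>\<^sup>+y. (\<Prod>i<?n. ((us @ [w]) ! i) (\<omega> i)) * v y \<partial>\<pi> (\<omega> (length us)))"
      by (intro nn_integral_cong) (auto simp: nth_append intro!: arg_cong2[where f="(*)"] prod.cong)
    also have "\<dots> = (\<Prod>i<?n. ((us @ [w]) ! i) (\<omega> i)) * (\<integral>\<^sup>+y. v y \<partial>\<pi> (\<omega> (length us)))"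
      using \<omega>l by (intro nn_integral_cmult) (simp add: measurable_cong_sets[OF pi_sets refl] m)
    also have "\<dots> = (\<Prod>i<?n. ((us @ [\<lambda>y. w y * (\<integral>\<^sup>+z. v z \<partial>\<pi> y)]) ! i) (\<omega> i))"
      by (auto simp add: nth_append mult.assoc intro!: arg_cong2[where f="(*)"] prod.cong)
    finally show "(\<integral>\<^sup>+\<omega>'. ?f \<omega>' \<partial>IT.eP ?n \<omega>) = (\<Prod>i<?n. ((us @ [\<lambda>y. w y * (\<integral>\<^sup>+z. v z \<partial>\<pi> y)]) ! i) (\<omega> i))" .
  qed
  also have "\<dots> = cyl \<pi> (us @ [\<lambda>y. w y * (\<integral>\<^sup>+z. v z \<partial>\<pi> y)]) x"
    by (rule snoc(1)) (use snoc(2) in auto)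
  also have "\<dots> = cyl \<pi> (us @ [w, v]) x" by (rule cyl_snoc2[OF x, symmetric])
  finally show ?case by simp
qed

lemma sets_path_law'[simp]: "sets (path_law M \<pi> x) = sets (paths M)"
  and space_path_law'[simp]: "space (path_law M \<pi> x) = space (paths M)"
  by (simp_all add: path_law_def)

lemma prob_space_path_law': "prob_space (path_law M \<pi> x)"
proof -
  have "emeasure (path_law M \<pi> x) (prod_emb UNIV (\<lambda>_. M) {} (space (PiM {} (\<lambda>_. M)))) = emeasure (IT.CI {}) (space (PiM {} (\<lambda>_. M)))"
    unfolding path_law_def by (rule IT.lim) auto
  also have "\<dots> = 1"
    using prob_space.emeasure_space_1[OF IT.PF.prob_space_P[of "{}"]] by (simp add: IT.CI_def)
  also have "prod_emb UNIV (\<lambda>_. M) {} (space (PiM {} (\<lambda>_. M))) = space (path_law M \<pi> x)"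
    by (auto simp: path_law_def prod_emb_def space_PiM)
  finally show ?thesis by (rule prob_spaceI)
qed

lemma emeasure_path_law_cylinder':
  assumes A: "\<And>i. i \<le> n \<Longrightarrow> A i \<in> sets M"
  shows "emeasure (path_law M \<pi> x) {\<omega>\<in>space (paths M). \<forall>i\<le>n. \<omega> i \<in> A i} = cyl \<pi> (map (\<lambda>i. indicator (A i)) [0..<Suc n]) x"
proof -
  let ?J = "{0..<Suc n}"
  have s: "(\<lambda>_. undefined) \<in> space (PiM {0..<0::nat} (\<lambda>_. M))" by (simp add: space_PiM)
  have E: "{\<omega>\<in>space (paths M). \<forall>i\<le>n. \<omega> i \<in> A i} = prod_emb UNIV (\<lambda>_. M) ?J (PiE ?J A)"
    using A[THEN sets.sets_into_space] by (auto simp: prod_emb_def space_PiM PiE_iff restrict_def extensional_def)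
  have S: "PiE ?J A \<in> sets (PiM ?J (\<lambda>_. M))"
    using A by (intro sets_PiM_I_finite) auto
  have up: "IT.up_to ?J = Suc n"
    unfolding IT.up_to_def by (rule Least_equality) (auto simp: not_less_eq_eq)
  have "emeasure (path_law M \<pi> x) {\<omega>\<in>space (paths M). \<forall>i\<le>n. \<omega> i \<in> A i} = emeasure (IT.CI ?J) (PiE ?J A)"
    unfolding path_law_def E by (rule IT.lim) (use S in auto)
  also have "\<dots> = emeasure (IT.C 0 (Suc n) (\<lambda>_. undefined)) (PiE ?J A)"
    using IT.emeasure_CI[of ?J "Suc n", OF _ S] sets.sets_into_space[OF S]
    by (subst IT.emeasure_CI[of ?J "Suc n", OF _ S]) (auto simp: prod_emb_id space_PiM)
  also have "\<dots> = (\<integral>\<^sup>+\<omega>. indicator (PiE ?J A) \<omega> \<partial>IT.C 0 (Suc n) (\<lambda>_. undefined))"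
    using S IT.sets_C[OF s, of "Suc n"] by (subst nn_integral_indicator) auto
  also have "\<dots> = (\<integral>\<^sup>+\<omega>. (\<Prod>i<Suc n. (map (\<lambda>i. indicator (A i)) [0..<Suc n] ! i) (\<omega> i) :: ennreal) \<partial>IT.C 0 (Suc n) (\<lambda>_. undefined))"
  proof (rule nn_integral_cong)
    fix \<omega> assume "\<omega> \<in> space (IT.C 0 (Suc n) (\<lambda>_. undefined))"
    then have \<omega>: "\<omega> \<in> space (PiM ?J (\<lambda>_. M))" using IT.space_C[OF s] by simp
    have "(\<Prod>i<Suc n. (map (\<lambda>i. indicator (A i)) [0..<Suc n] ! i) (\<omega> i) :: ennreal) = (\<Prod>i<Suc n. indicator (A i) (\<omega> i))"
      by (intro prod.cong refl) (simp del: upt_Suc)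
    also have "\<dots> = indicator (PiE ?J A) \<omega>"
    proof (cases "\<forall>i<Suc n. \<omega> i \<in> A i")
      case True
      then show ?thesis using \<omega> by (auto simp: space_PiM PiE_iff indicator_def simp del: prod.lessThan_Suc)
    next
      case False
      then show ?thesis using \<omega> by (auto simp: PiE_iff indicator_def simp del: prod.lessThan_Suc)
    qed
    finally show "indicator (PiE ?J A) \<omega> = (\<Prod>i<Suc n. (map (\<lambda>i. indicator (A i)) [0..<Suc n] ! i) (\<omega> i) :: ennreal)" by simp
  qed
  also have "\<dots> = cyl \<pi> (map (\<lambda>i. indicator (A i)) [0..<Suc n]) x"
  proof -
    let ?us = "map (\<lambda>i. indicator (A i) :: 'a \<Rightarrow> ennreal) [0..<n]"
    have "(\<integral>\<^sup>+\<omega>. (\<Prod>i<Suc (length ?us). ((?us @ [indicator (A n)]) ! i) (\<omega> i)) \<partial>IT.C 0 (Suc (length ?us)) (\<lambda>_. undefined))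
      = cyl \<pi> (?us @ [indicator (A n)]) x"
      by (rule nn_integral_C_cyl) (use A in auto)
    then show ?thesis by simp
  qed
  finally show ?thesis .
qed

end

lemmas sets_path_law[measurable_cong] = sets_path_law'
lemmas space_path_law = space_path_law'
lemmas prob_space_path_law = prob_space_path_law'
lemmas emeasure_path_law_cylinder = emeasure_path_law_cylinder'

end

lemma cylinder_generator:
  "sets (paths M) = sigma_sets (space (paths M)) {{\<omega>\<in>space (paths M). \<forall>i\<le>n. \<omega> i \<in> A i} | n A. \<forall>i. A i \<in> sets M}" (is "_ = sigma_sets ?\<Omega> ?E")
  and Int_stable_cylinders:
  "Int_stable {{\<omega>\<in>space (paths M). \<forall>i\<le>n. \<omega> i \<in> A i} | n A. \<forall>i::nat. A i \<in> sets M}"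
proof -
  have m: "{\<omega>\<in>space (paths M). \<forall>i\<le>n. \<omega> i \<in> A i} \<in> sets (paths M)" if "\<forall>i. A i \<in> sets M" for A and n :: nat
  proof -
    have [measurable]: "\<And>i. A i \<in> sets M" using that by auto
    show ?thesis by measurable
  qed
  show "sets (paths M) = sigma_sets ?\<Omega> ?E"
  proof (rule antisym)
    have "sets (paths M) = sigma_sets (space (paths M)) {{f\<in>PiE UNIV (\<lambda>_. space M). f i \<in> A} | i A. i \<in> (UNIV::nat set) \<and> A \<in> sets M}"
      unfolding space_PiM by (rule sets_PiM_single)
    also have "\<dots> \<subseteq> sigma_sets ?\<Omega> ?E"
    proof (intro sigma_sets_mono subsetI)
      fix B assume "B \<in> {{f\<in>PiE UNIV (\<lambda>_. space M). f i \<in> A} | i A. i \<in> (UNIV::nat set) \<and> A \<in> sets M}"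
      then obtain i A where B: "B = {f\<in>PiE UNIV (\<lambda>_. space M). f i \<in> A}" "A \<in> sets M" by auto
      have "B = {\<omega>\<in>space (paths M). \<forall>j\<le>i. \<omega> j \<in> (if j = i then A else space M)}"
        using B by (auto simp: space_PiM split: if_splits)
      also have "\<dots> \<in> ?E"
        using B(2) by (intro CollectI exI[of _ i] exI[of _ "\<lambda>j. if j = i then A else space M"]) auto
      finally show "B \<in> sigma_sets (space (paths M)) ?E" by (rule sigma_sets.Basic)
    qed
    finally show "sets (paths M) \<subseteq> sigma_sets ?\<Omega> ?E" .
    show "sigma_sets ?\<Omega> ?E \<subseteq> sets (paths M)"
      using m by (intro sets.sigma_sets_subset) auto
  qed
  show "Int_stable ?E"
  proof (rule Int_stableI)
    fix a b assume "a \<in> ?E" "b \<in> ?E"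
    then obtain n A m B where a: "a = {\<omega>\<in>space (paths M). \<forall>i\<le>n. \<omega> i \<in> A i}" "\<forall>i. A i \<in> sets M"
      and b: "b = {\<omega>\<in>space (paths M). \<forall>i\<le>m. \<omega> i \<in> B i}" "\<forall>i. B i \<in> sets M" by blast
    let ?C = "\<lambda>i. (if i \<le> n then A i else space M) \<inter> (if i \<le> m then B i else space M)"
    have "a \<inter> b = {\<omega>\<in>space (paths M). \<forall>i\<le>max n m. \<omega> i \<in> ?C i}"
    proof (intro equalityI subsetI)
      fix \<omega> assume "\<omega> \<in> a \<inter> b"
      then show "\<omega> \<in> {\<omega>\<in>space (paths M). \<forall>i\<le>max n m. \<omega> i \<in> ?C i}"
        unfolding a b by (simp add: space_PiM PiE_iff)
    next
      fix \<omega> assume \<omega>: "\<omega> \<in> {\<omega>\<in>space (paths M). \<forall>i\<le>max n m. \<omega> i \<in> ?C i}"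
      have "\<omega> i \<in> A i" if "i \<le> n" for i
      proof -
        have "i \<le> max n m" using that by simp
        then have "\<omega> i \<in> ?C i" using \<omega> by blast
        then show ?thesis using that by simp
      qed
      moreover have "\<omega> i \<in> B i" if "i \<le> m" for i
      proof -
        have "i \<le> max n m" using that by simp
        then have "\<omega> i \<in> ?C i" using \<omega> by blast
        then show ?thesis using that by simp
      qed
      ultimately show "\<omega> \<in> a \<inter> b" unfolding a b using \<omega> by simp
    qed
    moreover have "\<forall>i. ?C i \<in> sets M" using a b by auto
    ultimately show "a \<inter> b \<in> ?E"
      by (intro CollectI exI[of _ "max n m"] exI[of _ ?C] conjI)
  qed
qed

lemma measure_eqI_paths:
  assumes P: "finite_measure P" and s: "sets P = sets (paths M)" "sets Q = sets (paths M)"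
    and e: "\<And>n A. (\<And>i. A i \<in> sets M) \<Longrightarrow> emeasure P {\<omega>\<in>space (paths M). \<forall>i\<le>n. \<omega> i \<in> A i} = emeasure Q {\<omega>\<in>space (paths M). \<forall>i\<le>n. \<omega> i \<in> A i}"
  shows "P = Q"
proof (rule measure_eqI_generator_eq[OF Int_stable_cylinders[of M], where \<Omega>="space (paths M)" and A="\<lambda>_. space (paths M)"])
  show "{{\<omega> \<in> space (paths M). \<forall>i\<le>n. \<omega> i \<in> A i} |n A. \<forall>i. A i \<in> sets M} \<subseteq> Pow (space (paths M))" by auto
  show "sets P = sigma_sets (space (paths M)) {{\<omega> \<in> space (paths M). \<forall>i\<le>n. \<omega> i \<in> A i} |n A. \<forall>i. A i \<in> sets M}"
    "sets Q = sigma_sets (space (paths M)) {{\<omega> \<in> space (paths M). \<forall>i\<le>n. \<omega> i \<in> A i} |n A. \<forall>i. A i \<in> sets M}"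
    using s cylinder_generator by auto
  have "space (paths M) = {\<omega> \<in> space (paths M). \<forall>i\<le>0. \<omega> i \<in> space M}" by (auto simp: space_PiM)
  then show "range (\<lambda>_::nat. space (paths M)) \<subseteq> {{\<omega> \<in> space (paths M). \<forall>i\<le>n. \<omega> i \<in> A i} |n A. \<forall>i. A i \<in> sets M}" 
    by (intro subsetI CollectI exI[of _ 0] exI[of _ "\<lambda>_. space M"]) auto
  show "emeasure P (space (paths M)) \<noteq> \<infinity>" using P by (simp add: finite_measure.emeasure_finite)
qed (use e in auto)

context markov_kernel
begin

lemma measurable_path_law[measurable]: "path_law M \<pi> \<in> measurable M (subprob_algebra (paths M))"
proof (rule measurable_subprob_algebra_generated[OF cylinder_generator Int_stable_cylinders])
  fix a assume a: "a \<in> space M"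
  show "subprob_space (path_law M \<pi> a)" by (rule prob_space_imp_subprob_space[OF prob_space_path_law[OF a]])
  show "sets (path_law M \<pi> a) = sets (paths M)" by (rule sets_path_law[OF a])
next
  fix B assume "B \<in> {{\<omega> \<in> space (paths M). \<forall>i\<le>n. \<omega> i \<in> A i} |n A. \<forall>i. A i \<in> sets M}"
  then obtain n A where B: "B = {\<omega> \<in> space (paths M). \<forall>i\<le>n. \<omega> i \<in> A i}" and A: "\<forall>i. A i \<in> sets M" by auto
  have "cyl \<pi> (map (\<lambda>i. indicator (A i)) [0..<Suc n]) \<in> borel_measurable M"
    using A by (intro measurable_cyl) auto
  then show "(\<lambda>a. emeasure (path_law M \<pi> a) B) \<in> borel_measurable M"
    using A unfolding B by (subst measurable_cong[OF emeasure_path_law_cylinder]) auto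
next
  show "(\<lambda>a. emeasure (path_law M \<pi> a) (space (paths M))) \<in> borel_measurable M"
    using prob_space.emeasure_space_1[OF prob_space_path_law] space_path_law
    by (subst measurable_cong[where g="\<lambda>_. 1"]) fastforce+
qed auto

lemma measurable_path_law_cong:
  "sets N = sets M \<Longrightarrow> path_law M \<pi> \<in> measurable N (subprob_algebra (paths M))"
  using measurable_path_law by (simp cong: measurable_cong_sets)

lemma measurable_path_law_prob[measurable]: "path_law M \<pi> \<in> measurable M (prob_algebra (paths M))"
  by (intro measurable_prob_algebraI prob_space_path_law measurable_path_law)

lemma measurable_time_shift[measurable]: "time_shift \<in> measurable (paths M) (paths M)"
  unfolding time_shift_def by (intro measurable_PiM_single') (auto simp: space_PiM)

text \<open>The Markov property at time one: both sides have the same cylinder probabilities.\<close>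

lemma path_law_shift:
  assumes x: "x \<in> space M"
  shows "distr (path_law M \<pi> x) (paths M) time_shift = \<pi> x \<bind> path_law M \<pi>"
proof (rule measure_eqI_paths)
  have [measurable_cong]: "sets (path_law M \<pi> x) = sets (paths M)" "sets (\<pi> x) = sets M"
    using x by (auto simp: sets_path_law pi_sets)
  have ne: "space (\<pi> x) \<noteq> {}" using x pi_space by auto
  interpret P: prob_space "path_law M \<pi> x" by (rule prob_space_path_law[OF x])
  show "finite_measure (distr (path_law M \<pi> x) (paths M) time_shift)"
    by (intro P.finite_measure_distr) measurable
  show "sets (\<pi> x \<bind> path_law M \<pi>) = sets (paths M)"
    using x ne by (intro sets_bind) (auto simp: pi_space sets_path_law)
  fix n and A :: "nat \<Rightarrow> 'a set" assume A: "\<And>i. A i \<in> sets M"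
  let ?A = "\<lambda>i. case i of 0 \<Rightarrow> space M | Suc i \<Rightarrow> A i"
  have A'[measurable]: "?A i \<in> sets M" for i using A by (cases i) auto
  note A[measurable]
  have [measurable]: "{\<omega> \<in> space (paths M). \<forall>i\<le>n. \<omega> i \<in> A i} \<in> sets (paths M)" by measurable
  have "emeasure (distr (path_law M \<pi> x) (paths M) time_shift) {\<omega> \<in> space (paths M). \<forall>i\<le>n. \<omega> i \<in> A i}
    = emeasure (path_law M \<pi> x) (time_shift -` {\<omega> \<in> space (paths M). \<forall>i\<le>n. \<omega> i \<in> A i} \<inter> space (paths M))"
    using x by (subst emeasure_distr) (auto simp: space_path_law)
  also have "time_shift -` {\<omega> \<in> space (paths M). \<forall>i\<le>n. \<omega> i \<in> A i} \<inter> space (paths M)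
    = {\<omega> \<in> space (paths M). \<forall>i\<le>Suc n. \<omega> i \<in> ?A i}"
    by (auto simp: time_shift_def space_PiM PiE_iff split: nat.split)
  also have "emeasure (path_law M \<pi> x) \<dots> = cyl \<pi> (map (\<lambda>i. indicator (?A i)) [0..<Suc (Suc n)]) x"
    by (rule emeasure_path_law_cylinder[OF x]) auto
  also have "map (\<lambda>i. indicator (?A i)) [0..<Suc (Suc n)] = (indicator (space M) :: _ \<Rightarrow> ennreal) # map (\<lambda>i. indicator (A i)) [0..<Suc n]"
    by (subst upt_conv_Cons) (simp_all add: map_Suc_upt[symmetric] del: upt_Suc)
  also have "cyl \<pi> \<dots> x = (\<integral>\<^sup>+y. cyl \<pi> (map (\<lambda>i. indicator (A i)) [0..<Suc n]) y \<partial>\<pi> x)"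
    using x by (simp del: upt_Suc)
  also have "\<dots> = (\<integral>\<^sup>+y. emeasure (path_law M \<pi> y) {\<omega> \<in> space (paths M). \<forall>i\<le>n. \<omega> i \<in> A i} \<partial>\<pi> x)"
    using x A by (intro nn_integral_cong emeasure_path_law_cylinder[symmetric]) (auto simp: pi_space)
  also have "\<dots> = emeasure (\<pi> x \<bind> path_law M \<pi>) {\<omega> \<in> space (paths M). \<forall>i\<le>n. \<omega> i \<in> A i}"
    by (rule emeasure_bind[symmetric, OF ne measurable_path_law_cong]) (use x in \<open>auto simp: pi_sets\<close>)
  finally show "emeasure (distr (path_law M \<pi> x) (paths M) time_shift) {\<omega> \<in> space (paths M). \<forall>i\<le>n. \<omega> i \<in> A i} = \<dots>" .
qed simp

lemma AE_path_law_shift: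
  assumes x: "x \<in> space M" and [measurable]: "Measurable.pred (paths M) P"
  shows "(AE \<omega> in path_law M \<pi> x. P (time_shift \<omega>)) \<longleftrightarrow> (AE y in \<pi> x. AE \<omega> in path_law M \<pi> y. P \<omega>)"
proof -
  have [measurable_cong]: "sets (path_law M \<pi> x) = sets (paths M)" "sets (\<pi> x) = sets M"
    using x by (auto simp: sets_path_law pi_sets)
  have "(AE \<omega> in path_law M \<pi> x. P (time_shift \<omega>)) \<longleftrightarrow> (AE \<omega> in distr (path_law M \<pi> x) (paths M) time_shift. P \<omega>)"
    by (subst AE_distr_iff) measurable
  also have "\<dots> \<longleftrightarrow> (AE y in \<pi> x. AE \<omega> in path_law M \<pi> y. P \<omega>)"
    unfolding path_law_shift[OF x] by (rule AE_bind[OF measurable_path_law_cong]) (use x in \<open>auto simp: pi_sets\<close>)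
  finally show ?thesis .
qed

lemma AE_path_law_start:
  assumes x: "x \<in> space M" and [measurable]: "Measurable.pred M P"
  shows "(AE \<omega> in path_law M \<pi> x. P (\<omega> 0)) \<longleftrightarrow> P x"
proof -
  interpret P: prob_space "path_law M \<pi> x" by (rule prob_space_path_law[OF x])
  have sc[measurable_cong]: "sets (path_law M \<pi> x) = sets (paths M)"
    using x by (auto simp: sets_path_law)
  let ?A = "{y\<in>space M. \<not> P y}"
  have e: "emeasure (path_law M \<pi> x) {\<omega>\<in>space (paths M). \<forall>i\<le>0. \<omega> i \<in> ?A} = cyl \<pi> (map (\<lambda>i. indicator ?A) [0..<Suc 0]) x"
    by (rule emeasure_path_law_cylinder[OF x]) measurable
  have "(AE \<omega> in path_law M \<pi> x. P (\<omega> 0)) \<longleftrightarrow> emeasure (path_law M \<pi> x) {\<omega>\<in>space (path_law M \<pi> x). \<not> P (\<omega> 0)} = 0"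
    by (rule AE_iff_measurable[OF _ refl]) measurable
  also have "{\<omega>\<in>space (path_law M \<pi> x). \<not> P (\<omega> 0)} = {\<omega>\<in>space (paths M). \<forall>i\<le>0. \<omega> i \<in> ?A}"
    using x by (auto simp: space_path_law space_PiM)
  also note e
  also have "cyl \<pi> (map (\<lambda>i. indicator ?A) [0..<Suc 0]) x = indicator ?A x"
    using prob_space.emeasure_space_1[OF pi_prob_space[OF x]] by simp
  finally show ?thesis using x by (auto simp: indicator_def)
qed

end

section \<open>Haar systems normalized to probability kernels\<close>

lemma borel_rational_rays: "sets borel = sigma_sets UNIV ((\<lambda>a::real. {a <..}) ` \<rat>)"
proof (rule antisym)
  show "sigma_sets UNIV ((\<lambda>a::real. {a <..}) ` \<rat>) \<subseteq> sets borel"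
    by (rule sets.sigma_sets_subset[of _ borel, simplified]) auto
  have "sets (borel :: real measure) = sigma_sets UNIV (range (\<lambda>a. {a <..}))"
    unfolding borel_Ioi by auto
  also have "\<dots> \<subseteq> sigma_sets UNIV ((\<lambda>a::real. {a <..}) ` \<rat>)"
  proof (rule sigma_sets_mono, safe)
    fix a :: real
    have "{a <..} = (\<Union>q\<in>{q\<in>\<rat>. a < q}. {q <..})"
    proof (intro set_eqI iffI)
      fix x assume "x \<in> {a <..}"
      then obtain q where "q \<in> \<rat>" "a < q" "q < x" using Rats_dense_in_real[of a x] by auto
      then show "x \<in> (\<Union>q\<in>{q\<in>\<rat>. a < q}. {q <..})" by auto
    qed auto
    also have "\<dots> \<in> sigma_sets UNIV ((\<lambda>a::real. {a <..}) ` \<rat>)"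
      by (rule sigma_sets_UNION) (auto intro!: countable_image countable_subset[OF _ countable_rat])
    finally show "{a <..} \<in> sigma_sets UNIV ((\<lambda>a::real. {a <..}) ` \<rat>)" .
  qed
  finally show "sets (borel :: real measure) \<subseteq> sigma_sets UNIV ((\<lambda>a::real. {a <..}) ` \<rat>)" .
qed

text \<open>Countably many numbers determine a finite measure on the line; this is the source of the
  countable separation of objects below.\<close>

lemma real_measure_eqI_rational_rays:
  fixes M N :: "real measure"
  assumes sets: "sets M = sets borel" "sets N = sets borel" and fin: "finite_measure M"
    and eq: "\<And>q. q \<in> \<rat> \<Longrightarrow> emeasure M {q <..} = emeasure N {q <..}"
  shows "M = N"
proof (rule measure_eqI_generator_eq_countable)
  let ?LT = "\<lambda>a::real. {a <..}" let ?E = "?LT ` \<rat>"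
  show "Int_stable ?E"
    by (auto simp: Int_stable_def lessThan_Int_lessThan greaterThan_Int_greaterThan max_def)
  show "?E \<subseteq> Pow UNIV" "sets M = sigma_sets UNIV ?E" "sets N = sigma_sets UNIV ?E"
    unfolding sets borel_rational_rays by auto
  show "?LT`\<rat> \<subseteq> ?E" "(\<Union>i\<in>\<rat>. ?LT i) = UNIV" "\<And>a. a \<in> ?LT`\<rat> \<Longrightarrow> emeasure M a \<noteq> \<infinity>"
    using fin by (auto intro: Rats_no_bot_less simp: finite_measure.emeasure_finite)
qed (auto intro: assms countable_rat)

text \<open>The isomorphism with a Borel subset of the line, as a real function on the whole space.  The last
  property is the measurability of its inverse.\<close>

lemma lebesgue_space_coordinate:
  fixes M :: "'a measure"
  assumes "lebesgue_space M"
  obtains X0 and e :: "'a \<Rightarrow> real" where "X0 \<in> sets M" "AE x in M. x \<in> X0" "e \<in> borel_measurable M" "inj_on e X0"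
    "\<And>A. A \<in> sets M \<Longrightarrow> A \<subseteq> X0 \<Longrightarrow> \<exists>D\<in>sets borel. \<forall>x\<in>X0. x \<in> A \<longleftrightarrow> e x \<in> D"
proof -
  obtain X0 B \<phi> \<psi> where X0: "X0 \<in> sets M" "space M - X0 \<in> null_sets M" and B: "B \<in> sets (borel :: real measure)"
    and \<phi>: "\<phi> \<in> measurable (restrict_space M X0) (restrict_space borel B)"
    and \<psi>: "\<psi> \<in> measurable (restrict_space borel B) (restrict_space M X0)"
    and inv: "\<And>x. x \<in> X0 \<Longrightarrow> \<psi> (\<phi> x) = x"
    using assms unfolding lebesgue_space_def by blast
  have sX0: "X0 \<subseteq> space M" "X0 \<inter> space M = X0" using sets.sets_into_space[OF X0(1)] by auto
  define e where "e x = indicator X0 x *\<^sub>R \<phi> x" for x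
  have eX0: "e x = \<phi> x" if "x \<in> X0" for x using that by (simp add: e_def)
  have "\<phi> \<in> borel_measurable (restrict_space M X0)"
    using \<phi> by (simp add: measurable_restrict_space2_iff)
  then have e: "e \<in> borel_measurable M"
    using X0 sX0 unfolding e_def[abs_def] by (simp add: borel_measurable_restrict_space_iff)
  have "AE x in M. x \<in> X0"
    using X0(2) by (rule AE_I'[of "space M - X0"]) auto
  moreover have "inj_on e X0"
    using inv by (auto simp: inj_on_def eX0) metis
  moreover have "\<exists>D\<in>sets borel. \<forall>x\<in>X0. x \<in> A \<longleftrightarrow> e x \<in> D" if A: "A \<in> sets M" "A \<subseteq> X0" for A
  proof (intro bexI ballI)
    have "\<psi> -` A \<inter> space (restrict_space borel B) \<in> sets (restrict_space borel B)"
      using A X0 by (intro measurable_sets[OF \<psi>]) (auto simp: sets_restrict_space_iff sX0)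
    then show "\<psi> -` A \<inter> B \<in> sets borel"
      using B by (simp add: sets_restrict_space_iff space_restrict_space)
    fix x assume x: "x \<in> X0"
    then have "\<phi> x \<in> B"
      using measurable_space[OF \<phi>, of x] sX0 by (auto simp: space_restrict_space)
    then show "x \<in> A \<longleftrightarrow> e x \<in> \<psi> -` A \<inter> B"
      using x by (simp add: eX0 inv)
  qed
  ultimately show ?thesis using that X0(1) e by blast
qed

text \<open>\<open>U\<close> is meant to be conull; over it equality of objects is a measurable relation.\<close>

locale separated_groupoid = borel_groupoid G for G :: "('o, 'g) groupoid" +
  fixes U :: "'o set"
  assumes U_sets[measurable]: "U \<in> sets (objs G)"
    and diag_U: "{(x, y). x \<in> U \<and> x = y} \<in> sets (objs G \<Otimes>\<^sub>M objs G)"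
begin

declare measurable_src[measurable] measurable_tgt[measurable] measurable_inv[measurable]

lemma U_objs: "x \<in> U \<Longrightarrow> x \<in> space (objs G)"
  using sets.sets_into_space[OF U_sets] by auto

text \<open>The conjunct \<open>f x \<in> U\<close> is essential: equality of objects outside \<open>U\<close> need not be measurable.\<close>

lemma pred_eq_U[measurable (raw)]:
  assumes [measurable]: "f \<in> measurable N (objs G)" "g \<in> measurable N (objs G)"
  shows "Measurable.pred N (\<lambda>x. f x \<in> U \<and> f x = g x)"
proof -
  have "(\<lambda>x. (f x, g x)) -` {(x, y). x \<in> U \<and> x = y} \<inter> space N \<in> sets N"
    by (rule measurable_sets[OF _ diag_U]) measurable
  also have "(\<lambda>x. (f x, g x)) -` {(x, y). x \<in> U \<and> x = y} \<inter> space N = {x\<in>space N. f x \<in> U \<and> f x = g x}"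
    by auto
  finally show ?thesis by (simp add: pred_def)
qed

lemma fibre_sets: "x \<in> U \<Longrightarrow> fibre G x \<in> sets (arrs G)"
proof -
  assume x: "x \<in> U"
  have "(\<lambda>_. x) \<in> measurable (arrs G) (objs G)" using x by (simp add: U_objs)
  from pred_eq_U[OF this measurable_tgt]
  have "{g\<in>space (arrs G). x \<in> U \<and> x = tgt G g} \<in> sets (arrs G)" by (simp add: pred_def)
  also have "{g\<in>space (arrs G). x \<in> U \<and> x = tgt G g} = fibre G x"
    using x by (auto simp: fibre_def)
  finally show ?thesis .
qed

text \<open>Multiplication made total.  The default value is the second argument because it is an arrow and
  depends measurably on the pair.\<close>

definition tmult :: "'g \<Rightarrow> 'g \<Rightarrow> 'g" where
  "tmult g k = (if src G g \<in> U \<and> src G g = tgt G k then gmult G g k else k)"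

lemma measurable_tmult_pair: "(\<lambda>p. tmult (fst p) (snd p)) \<in> measurable (arrs G \<Otimes>\<^sub>M arrs G) (arrs G)"
proof -
  let ?M = "arrs G \<Otimes>\<^sub>M arrs G"
  define S where "S = {p\<in>space ?M. src G (fst p) \<in> U \<and> src G (fst p) = tgt G (snd p)}"
  have S: "{p\<in>space ?M. p \<in> S} \<in> sets ?M"
  proof -
    have "S \<in> sets ?M" unfolding S_def pred_def[symmetric] by measurable
    also have "S = {p\<in>space ?M. p \<in> S}" by (auto simp: S_def)
    finally show ?thesis .
  qed
  have 1: "(\<lambda>p. gmult G (fst p) (snd p)) \<in> measurable (restrict_space ?M S) (arrs G)"
  proof -
    have "S \<subseteq> composable G" by (auto simp: S_def composable_def space_pair_measure)
    from measurable_restrict_mono[OF measurable_mult this] show ?thesis by (simp add: split_beta')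
  qed
  have "(\<lambda>p. if p \<in> S then gmult G (fst p) (snd p) else snd p) \<in> measurable ?M (arrs G)"
    unfolding measurable_If_restrict_space_iff[OF S]
    using 1 by (auto intro!: measurable_restrict_space1)
  then show ?thesis
    by (rule measurable_cong[THEN iffD1, rotated]) (auto simp: S_def tmult_def)
qed

lemma measurable_tmult[measurable (raw)]:
  assumes "f \<in> measurable N (arrs G)" "g \<in> measurable N (arrs G)"
  shows "(\<lambda>x. tmult (f x) (g x)) \<in> measurable N (arrs G)"
  using measurable_compose[OF measurable_Pair[OF assms] measurable_tmult_pair] by simp

lemma tmult_in: "g \<in> space (arrs G) \<Longrightarrow> k \<in> space (arrs G) \<Longrightarrow> tmult g k \<in> space (arrs G)"
  by (auto simp: tmult_def composable_def intro!: mult_in)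

text \<open>Over \<open>U\<close> fibres are measurable, and neither the completion nor the restriction to the
  fibre is visible in the image measure.\<close>

lemma translate_eq_distr:
  assumes g: "g \<in> space (arrs G)" "src G g \<in> U" and s: "sets \<theta> = sets (arrs G)"
    and t: "AE k in \<theta>. tgt G k = src G g"
  shows "translate G g \<theta> = distr \<theta> (arrs G) (tmult g)"
proof (rule measure_eqI)
  let ?F = "fibre G (src G g)"
  note s[measurable_cong]
  have sp: "space \<theta> = space (arrs G)" using s by (rule sets_eq_imp_space_eq)
  have gg[measurable]: "(\<lambda>_. g) \<in> measurable N (arrs G)" for N using g by simp
  have gmg[measurable]: "tmult g \<in> measurable (arrs G) (arrs G)" by measurable
  have F[measurable]: "?F \<in> sets (arrs G)" using g by (intro fibre_sets) auto
  have eq: "gmult G g k = tmult g k" if "k \<in> ?F" for k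
    using that g by (auto simp: fibre_def tmult_def)
  show "sets (translate G g \<theta>) = sets (distr \<theta> (arrs G) (tmult g))" by (simp add: translate_def)
  fix A assume "A \<in> sets (translate G g \<theta>)"
  then have A[measurable]: "A \<in> sets (arrs G)" by (simp add: translate_def)
  have m: "gmult G g \<in> measurable (restrict_space (completion \<theta>) ?F) (arrs G)"
  proof (subst measurable_cong[where g="tmult g"])
    show "tmult g \<in> measurable (restrict_space (completion \<theta>) ?F) (arrs G)"
      by (intro measurable_restrict_space1 measurable_completion) measurable
  qed (auto simp: space_restrict_space eq)
  have "emeasure (translate G g \<theta>) A = emeasure (restrict_space (completion \<theta>) ?F) (gmult G g -` A \<inter> space (restrict_space (completion \<theta>) ?F))"
    unfolding translate_def by (rule emeasure_distr[OF m A])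
  also have "gmult G g -` A \<inter> space (restrict_space (completion \<theta>) ?F) = {k\<in>space (arrs G). tmult g k \<in> A \<and> k \<in> ?F}"
    using F[THEN sets.sets_into_space] by (auto simp: space_restrict_space sp eq)
  also have "emeasure (restrict_space (completion \<theta>) ?F) \<dots> = emeasure (completion \<theta>) {k\<in>space (arrs G). tmult g k \<in> A \<and> k \<in> ?F}"
    using F by (intro emeasure_restrict_space) (auto simp: sp s)
  also have "\<dots> = emeasure \<theta> {k\<in>space (arrs G). tmult g k \<in> A \<and> k \<in> ?F}"
    using s by (simp add: emeasure_completion)
  also have "\<dots> = emeasure \<theta> (tmult g -` A \<inter> space \<theta>)"
  proof (rule emeasure_eq_AE)
    show "AE k in \<theta>. k \<in> {k \<in> space (arrs G). tmult g k \<in> A \<and> k \<in> ?F} \<longleftrightarrow> k \<in> tmult g -` A \<inter> space \<theta>"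
      using t by eventually_elim (auto simp: sp fibre_def)
    show "{k \<in> space (arrs G). tmult g k \<in> A \<and> k \<in> ?F} \<in> sets \<theta>" unfolding s by measurable
    show "tmult g -` A \<inter> space \<theta> \<in> sets \<theta>" unfolding s sp by (rule measurable_sets[OF gmg A])
  qed
  also have "\<dots> = emeasure (distr \<theta> (arrs G) (tmult g)) A"
    by (rule emeasure_distr[symmetric]) measurable
  finally show "emeasure (translate G g \<theta>) A = emeasure (distr \<theta> (arrs G) (tmult g)) A" .
qed

end

text \<open>What matters of the Haar system are its null sets, so it is replaced by equivalent probability measures \<open>\<kappa>\<^sup>x\<close>, and \<open>\<mu>\<close> by an equivalent finite measure.  The last assumption is the
  quasi-invariance of \<open>\<mu>\<close>; applied to the inverse, one implication gives both.\<close>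

locale normalized_groupoid = separated_groupoid G U for G :: "('o, 'g) groupoid" and U +
  fixes \<kappa> :: "'o \<Rightarrow> 'g measure" and \<mu> :: "'o measure"
  assumes kappa: "\<kappa> \<in> measurable (objs G) (prob_algebra (arrs G))"
    and kappa_fibre: "\<And>x. x \<in> U \<Longrightarrow> AE g in \<kappa> x. tgt G g = x"
    and kappa_translate: "\<And>g A. g \<in> space (arrs G) \<Longrightarrow> src G g \<in> U \<Longrightarrow> tgt G g \<in> U \<Longrightarrow> A \<in> sets (arrs G) \<Longrightarrow>
      (AE k in \<kappa> (src G g). tmult g k \<notin> A) \<longleftrightarrow> (AE k in \<kappa> (tgt G g). k \<notin> A)"
    and finite_mu: "finite_measure \<mu>"
    and sets_mu[measurable_cong]: "sets \<mu> = sets (objs G)"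
    and AE_mu_U: "AE x in \<mu>. x \<in> U"
    and quasi: "\<And>A. A \<in> sets (arrs G) \<Longrightarrow> (AE x in \<mu>. AE g in \<kappa> x. g \<notin> A) \<Longrightarrow> (AE x in \<mu>. AE g in \<kappa> x. ginv G g \<notin> A)"

context
  fixes G :: "('o, 'g) groupoid" and lam :: "'o \<Rightarrow> 'g measure" and \<mu> :: "'o measure"
  assumes mg: "measured_groupoid G lam \<mu>"
begin

interpretation borel_groupoid G using mg by (auto simp: measured_groupoid_def)

lemma haar_sets: "x \<in> space (objs G) \<Longrightarrow> sets (lam x) = sets (arrs G)"
  and haar_fibre: "x \<in> space (objs G) \<Longrightarrow> AE g in lam x. tgt G g = x"
  and haar_measurable: "f \<in> borel_measurable (arrs G) \<Longrightarrow> (\<lambda>x. \<integral>\<^sup>+ g. (f g :: ennreal) \<partial>lam x) \<in> borel_measurable (objs G)"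
  and haar_proper: "\<exists>f \<in> borel_measurable (arrs G). \<forall>x\<in>space (objs G). (\<integral>\<^sup>+ g. (f g :: ennreal) \<partial>lam x) = 1"
  and haar_translate: "g\<in>space (arrs G) \<Longrightarrow> translate G g (lam (src G g)) = lam (tgt G g)"
  and base_sets: "sets \<mu> = sets (objs G)"
  and base_quasi: "quasi_invariant G lam \<mu>"
  using mg unfolding measured_groupoid_def borel_haar_system_def by auto

lemma base_space: "space \<mu> = space (objs G)" using base_sets by (rule sets_eq_imp_space_eq)

lemma haar_measurable_emeasure: "A \<in> sets (arrs G) \<Longrightarrow> (\<lambda>x. emeasure (lam x) A) \<in> borel_measurable \<mu>"
proof -
  assume A: "A \<in> sets (arrs G)"
  have "(\<lambda>x. \<integral>\<^sup>+ g. indicator A g \<partial>lam x) \<in> borel_measurable (objs G)"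
    using A by (intro haar_measurable) auto
  then have "(\<lambda>x. emeasure (lam x) A) \<in> borel_measurable (objs G)"
    by (subst (asm) measurable_cong[where g="\<lambda>x. emeasure (lam x) A"]) (use A haar_sets in auto)
  then show ?thesis by (simp add: measurable_cong_sets[OF base_sets refl])
qed

lemma sets_haar_star[simp]: "sets (haar_star G lam \<mu>) = sets (arrs G)"
  and space_haar_star[simp]: "space (haar_star G lam \<mu>) = space (arrs G)"
  by (simp_all add: haar_star_def)

lemma emeasure_haar_star:
  assumes A: "A \<in> sets (arrs G)"
  shows "emeasure (haar_star G lam \<mu>) A = (\<integral>\<^sup>+x. emeasure (lam x) A \<partial>\<mu>)"
  unfolding haar_star_def
proof (rule emeasure_measure_of_sigma)
  show "sigma_algebra (space (arrs G)) (sets (arrs G))" ..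
  show "positive (sets (arrs G)) (\<lambda>A. \<integral>\<^sup>+ x. emeasure (lam x) A \<partial>\<mu>)"
    by (simp add: positive_def)
  show "countably_additive (sets (arrs G)) (\<lambda>A. \<integral>\<^sup>+ x. emeasure (lam x) A \<partial>\<mu>)"
  proof (rule countably_additiveI)
    fix B :: "nat \<Rightarrow> 'g set" assume B: "range B \<subseteq> sets (arrs G)" "disjoint_family B"
    have "(\<Sum>i. \<integral>\<^sup>+ x. emeasure (lam x) (B i) \<partial>\<mu>) = (\<integral>\<^sup>+ x. (\<Sum>i. emeasure (lam x) (B i)) \<partial>\<mu>)"
      using B by (intro nn_integral_suminf[symmetric] haar_measurable_emeasure) auto
    also have "\<dots> = (\<integral>\<^sup>+ x. emeasure (lam x) (\<Union>i. B i) \<partial>\<mu>)"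
      using B by (intro nn_integral_cong suminf_emeasure) (auto simp: base_space haar_sets)
    finally show "(\<Sum>i. \<integral>\<^sup>+ x. emeasure (lam x) (B i) \<partial>\<mu>) = (\<integral>\<^sup>+ x. emeasure (lam x) (\<Union>i. B i) \<partial>\<mu>)" .
  qed
  show "A \<in> sets (arrs G)" by fact
qed

text \<open>The \<open>\<lambda>\<^sup>x\<close> need not be finite, so \<open>\<lambda> \<star> \<mu>\<close> is not covered by the Giry monad and its
  disintegration has to be derived separately.\<close>

lemma nn_integral_haar_star:
  assumes f: "f \<in> borel_measurable (arrs G)"
  shows "(\<integral>\<^sup>+g. f g \<partial>haar_star G lam \<mu>) = (\<integral>\<^sup>+x. \<integral>\<^sup>+g. f g \<partial>lam x \<partial>\<mu>)"
  using f
proof (induction rule: borel_measurable_induct)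
  case (cong f g)
  have "(\<integral>\<^sup>+g. f g \<partial>lam x) = (\<integral>\<^sup>+h. g h \<partial>lam x)" if "x \<in> space \<mu>" for x
    using cong that sets_eq_imp_space_eq[OF haar_sets] by (intro nn_integral_cong) (auto simp: base_space)
  moreover have "(\<integral>\<^sup>+g. f g \<partial>haar_star G lam \<mu>) = (\<integral>\<^sup>+h. g h \<partial>haar_star G lam \<mu>)"
    using cong by (intro nn_integral_cong) auto
  ultimately show ?case using cong(4) by (simp cong: nn_integral_cong)
next
  case (set A)
  have "(\<integral>\<^sup>+x. emeasure (lam x) A \<partial>\<mu>) = (\<integral>\<^sup>+x. \<integral>\<^sup>+g. indicator A g \<partial>lam x \<partial>\<mu>)"
    using set by (intro nn_integral_cong) (auto simp: base_space haar_sets)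
  then show ?case using set by (simp add: emeasure_haar_star)
next
  case (mult u c)
  have "(\<integral>\<^sup>+x. \<integral>\<^sup>+g. c * u g \<partial>lam x \<partial>\<mu>) = (\<integral>\<^sup>+x. c * \<integral>\<^sup>+g. u g \<partial>lam x \<partial>\<mu>)"
    using mult by (intro nn_integral_cong nn_integral_cmult) (auto simp: base_space measurable_cong_sets[OF haar_sets refl])
  also have "\<dots> = c * (\<integral>\<^sup>+x. \<integral>\<^sup>+g. u g \<partial>lam x \<partial>\<mu>)"
    using mult haar_measurable by (intro nn_integral_cmult) (auto simp: measurable_cong_sets[OF base_sets refl])
  finally show ?case using mult by (simp add: nn_integral_cmult measurable_cong_sets[OF sets_haar_star refl])
next
  case (add u v)
  have "(\<integral>\<^sup>+x. \<integral>\<^sup>+g. v g + u g \<partial>lam x \<partial>\<mu>) = (\<integral>\<^sup>+x. (\<integral>\<^sup>+g. v g \<partial>lam x) + (\<integral>\<^sup>+g. u g \<partial>lam x) \<partial>\<mu>)"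
    using add by (intro nn_integral_cong nn_integral_add) (auto simp: base_space measurable_cong_sets[OF haar_sets refl])
  also have "\<dots> = (\<integral>\<^sup>+x. \<integral>\<^sup>+g. v g \<partial>lam x \<partial>\<mu>) + (\<integral>\<^sup>+x. \<integral>\<^sup>+g. u g \<partial>lam x \<partial>\<mu>)"
    using add haar_measurable by (intro nn_integral_add) (auto simp: measurable_cong_sets[OF base_sets refl])
  finally show ?case using add by (simp add: nn_integral_add measurable_cong_sets[OF sets_haar_star refl])
next
  case (seq V)
  have "(\<integral>\<^sup>+x. \<integral>\<^sup>+g. (SUP i. V i) g \<partial>lam x \<partial>\<mu>) = (\<integral>\<^sup>+x. (SUP i. \<integral>\<^sup>+g. V i g \<partial>lam x) \<partial>\<mu>)"
    using seq unfolding SUP_apply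
    by (intro nn_integral_cong nn_integral_monotone_convergence_SUP) (auto simp: base_space measurable_cong_sets[OF haar_sets refl])
  also have "\<dots> = (SUP i. \<integral>\<^sup>+x. \<integral>\<^sup>+g. V i g \<partial>lam x \<partial>\<mu>)"
    using seq haar_measurable
    by (intro nn_integral_monotone_convergence_SUP) (auto simp: measurable_cong_sets[OF base_sets refl] incseq_def le_fun_def intro!: nn_integral_mono)
  also have "\<dots> = (SUP i. \<integral>\<^sup>+g. V i g \<partial>haar_star G lam \<mu>)" using seq by simp
  also have "\<dots> = (\<integral>\<^sup>+g. (SUP i. V i) g \<partial>haar_star G lam \<mu>)"
    using seq unfolding SUP_apply
    by (intro nn_integral_monotone_convergence_SUP[symmetric]) (auto simp: measurable_cong_sets[OF sets_haar_star refl])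
  finally show ?case by simp
qed

lemma null_sets_haar_star:
  assumes A: "A \<in> sets (arrs G)"
  shows "A \<in> null_sets (haar_star G lam \<mu>) \<longleftrightarrow> (AE x in \<mu>. AE g in lam x. g \<notin> A)"
proof -
  have "A \<in> null_sets (haar_star G lam \<mu>) \<longleftrightarrow> (AE x in \<mu>. emeasure (lam x) A = 0)"
    using A by (simp add: null_sets_def emeasure_haar_star nn_integral_0_iff_AE haar_measurable_emeasure)
  also have "\<dots> \<longleftrightarrow> (AE x in \<mu>. AE g in lam x. g \<notin> A)"
    using A by (intro AE_cong) (auto simp: AE_iff_null_sets[symmetric] null_sets_def haar_sets base_space)
  finally show ?thesis .
qed


text \<open>With \<open>h\<close> positive and \<open>\<lambda> \<star> \<mu>\<close>-integrable and \<open>w(x) = \<integral> h d\<lambda>\<^sup>x\<close>, the measures \<open>\<kappa>\<^sup>x = (h / w(x)) \<lambda>\<^sup>x\<close> and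
  \<open>w \<mu>\<close> have the required properties where \<open>w\<close> is finite.  Such an \<open>x\<close> belongs to \<open>U\<close> if moreover the
  probability measure \<open>f0 \<lambda>\<^sup>x\<close> is carried by the standard part \<open>X0\<close> of \<open>G\<close>.\<close>

lemma normalization:
  assumes leb: "lebesgue_space (haar_star G lam \<mu>)"
  obtains U \<kappa> \<mu>' where "normalized_groupoid G U \<kappa> \<mu>'"
    "\<And>x P. x \<in> U \<Longrightarrow> (AE g in \<kappa> x. P g) \<longleftrightarrow> (AE g in lam x. P g)"
    "\<And>P. (AE x in \<mu>'. P x) \<longleftrightarrow> (AE x in \<mu>. P x)"
    "\<exists>d\<in>borel_measurable (arrs G). \<forall>x\<in>U. lam x = density (\<kappa> x) d"
proof -
  note [measurable] = measurable_src measurable_tgt measurable_inv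
  let ?m = "haar_star G lam \<mu>"
  interpret m: sigma_finite_measure ?m using leb by (simp add: lebesgue_space_def)
  obtain X0 and e :: "'g \<Rightarrow> real" where X0: "X0 \<in> sets ?m" "AE x in ?m. x \<in> X0" and e: "e \<in> borel_measurable ?m" and inj: "inj_on e X0"
    and D: "\<And>A. A \<in> sets ?m \<Longrightarrow> A \<subseteq> X0 \<Longrightarrow> \<exists>D\<in>sets borel. \<forall>x\<in>X0. x \<in> A \<longleftrightarrow> e x \<in> D"
    using lebesgue_space_coordinate[OF leb] by blast
  have X0s[measurable]: "X0 \<in> sets (arrs G)" using X0 by simp
  have em[measurable]: "e \<in> borel_measurable (arrs G)" using e by (simp add: measurable_cong_sets[OF sets_haar_star refl])
  obtain h where h: "h \<in> borel_measurable ?m" "integral\<^sup>N ?m h \<noteq> \<infinity>" "\<And>g. g \<in> space ?m \<Longrightarrow> 0 < h g" "\<And>g. g \<in> space ?m \<Longrightarrow> h g < \<infinity>"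
    using m.Ex_finite_integrable_function by blast
  have hm[measurable]: "h \<in> borel_measurable (arrs G)" using h(1) by (simp add: measurable_cong_sets[OF sets_haar_star refl])
  obtain f0 :: "'g \<Rightarrow> ennreal" where f0[measurable]: "f0 \<in> borel_measurable (arrs G)" and f01: "\<And>x. x \<in> space (objs G) \<Longrightarrow> (\<integral>\<^sup>+g. f0 g \<partial>lam x) = 1"
    using haar_proper by blast
  have sl: "space (lam x) = space (arrs G)" if "x \<in> space (objs G)" for x
    using haar_sets[OF that] by (rule sets_eq_imp_space_eq)
  have ml: "measurable (lam x) N = measurable (arrs G) N" if "x \<in> space (objs G)" for x and N :: "'z measure"
    using haar_sets[OF that] by (rule measurable_cong_sets) simp
  define w where "w x = (\<integral>\<^sup>+g. h g \<partial>lam x)" for x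
  have wm[measurable]: "w \<in> borel_measurable (objs G)"
    unfolding w_def[abs_def] by (rule haar_measurable) measurable
  have w0: "0 < w x" if x: "x \<in> space (objs G)" for x
  proof (rule ccontr)
    assume "\<not> 0 < w x"
    then have "AE g in lam x. h g = 0"
      unfolding w_def by (subst nn_integral_0_iff_AE[symmetric]) (auto simp: ml[OF x])
    then have "AE g in lam x. f0 g = 0"
      by (rule AE_mp) (use h(3) in \<open>fastforce intro!: AE_I2 simp: sl[OF x]\<close>)
    then have "(\<integral>\<^sup>+g. f0 g \<partial>lam x) = 0"
      by (subst nn_integral_0_iff_AE) (auto simp: ml[OF x])
    then show False using f01[OF x] by simp
  qed
  have "(\<integral>\<^sup>+x. w x \<partial>\<mu>) = integral\<^sup>N ?m h"
    unfolding w_def by (rule nn_integral_haar_star[symmetric]) measurable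
  then have wfin: "(\<integral>\<^sup>+x. w x \<partial>\<mu>) \<noteq> \<infinity>" using h(2) by simp
  have wm'[measurable]: "w \<in> borel_measurable \<mu>" by (simp add: measurable_cong_sets[OF base_sets refl])
  define \<alpha> where "\<alpha> x = density (lam x) f0" for x
  have s\<alpha>: "sets (\<alpha> x) = sets (arrs G)" if "x \<in> space (objs G)" for x using haar_sets[OF that] by (simp add: \<alpha>_def)
  have e\<alpha>: "emeasure (\<alpha> x) A = (\<integral>\<^sup>+g. f0 g * indicator A g \<partial>lam x)" if "x \<in> space (objs G)" "A \<in> sets (arrs G)" for x A
    using that by (simp add: \<alpha>_def emeasure_density ml haar_sets)
  have \<alpha>p: "prob_space (\<alpha> x)" if x: "x \<in> space (objs G)" for x
  proof
    have "(\<integral>\<^sup>+g. f0 g * indicator (space (arrs G)) g \<partial>lam x) = (\<integral>\<^sup>+g. f0 g \<partial>lam x)"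
      by (intro nn_integral_cong) (simp add: sl[OF x])
    then show "emeasure (\<alpha> x) (space (\<alpha> x)) = 1"
      using x by (simp add: e\<alpha> f01 sets_eq_imp_space_eq[OF s\<alpha>])
  qed
  have \<alpha>m: "(\<lambda>x. emeasure (\<alpha> x) A) \<in> borel_measurable (objs G)" if [measurable]: "A \<in> sets (arrs G)" for A
  proof -
    have "(\<lambda>x. \<integral>\<^sup>+g. f0 g * indicator A g \<partial>lam x) \<in> borel_measurable (objs G)"
      by (rule haar_measurable) measurable
    then show ?thesis by (rule measurable_cong[THEN iffD1, rotated]) (simp add: e\<alpha>)
  qed
  have \<alpha>_sub[measurable]: "\<alpha> \<in> measurable (objs G) (prob_algebra (arrs G))"
    by (intro measurable_prob_algebraI measurable_subprob_algebra \<alpha>p \<alpha>m s\<alpha> prob_space_imp_subprob_space)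
  have \<alpha>AE: "AE g in \<alpha> x. P g" if "AE g in lam x. P g" "x \<in> space (objs G)" for P x
    using that unfolding \<alpha>_def by (subst AE_density) (auto simp: ml)
  define U where "U = {x\<in>space (objs G). w x < \<infinity> \<and> emeasure (\<alpha> x) (space (arrs G) - X0) = 0}"
  have Us: "U \<in> sets (objs G)"
  proof -
    have [measurable]: "(\<lambda>x. emeasure (\<alpha> x) (space (arrs G) - X0)) \<in> borel_measurable (objs G)"
      by (rule \<alpha>m) measurable
    show ?thesis unfolding U_def by measurable
  qed
  have Uo: "x \<in> U \<Longrightarrow> x \<in> space (objs G)" for x by (simp add: U_def)
  have AEU: "AE x in \<mu>. x \<in> U"
  proof -
    have "AE x in \<mu>. w x \<noteq> \<infinity>" by (rule nn_integral_PInf_AE[OF wm' wfin])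
    moreover have "AE x in \<mu>. AE g in lam x. g \<notin> space (arrs G) - X0"
    proof (subst null_sets_haar_star[symmetric])
      show "space (arrs G) - X0 \<in> null_sets ?m"
        using X0(2) by (subst AE_iff_null_sets) (auto elim: AE_mp)
    qed measurable
    ultimately show ?thesis using AE_space
    proof eventually_elim
      case (elim x)
      then have x: "x \<in> space (objs G)" by (simp add: base_space)
      have "space (arrs G) - X0 \<in> null_sets (\<alpha> x)"
        using \<alpha>AE[OF elim(2) x] by (subst AE_iff_null_sets) (auto simp: s\<alpha>[OF x])
      then show "x \<in> U" using elim x by (auto simp: U_def less_top)
    qed
  qed
  \<comment> \<open>the coordinate e turns the measures alpha into measures on the line that separate objects\<close>
  define \<rho> where "\<rho> x = distr (\<alpha> x) borel e" for x
  have \<rho>e: "emeasure (\<rho> x) D = emeasure (\<alpha> x) (e -` D \<inter> space (arrs G))" if "x \<in> space (objs G)" "D \<in> sets borel" for x D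
    using that unfolding \<rho>_def by (subst emeasure_distr) (auto simp: measurable_cong_sets[OF s\<alpha> refl] sets_eq_imp_space_eq[OF s\<alpha>])
  have sep: "x = y" if x: "x \<in> U" and y: "y \<in> U" and eq: "\<rho> x = \<rho> y" for x y
  proof (rule ccontr)
    assume "x \<noteq> y"
    \<comment> \<open>\<open>\<alpha>\<^sup>x\<close> and \<open>\<alpha>\<^sup>y\<close> live on disjoint fibres; the fibres need not be measurable, but
      \<open>X0 - N\<close> is a measurable part of the first one that carries \<open>\<alpha>\<^sup>x\<close>\<close>
    note xo = Uo[OF x] and yo = Uo[OF y]
    obtain N where N: "{g\<in>space (lam x). tgt G g \<noteq> x} \<subseteq> N" "N \<in> null_sets (lam x)"
      using haar_fibre[OF xo] by (auto simp: eventually_ae_filter)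
    then have Ns[measurable]: "N \<in> sets (arrs G)" using haar_sets[OF xo] by auto
    let ?A = "X0 - N"
    have A: "?A \<in> sets ?m" "?A \<subseteq> X0" by auto
    obtain D where D': "D \<in> sets borel" "\<And>g. g \<in> X0 \<Longrightarrow> g \<in> ?A \<longleftrightarrow> e g \<in> D" using D[OF A] by blast
    have XA: "X0 \<subseteq> space (arrs G)" using sets.sets_into_space[OF X0s] .
    have \<rho>D: "emeasure (\<rho> z) D = emeasure (\<alpha> z) ?A" if z: "z \<in> U" for z
    proof -
      have zo: "z \<in> space (objs G)" using z by (rule Uo)
      have n: "space (arrs G) - X0 \<in> null_sets (\<alpha> z)"
        using z by (auto simp: U_def null_sets_def s\<alpha>)
      have "AE g in \<alpha> z. g \<in> X0"
        by (rule AE_I'[OF n]) (auto simp: sets_eq_imp_space_eq[OF s\<alpha>[OF zo]])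
      then have "AE g in \<alpha> z. g \<in> e -` D \<inter> space (arrs G) \<longleftrightarrow> g \<in> ?A"
        by eventually_elim (use D'(2) XA in auto)
      then show ?thesis
        unfolding \<rho>e[OF zo D'(1)]
        by (rule emeasure_eq_AE) (use D'(1) in \<open>auto simp: s\<alpha>[OF zo]\<close>)
    qed
    have "AE g in lam x. g \<notin> N" using N(2) by (rule AE_not_in)
    then have "AE g in \<alpha> x. g \<notin> N" using \<alpha>AE xo by blast
    moreover have "AE g in \<alpha> x. g \<in> X0"
    proof (rule AE_I'[where N="space (arrs G) - X0"])
      show "space (arrs G) - X0 \<in> null_sets (\<alpha> x)" using x by (auto simp: U_def null_sets_def s\<alpha>)
    qed (auto simp: sets_eq_imp_space_eq[OF s\<alpha>[OF xo]])
    ultimately have "AE g in \<alpha> x. g \<in> ?A" by eventually_elim auto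
    then have 1: "emeasure (\<alpha> x) ?A = 1"
      using prob_space.emeasure_eq_1_AE[OF \<alpha>p[OF xo]] A by (simp add: s\<alpha>[OF xo])
    have "AE g in lam y. g \<notin> ?A"
      using haar_fibre[OF yo] AE_space
      by eventually_elim (use N(1) \<open>x \<noteq> y\<close> in \<open>auto simp: sl xo yo\<close>)
    then have "AE g in \<alpha> y. g \<notin> ?A" using \<alpha>AE yo by blast
    then have "?A \<in> null_sets (\<alpha> y)" by (subst AE_iff_null_sets) (auto simp: s\<alpha>[OF yo])
    then have "emeasure (\<alpha> y) ?A = 0" by auto
    then show False using 1 \<rho>D[OF x] \<rho>D[OF y] eq by simp
  qed
  have \<rho>m[measurable]: "(\<lambda>x. emeasure (\<rho> x) {q <..}) \<in> borel_measurable (objs G)" for q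
  proof -
    have "(\<lambda>x. emeasure (\<alpha> x) (e -` {q <..} \<inter> space (arrs G))) \<in> borel_measurable (objs G)"
      by (rule \<alpha>m) measurable
    then show ?thesis by (rule measurable_cong[THEN iffD1, rotated]) (simp add: \<rho>e)
  qed
  have \<rho>fin: "finite_measure (\<rho> x)" if "x \<in> space (objs G)" for x
    unfolding \<rho>_def using prob_space.finite_measure[OF \<alpha>p[OF that]]
    by (intro finite_measure.finite_measure_distr) (auto simp: measurable_cong_sets[OF s\<alpha>[OF that] refl])
  have diag: "{(x, y). x \<in> U \<and> x = y} \<in> sets (objs G \<Otimes>\<^sub>M objs G)"
  proof -
    note Us[measurable]
    have "{p\<in>space (objs G \<Otimes>\<^sub>M objs G). fst p \<in> U \<and> snd p \<in> U \<and>
        (\<forall>q\<in>\<rat>. emeasure (\<rho> (fst p)) {q <..} = emeasure (\<rho> (snd p)) {q <..})} \<in> sets (objs G \<Otimes>\<^sub>M objs G)" (is "?S \<in> _")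
      using countable_rat by measurable
    moreover have "?S = {(x, y). x \<in> U \<and> x = y}"
    proof (intro set_eqI iffI)
      fix p assume p: "p \<in> ?S"
      then have "\<rho> (fst p) = \<rho> (snd p)"
        using \<rho>fin Uo by (intro real_measure_eqI_rational_rays) (auto simp: \<rho>_def)
      then show "p \<in> {(x, y). x \<in> U \<and> x = y}" using p sep[of "fst p" "snd p"] by auto
    qed (auto simp: space_pair_measure Uo)
    ultimately show ?thesis by simp
  qed
  interpret S: separated_groupoid G U
    by (rule separated_groupoid.intro[OF borel_groupoid_axioms]) (unfold_locales, rule Us, rule diag)
  define \<kappa> where "\<kappa> x = (if x \<in> U then density (lam x) (\<lambda>g. h g / w x) else \<alpha> x)" for x
  have \<kappa>AE: "(AE g in \<kappa> x. P g) \<longleftrightarrow> (AE g in lam x. P g)" if x: "x \<in> U" for x P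
  proof -
    have xo: "x \<in> space (objs G)" using x by (rule Uo)
    have "(AE g in \<kappa> x. P g) \<longleftrightarrow> (AE g in lam x. 0 < h g / w x \<longrightarrow> P g)"
    proof -
      have "(\<lambda>g. h g / w x) \<in> borel_measurable (lam x)" unfolding ml[OF xo] by measurable
      from AE_density[OF this] show ?thesis unfolding \<kappa>_def if_P[OF x] .
    qed
    also have "\<dots> \<longleftrightarrow> (AE g in lam x. P g)"
      using x h(3) by (intro AE_cong) (auto simp: sl[OF xo] U_def divide_ennreal_def ennreal_zero_less_mult_iff ennreal_inverse_positive less_top)
    finally show ?thesis .
  qed
  have s\<kappa>: "sets (\<kappa> x) = sets (arrs G)" if "x \<in> space (objs G)" for x
    using that by (simp add: \<kappa>_def s\<alpha> haar_sets)
  have e\<kappa>: "emeasure (\<kappa> x) A = (\<integral>\<^sup>+g. h g * indicator A g \<partial>lam x) / w x" if x: "x \<in> U" and A: "A \<in> sets (arrs G)" for x A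
  proof -
    have xo: "x \<in> space (objs G)" using x by (rule Uo)
    have "emeasure (\<kappa> x) A = (\<integral>\<^sup>+g. h g / w x * indicator A g \<partial>lam x)"
      using x A by (simp add: \<kappa>_def emeasure_density ml[OF xo] haar_sets[OF xo])
    also have "\<dots> = (\<integral>\<^sup>+g. h g * indicator A g / w x \<partial>lam x)"
      by (intro nn_integral_cong) (simp add: divide_ennreal_def mult_ac)
    also have "\<dots> = (\<integral>\<^sup>+g. h g * indicator A g \<partial>lam x) / w x"
      using A by (intro nn_integral_divide) (simp add: ml[OF xo])
    finally show ?thesis .
  qed
  have \<kappa>p: "prob_space (\<kappa> x)" if xo: "x \<in> space (objs G)" for x
  proof (cases "x \<in> U")
    case True
    show ?thesis
    proof
      have "(\<integral>\<^sup>+g. h g * indicator (space (arrs G)) g \<partial>lam x) = w x"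
        unfolding w_def by (intro nn_integral_cong) (simp add: sl[OF xo])
      then show "emeasure (\<kappa> x) (space (\<kappa> x)) = 1"
        using True w0[OF xo] by (simp add: e\<kappa> sets_eq_imp_space_eq[OF s\<kappa>[OF xo]] U_def ennreal_divide_self)
    qed
  qed (use \<alpha>p[OF xo] in \<open>simp add: \<kappa>_def\<close>)
  have \<kappa>m: "(\<lambda>x. emeasure (\<kappa> x) A) \<in> borel_measurable (objs G)" if A[measurable]: "A \<in> sets (arrs G)" for A
  proof -
    note \<alpha>m[OF A, measurable]
    have [measurable]: "(\<lambda>x. \<integral>\<^sup>+g. h g * indicator A g \<partial>lam x) \<in> borel_measurable (objs G)"
      by (rule haar_measurable) measurable
    have "(\<lambda>x. if x \<in> U then (\<integral>\<^sup>+g. h g * indicator A g \<partial>lam x) / w x else emeasure (\<alpha> x) A) \<in> borel_measurable (objs G)"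
      using Us by measurable
    then show ?thesis by (rule measurable_cong[THEN iffD1, rotated]) (simp add: e\<kappa> A, simp add: \<kappa>_def)
  qed
  define \<mu>' where "\<mu>' = density \<mu> w"
  have \<mu>AE: "(AE x in \<mu>'. P x) \<longleftrightarrow> (AE x in \<mu>. P x)" for P
  proof -
    have "(AE x in \<mu>'. P x) \<longleftrightarrow> (AE x in \<mu>. 0 < w x \<longrightarrow> P x)"
      unfolding \<mu>'_def by (rule AE_density) measurable
    also have "\<dots> \<longleftrightarrow> (AE x in \<mu>. P x)" by (rule AE_cong) (simp add: w0 base_space)
    finally show ?thesis .
  qed
  have "normalized_groupoid G U \<kappa> \<mu>'"
  proof (rule normalized_groupoid.intro[OF S.separated_groupoid_axioms normalized_groupoid_axioms.intro])
    show "\<kappa> \<in> measurable (objs G) (prob_algebra (arrs G))"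
      by (intro measurable_prob_algebraI measurable_subprob_algebra \<kappa>p \<kappa>m s\<kappa> prob_space_imp_subprob_space)
    show "AE g in \<kappa> x. tgt G g = x" if "x \<in> U" for x
      using \<kappa>AE[OF that] haar_fibre[OF Uo[OF that]] by simp
    show "(AE k in \<kappa> (src G g). S.tmult g k \<notin> A) \<longleftrightarrow> (AE k in \<kappa> (tgt G g). k \<notin> A)"
      if g: "g \<in> space (arrs G)" "src G g \<in> U" "tgt G g \<in> U" and A[measurable]: "A \<in> sets (arrs G)" for g A
    proof -
      have so: "src G g \<in> space (objs G)" using Uo g by simp
      have gg: "(\<lambda>_. g) \<in> measurable N (arrs G)" for N :: "'g measure" using g by simp
      have gmg: "S.tmult g \<in> measurable (lam (src G g)) (arrs G)"
        unfolding ml[OF so] by (rule S.measurable_tmult[OF gg]) simp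
      have "lam (tgt G g) = distr (lam (src G g)) (arrs G) (S.tmult g)"
        using haar_translate[OF g(1)] S.translate_eq_distr[OF g(1,2) haar_sets[OF so] haar_fibre[OF so]] by simp
      then have "(AE k in lam (tgt G g). k \<notin> A) \<longleftrightarrow> (AE k in distr (lam (src G g)) (arrs G) (S.tmult g). k \<notin> A)"
        by (rule arg_cong)
      also have "\<dots> \<longleftrightarrow> (AE k in lam (src G g). S.tmult g k \<notin> A)"
        by (rule AE_distr_iff[OF gmg]) measurable
      finally have "(AE k in lam (tgt G g). k \<notin> A) \<longleftrightarrow> (AE k in lam (src G g). S.tmult g k \<notin> A)" .
      then show ?thesis using g by (simp add: \<kappa>AE)
    qed
    show "finite_measure \<mu>'"
    proof (rule finite_measureI)
      have "emeasure \<mu>' (space \<mu>') = (\<integral>\<^sup>+x. w x * indicator (space \<mu>) x \<partial>\<mu>)"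
        unfolding \<mu>'_def by (subst emeasure_density) auto
      also have "\<dots> = (\<integral>\<^sup>+x. w x \<partial>\<mu>)" by (intro nn_integral_cong) simp
      finally show "emeasure \<mu>' (space \<mu>') \<noteq> \<infinity>" using wfin by simp
    qed
    show "sets \<mu>' = sets (objs G)" by (simp add: \<mu>'_def base_sets)
    show "AE x in \<mu>'. x \<in> U" by (simp add: \<mu>AE AEU)
    show "AE x in \<mu>'. AE g in \<kappa> x. ginv G g \<notin> A"
      if A[measurable]: "A \<in> sets (arrs G)" and n: "AE x in \<mu>'. AE g in \<kappa> x. g \<notin> A" for A
    proof -
      let ?B = "ginv G -` A \<inter> space (arrs G)"
      have "AE x in \<mu>. AE g in lam x. g \<notin> A"
        using n AEU unfolding \<mu>AE by eventually_elim (simp add: \<kappa>AE)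
      then have "A \<in> null_sets ?m" by (simp add: null_sets_haar_star)
      then have "A \<in> null_sets (distr ?m (arrs G) (ginv G))"
        using base_quasi unfolding quasi_invariant_def mutually_ac_def absolutely_continuous_def by auto
      then have "emeasure ?m ?B = 0"
        by (subst (asm) null_sets_distr_iff) (auto simp: measurable_cong_sets[OF sets_haar_star refl])
      then have "?B \<in> null_sets ?m" by (intro null_setsI) auto
      then have "AE x in \<mu>. AE g in lam x. g \<notin> ?B" by (subst null_sets_haar_star[symmetric]) auto
      then show ?thesis
        using AEU unfolding \<mu>AE
      proof eventually_elim
        case (elim x)
        from elim(1) AE_space have "AE g in lam x. ginv G g \<notin> A"
          by eventually_elim (use sl[OF Uo[OF elim(2)]] in auto)
        then show ?case by (simp add: \<kappa>AE elim)
      qed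
    qed
  qed
  moreover have "\<exists>d\<in>borel_measurable (arrs G). \<forall>x\<in>U. lam x = density (\<kappa> x) d"
  proof (intro bexI ballI)
    let ?d = "\<lambda>g. w (tgt G g) / h g"
    show d: "?d \<in> borel_measurable (arrs G)" by measurable
    fix x assume x: "x \<in> U"
    note xo = Uo[OF x]
    have 1: "(\<lambda>g. h g / w x) \<in> borel_measurable (lam x)" "?d \<in> borel_measurable (lam x)"
      unfolding ml[OF xo] by measurable
    have "density (\<kappa> x) ?d = density (lam x) (\<lambda>g. h g / w x * ?d g)"
      unfolding \<kappa>_def if_P[OF x] by (rule density_density_eq[OF 1])
    also have "\<dots> = density (lam x) (\<lambda>_. 1)"
    proof (rule density_cong)
      show "AE g in lam x. h g / w x * ?d g = 1"
        using haar_fibre[OF xo] AE_space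
      proof eventually_elim
        case (elim g)
        then have "0 < h g" "h g < \<infinity>" using h(3,4) by (auto simp: sl[OF xo])
        moreover have "0 < w x" "w x < \<infinity>" using w0[OF xo] x by (auto simp: U_def)
        ultimately have 1: "h g / h g = 1" "w x / w x = 1" by (auto intro!: ennreal_divide_self simp: less_top)
        have "h g / w x * (w x / h g) = (h g / h g) * (w x / w x)"
          by (simp only: divide_ennreal_def ac_simps)
        then show ?case using elim 1 by simp
      qed
    qed (use 1 in auto)
    also have "\<dots> = lam x" by (rule density_1)
    finally show "lam x = density (\<kappa> x) ?d" by simp
  qed
  ultimately show ?thesis using that \<kappa>AE \<mu>AE by blast
qed

end

section \<open>The action on paths and on the boundary\<close>

text \<open>Makes almost-everywhere statements with respect to a kernel measurable in the parameter, as
  iterated statements of this form need.\<close>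

lemma pred_AE_kernel:
  assumes K[measurable]: "K \<in> measurable M (subprob_algebra N)"
    and P: "Measurable.pred (M \<Otimes>\<^sub>M N) (\<lambda>p. P (fst p) (snd p))"
  shows "Measurable.pred M (\<lambda>x. AE y in K x. P x y)"
proof -
  have P'[measurable]: "Measurable.pred (M \<Otimes>\<^sub>M N) (\<lambda>(x, y). P x y)" using P by (simp add: case_prod_beta)
  have "(\<lambda>x. \<integral>\<^sup>+y. (if P x y then 0 else 1) \<partial>K x) \<in> borel_measurable M"
    by (rule nn_integral_measurable_subprob_algebra2[OF _ K]) measurable
  then have "Measurable.pred M (\<lambda>x. (\<integral>\<^sup>+y. (if P x y then 0 else 1) \<partial>K x) = (0 :: ennreal))"
    by measurable
  also have "?this \<longleftrightarrow> ?thesis"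
  proof (rule measurable_cong)
    fix x assume x: "x \<in> space M"
    have s: "sets (K x) = sets N" using subprob_measurableD(2)[OF K x] .
    have "Measurable.pred N (\<lambda>y. P x y)"
      using measurable_compose[OF measurable_Pair1'[OF x] P] by simp
    then have "(\<lambda>y. (if P x y then 0 else 1) :: ennreal) \<in> borel_measurable (K x)"
      unfolding measurable_cong_sets[OF s refl] by measurable
    then show "((\<integral>\<^sup>+y. (if P x y then 0 else 1) \<partial>K x) = (0 :: ennreal)) \<longleftrightarrow> (AE y in K x. P x y)"
      by (subst nn_integral_0_iff_AE) (auto intro!: AE_cong split: if_splits)
  qed
  finally show ?thesis .
qed

lemma (in markov_kernel) cyl_cong:
  assumes "\<And>i y. y \<in> space M \<Longrightarrow> u i y = v i y" "x \<in> space M"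
  shows "cyl \<pi> (map u ns) x = cyl \<pi> (map v ns) x"
  using assms(2)
proof (induction ns arbitrary: x)
  case (Cons i ns)
  have "(\<integral>\<^sup>+y. cyl \<pi> (map u ns) y \<partial>\<pi> x) = (\<integral>\<^sup>+y. cyl \<pi> (map v ns) y \<partial>\<pi> x)"
    using Cons by (intro nn_integral_cong) (simp add: pi_space)
  then show ?case using Cons assms(1) by simp
qed simp

lemma AE_iff_AE: "AE x in M. P x \<longleftrightarrow> P' x \<Longrightarrow> (AE x in M. P x) \<longleftrightarrow> (AE x in M. P' x)"
proof
  assume h: "AE x in M. P x \<longleftrightarrow> P' x"
  { assume "AE x in M. P x" with h show "AE x in M. P' x" by eventually_elim simp }
  { assume "AE x in M. P' x" with h show "AE x in M. P x" by eventually_elim simp }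
qed

lemma prob_space_AE_commute:
  assumes "prob_space M" "prob_space N" and P: "Measurable.pred (M \<Otimes>\<^sub>M N) (\<lambda>p. P (fst p) (snd p))"
  shows "(AE x in M. AE y in N. P x y) \<longleftrightarrow> (AE y in N. AE x in M. P x y)"
proof -
  interpret M: prob_space M by fact
  interpret N: prob_space N by fact
  interpret pair_sigma_finite M N ..
  show ?thesis using P by (intro AE_commute) (simp add: pred_def)
qed

text \<open>An invariant Markov operator over a normalized system.  Objects exist by assumption, since the Giry
  bind over an empty space carries the wrong \<open>\<sigma>\<close>-algebra.\<close>

locale invariant_chain = normalized_groupoid G U \<kappa> \<mu> for G :: "('o, 'g) groupoid" and U \<kappa> \<mu> +
  fixes \<pi> :: "'g \<Rightarrow> 'g measure"
  assumes nonempty: "space (objs G) \<noteq> {}"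
    and pi_kernel: "\<pi> \<in> measurable (arrs G) (prob_algebra (arrs G))"
    and pi_fibre: "\<And>g. g \<in> space (arrs G) \<Longrightarrow> AE h in \<pi> g. tgt G h = tgt G g"
    and pi_translate: "\<And>g k. g \<in> space (arrs G) \<Longrightarrow> k \<in> space (arrs G) \<Longrightarrow> src G g = tgt G k \<Longrightarrow> src G g \<in> U \<Longrightarrow>
        \<pi> (gmult G g k) = distr (\<pi> k) (arrs G) (tmult g)"
    and pi_adapted: "\<And>A. A \<in> sets (arrs G) \<Longrightarrow> (AE x in \<mu>. AE g in \<kappa> x. g \<notin> A) \<Longrightarrow>
        (AE x in \<mu>. AE g in \<kappa> x. AE h in \<pi> g. h \<notin> A)"
begin

sublocale markov_kernel "arrs G" \<pi> by standard (rule pi_kernel)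
sublocale mu: finite_measure \<mu> by (rule finite_mu)

lemma space_mu: "space \<mu> = space (objs G)" using sets_mu by (rule sets_eq_imp_space_eq)

lemma kappa_sub[measurable]: "\<kappa> \<in> measurable (objs G) (subprob_algebra (arrs G))"
  using kappa by (rule measurable_prob_algebraD)

lemma kappa_space: "x \<in> space (objs G) \<Longrightarrow> space (\<kappa> x) = space (arrs G)"
  and kappa_sets: "x \<in> space (objs G) \<Longrightarrow> sets (\<kappa> x) = sets (arrs G)"
  using subprob_measurableD[OF kappa_sub] by auto

lemma kappa_prob: "x \<in> space (objs G) \<Longrightarrow> prob_space (\<kappa> x)"
  using measurable_space[OF kappa] by (auto simp: space_prob_algebra)

abbreviation "PS \<equiv> paths (arrs G)"
abbreviation "PL \<equiv> path_law (arrs G) \<pi>"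

text \<open>\<open>Qfib x\<close> is the law of the chain with initial distribution \<open>\<kappa>\<^sup>x\<close>, and \<open>Q\<close> is a finite measure equivalent to the path
  measure with initial measure \<open>\<lambda> \<star> \<mu>\<close>.\<close>

definition Qfib :: "'o \<Rightarrow> (nat \<Rightarrow> 'g) measure" where "Qfib x = \<kappa> x \<bind> PL"
definition Q :: "(nat \<Rightarrow> 'g) measure" where "Q = \<mu> \<bind> Qfib"

lemma Qfib_prob[measurable]: "Qfib \<in> measurable (objs G) (prob_algebra PS)"
  unfolding Qfib_def[abs_def] by (rule measurable_bind_prob_space[OF kappa]) measurable

lemma Qfib_sub[measurable]: "Qfib \<in> measurable (objs G) (subprob_algebra PS)"
  using Qfib_prob by (rule measurable_prob_algebraD)

lemma Qfib_space: "x \<in> space (objs G) \<Longrightarrow> space (Qfib x) = space PS"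
  and Qfib_sets: "x \<in> space (objs G) \<Longrightarrow> sets (Qfib x) = sets PS"
  using subprob_measurableD[OF Qfib_sub] by auto

lemma Qfib_prob_space: "x \<in> space (objs G) \<Longrightarrow> prob_space (Qfib x)"
  using measurable_space[OF Qfib_prob] by (auto simp: space_prob_algebra)

lemma Q_sets[measurable_cong]: "sets Q = sets PS"
  unfolding Q_def using nonempty by (intro sets_bind) (auto simp: Qfib_sets space_mu)

lemma Q_space: "space Q = space PS" using Q_sets by (rule sets_eq_imp_space_eq)

lemma Qfib_mu: "Qfib \<in> measurable \<mu> (subprob_algebra PS)"
  using Qfib_sub by (simp add: measurable_cong_sets[OF sets_mu refl])

lemma AE_Q: "Measurable.pred PS P \<Longrightarrow> (AE \<omega> in Q. P \<omega>) \<longleftrightarrow> (AE x in \<mu>. AE \<omega> in Qfib x. P \<omega>)"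
  unfolding Q_def by (rule AE_bind[OF Qfib_mu])

lemma AE_Qfib:
  assumes "x \<in> space (objs G)" "Measurable.pred PS P"
  shows "(AE \<omega> in Qfib x. P \<omega>) \<longleftrightarrow> (AE k in \<kappa> x. AE \<omega> in PL k. P \<omega>)"
  unfolding Qfib_def using assms by (intro AE_bind[OF measurable_path_law_cong]) (auto simp: kappa_sets)

lemma finite_Q: "finite_measure Q"
proof (rule finite_measureI)
  have "emeasure Q (space Q) = (\<integral>\<^sup>+x. emeasure (Qfib x) (space PS) \<partial>\<mu>)"
    unfolding Q_space using nonempty unfolding Q_def by (intro emeasure_bind[OF _ Qfib_mu]) (auto simp: space_mu)
  also have "\<dots> = (\<integral>\<^sup>+x. 1 \<partial>\<mu>)"
    using prob_space.emeasure_space_1[OF Qfib_prob_space] Qfib_space by (intro nn_integral_cong) (auto simp: space_mu)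
  finally show "emeasure Q (space Q) \<noteq> \<infinity>" using mu.emeasure_finite by simp
qed

sublocale Q: finite_measure Q by (rule finite_Q)

lemma base_AE_tgt:
  assumes "AE x in \<mu>. V x" shows "AE x in \<mu>. AE g in \<kappa> x. V (tgt G g)"
  using assms AE_mu_U
proof eventually_elim
  case (elim x)
  show ?case using kappa_fibre[OF elim(2)] by eventually_elim (use elim in simp)
qed

lemma quasi_pred:
  assumes P[measurable]: "Measurable.pred (arrs G) P" and "AE x in \<mu>. AE g in \<kappa> x. P g"
  shows "AE x in \<mu>. AE g in \<kappa> x. P (ginv G g)"
proof -
  let ?A = "{g\<in>space (arrs G). \<not> P g}"
  have "AE x in \<mu>. AE g in \<kappa> x. g \<notin> ?A" using assms(2) by eventually_elim (auto elim: eventually_mono)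
  then have "AE x in \<mu>. AE g in \<kappa> x. ginv G g \<notin> ?A" by (intro quasi) measurable
  then show ?thesis using AE_space
  proof eventually_elim
    case (elim x)
    show ?case using elim(1) AE_space
      by eventually_elim (use elim(2) in \<open>auto simp: kappa_space space_mu intro: inv_in\<close>)
  qed
qed

text \<open>For targets the corresponding fact is immediate; the inverse, which preserves null sets, exchanges
  sources and targets.\<close>

lemma base_AE_src:
  assumes "AE x in \<mu>. V x" shows "AE x in \<mu>. AE g in \<kappa> x. V (src G g)"
proof -
  obtain N where N: "{x\<in>space \<mu>. \<not> V x} \<subseteq> N" "N \<in> null_sets \<mu>"
    using assms by (auto simp: eventually_ae_filter)
  have [measurable]: "N \<in> sets (objs G)" using N(2) sets_mu by auto
  have "AE x in \<mu>. x \<notin> N" using N(2) by (rule AE_not_in)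
  from base_AE_tgt[OF this] have "AE x in \<mu>. AE g in \<kappa> x. tgt G (ginv G g) \<notin> N"
    by (intro quasi_pred[where P="\<lambda>g. tgt G g \<notin> N"]) measurable
  then show ?thesis using AE_space
  proof eventually_elim
    case (elim x)
    show ?case using elim(1) AE_space
    proof eventually_elim
      case (elim g)
      then have "g \<in> space (arrs G)" using \<open>x \<in> space \<mu>\<close> by (simp add: kappa_space space_mu)
      then show ?case using elim N(1) src_in by (auto simp: tgt_inv space_mu)
    qed
  qed
qed

lemma AE_path_fibre:
  assumes "k \<in> space (arrs G)" "tgt G k \<in> U"
  shows "AE \<omega> in PL k. \<forall>n. tgt G (\<omega> n) = tgt G k"
proof -
  have m: "Measurable.pred PS (\<lambda>\<omega>. x \<in> U \<and> x = tgt G (\<omega> n))" if "x \<in> space (objs G)" for x n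
  proof -
    have "(\<lambda>_. x) \<in> measurable PS (objs G)" using that by simp
    then show ?thesis by (rule pred_eq_U) measurable
  qed
  have m': "Measurable.pred (arrs G) (\<lambda>k. x \<in> U \<and> x = tgt G k)" if "x \<in> space (objs G)" for x
  proof -
    have "(\<lambda>_. x) \<in> measurable (arrs G) (objs G)" using that by simp
    then show ?thesis by (rule pred_eq_U) measurable
  qed
  have "AE \<omega> in PL k. tgt G k \<in> U \<and> tgt G k = tgt G (\<omega> n)" if "k \<in> space (arrs G)" "tgt G k \<in> U" for n k
    using that
  proof (induction n arbitrary: k)
    case 0
    then show ?case
      using AE_path_law_start[OF _ m'[of "tgt G k"], of k] tgt_in by auto
  next
    case (Suc n)
    have "AE \<omega> in PL k. tgt G k \<in> U \<and> tgt G k = tgt G (time_shift \<omega> n)"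
    proof (subst AE_path_law_shift[OF Suc(2) m])
      show "AE y in \<pi> k. AE \<omega> in PL y. tgt G k \<in> U \<and> tgt G k = tgt G (\<omega> n)"
        using pi_fibre[OF Suc(2)] AE_space
      proof eventually_elim
        case (elim y)
        then show ?case using Suc.IH[of y] Suc(2,3) by (simp add: pi_space)
      qed
    qed (use Suc tgt_in in auto)
    then show ?case by (simp add: time_shift_def)
  qed
  then have "AE \<omega> in PL k. \<forall>n. tgt G k \<in> U \<and> tgt G k = tgt G (\<omega> n)"
    using assms by (simp add: AE_all_countable)
  then show ?thesis by eventually_elim metis
qed

lemma AE_Qfib_fibre:
  assumes x: "x \<in> U" shows "AE \<omega> in Qfib x. \<forall>n. tgt G (\<omega> n) = x"
proof -
  note xo = U_objs[OF x]
  have "(\<lambda>_. x) \<in> measurable PS (objs G)" using xo by simp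
  note [measurable] = pred_eq_U[OF this]
  have "AE \<omega> in Qfib x. \<forall>n. x \<in> U \<and> x = tgt G (\<omega> n)"
  proof (subst AE_Qfib[OF xo])
    show "AE k in \<kappa> x. AE \<omega> in PL k. \<forall>n. x \<in> U \<and> x = tgt G (\<omega> n)"
      using kappa_fibre[OF x] AE_space
    proof eventually_elim
      case (elim k)
      then have "AE \<omega> in PL k. \<forall>n. tgt G (\<omega> n) = tgt G k"
        using x xo by (intro AE_path_fibre) (auto simp: kappa_space)
      then show ?case by eventually_elim (use elim x in auto)
    qed
  qed measurable
  then show ?thesis by eventually_elim metis
qed

definition \<tau> :: "'g \<Rightarrow> (nat \<Rightarrow> 'g) \<Rightarrow> nat \<Rightarrow> 'g" where "\<tau> g \<omega> = (\<lambda>n. tmult g (\<omega> n))"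

lemma measurable_\<tau>[measurable (raw)]:
  assumes [measurable]: "f \<in> measurable N (arrs G)" "h \<in> measurable N PS"
  shows "(\<lambda>x. \<tau> (f x) (h x)) \<in> measurable N PS"
proof -
  have "h x i \<in> space (arrs G)" if "x \<in> space N" for x i
    using measurable_space[OF assms(2) that] by (auto simp: space_PiM)
  then show ?thesis
    unfolding \<tau>_def
    by (intro measurable_PiM_single') (auto intro!: tmult_in measurable_space[OF assms(1)])
qed

text \<open>Invariance of the operator: after a step from \<open>gk\<close> the chain is distributed as \<open>g\<close> times the
  chain after a step from \<open>k\<close>.\<close>

lemma cyl_translate:
  assumes g: "g \<in> space (arrs G)" "src G g \<in> U" and us: "\<And>u. u \<in> set us \<Longrightarrow> u \<in> borel_measurable (arrs G)"
    and k: "k \<in> space (arrs G)" "tgt G k = src G g"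
  shows "cyl \<pi> us (gmult G g k) = cyl \<pi> (map (\<lambda>u y. u (tmult g y)) us) k"
  using us k
proof (induction us arbitrary: k)
  case (Cons u us)
  have gg: "(\<lambda>_. g) \<in> measurable (\<pi> k) (arrs G)" using g by simp
  have gmg: "tmult g \<in> measurable (\<pi> k) (arrs G)"
    using Cons.prems(2) by (intro measurable_tmult[OF gg]) (simp add: measurable_cong_sets[OF pi_sets refl])
  have "(\<integral>\<^sup>+y. cyl \<pi> us y \<partial>\<pi> (gmult G g k)) = (\<integral>\<^sup>+y. cyl \<pi> us (tmult g y) \<partial>\<pi> k)"
    using Cons g unfolding pi_translate[OF g(1) Cons.prems(2) Cons.prems(3)[symmetric] g(2)]
    by (intro nn_integral_distr[OF gmg]) (auto intro!: measurable_cyl)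
  also have "\<dots> = (\<integral>\<^sup>+y. cyl \<pi> (map (\<lambda>u y. u (tmult g y)) us) y \<partial>\<pi> k)"
  proof (rule nn_integral_cong_AE)
    show "AE y in \<pi> k. cyl \<pi> us (tmult g y) = cyl \<pi> (map (\<lambda>u y. u (tmult g y)) us) y"
      using pi_fibre[OF Cons.prems(2)] AE_space
    proof eventually_elim
      case (elim y)
      then have y: "y \<in> space (arrs G)" "tgt G y = src G g" using Cons.prems by (auto simp: pi_space)
      then have "tmult g y = gmult G g y" using g by (simp add: tmult_def)
      then show ?case using Cons.IH[OF Cons.prems(1) y] by simp
    qed
  qed
  finally have "(\<integral>\<^sup>+y. cyl \<pi> us y \<partial>\<pi> (gmult G g k)) = (\<integral>\<^sup>+y. cyl \<pi> (map (\<lambda>u y. u (tmult g y)) us) y \<partial>\<pi> k)" .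
  moreover have "tmult g k = gmult G g k" using Cons.prems g by (simp add: tmult_def)
  ultimately show ?case by simp
qed simp

lemma path_law_translate:
  assumes g: "g \<in> space (arrs G)" "src G g \<in> U" and k: "k \<in> space (arrs G)" "tgt G k = src G g"
  shows "PL (gmult G g k) = distr (PL k) PS (\<tau> g)"
proof (rule measure_eqI_paths)
  have gk: "gmult G g k \<in> space (arrs G)" using g k by (intro mult_in) (auto simp: composable_def)
  have gg: "(\<lambda>_. g) \<in> measurable N (arrs G)" for N :: "'z measure" using g by simp
  have gmg: "tmult g \<in> measurable (arrs G) (arrs G)" by (intro measurable_tmult[OF gg]) simp
  have tg: "\<tau> g \<in> measurable (PL k) PS" using measurable_\<tau>[OF gg, of "\<lambda>x. x"] k by (simp add: measurable_cong_sets[OF sets_path_law refl])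
  show "finite_measure (PL (gmult G g k))" by (rule prob_space.finite_measure[OF prob_space_path_law[OF gk]])
  show "sets (PL (gmult G g k)) = sets PS" using gk by (rule sets_path_law)
  fix n and A :: "nat \<Rightarrow> 'g set" assume A[measurable]: "\<And>i. A i \<in> sets (arrs G)"
  let ?B = "\<lambda>i. tmult g -` A i \<inter> space (arrs G)"
  have B: "?B i \<in> sets (arrs G)" for i by (rule measurable_sets[OF gmg A])
  have cs: "{\<omega> \<in> space PS. \<forall>i\<le>n. \<omega> i \<in> A i} \<in> sets PS" by measurable
  have "emeasure (PL (gmult G g k)) {\<omega> \<in> space PS. \<forall>i\<le>n. \<omega> i \<in> A i} = cyl \<pi> (map (\<lambda>i. indicator (A i)) [0..<Suc n]) (gmult G g k)"
    by (rule emeasure_path_law_cylinder[OF gk]) simp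
  also have "\<dots> = cyl \<pi> (map (\<lambda>u y. u (tmult g y)) (map (\<lambda>i. indicator (A i)) [0..<Suc n])) k"
    by (rule cyl_translate[OF g _ k]) auto
  also have "\<dots> = cyl \<pi> (map (\<lambda>i. indicator (?B i)) [0..<Suc n]) k"
  proof -
    have "cyl \<pi> (map (\<lambda>i y. indicator (A i) (tmult g y)) [0..<Suc n]) k = cyl \<pi> (map (\<lambda>i. indicator (?B i)) [0..<Suc n]) k"
      by (rule cyl_cong[OF _ k(1)]) (simp add: indicator_def)
    then show ?thesis by (simp add: comp_def del: upt_Suc)
  qed
  also have "\<dots> = emeasure (PL k) {\<omega> \<in> space PS. \<forall>i\<le>n. \<omega> i \<in> ?B i}"
    by (rule emeasure_path_law_cylinder[OF k(1), symmetric]) (rule B)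
  also have "{\<omega> \<in> space PS. \<forall>i\<le>n. \<omega> i \<in> ?B i} = \<tau> g -` {\<omega> \<in> space PS. \<forall>i\<le>n. \<omega> i \<in> A i} \<inter> space (PL k)"
    using g k by (auto simp: \<tau>_def space_path_law space_PiM PiE_iff tmult_in)
  also have "emeasure (PL k) \<dots> = emeasure (distr (PL k) PS (\<tau> g)) {\<omega> \<in> space PS. \<forall>i\<le>n. \<omega> i \<in> A i}"
    by (rule emeasure_distr[OF tg cs, symmetric])
  finally show "emeasure (PL (gmult G g k)) {\<omega> \<in> space PS. \<forall>i\<le>n. \<omega> i \<in> A i} = \<dots>" .
qed simp

text \<open>Translation by \<open>g\<close> maps the null sets of the chain over the source of \<open>g\<close> onto those of the chain
  over its target, because it does so with the initial distributions.\<close>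

lemma AE_Qfib_translate:
  assumes g: "g \<in> space (arrs G)" "src G g \<in> U" "tgt G g \<in> U" and P[measurable]: "Measurable.pred PS P"
  shows "(AE \<omega> in Qfib (src G g). P (\<tau> g \<omega>)) \<longleftrightarrow> (AE \<omega> in Qfib (tgt G g). P \<omega>)"
proof -
  note so = U_objs[OF g(2)] and to = U_objs[OF g(3)]
  have gg: "(\<lambda>_. g) \<in> measurable N (arrs G)" for N :: "'z measure" using g by simp
  have tg[measurable]: "\<tau> g \<in> measurable PS PS" using measurable_\<tau>[OF gg, of "\<lambda>x. x"] by simp
  have good: "Measurable.pred (arrs G) (\<lambda>k. AE \<omega> in PL k. P \<omega>)"
    by (rule pred_AE_kernel[OF measurable_path_law]) measurable
  let ?A = "{k\<in>space (arrs G). \<not> (AE \<omega> in PL k. P \<omega>)}"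
  have A: "?A \<in> sets (arrs G)" using good by measurable
  have "(AE \<omega> in Qfib (src G g). P (\<tau> g \<omega>)) \<longleftrightarrow> (AE k in \<kappa> (src G g). AE \<omega> in PL k. P (\<tau> g \<omega>))"
    by (rule AE_Qfib[OF so]) measurable
  also have "\<dots> \<longleftrightarrow> (AE k in \<kappa> (src G g). tmult g k \<notin> ?A)"
  proof -
    have "AE k in \<kappa> (src G g). (AE \<omega> in PL k. P (\<tau> g \<omega>)) \<longleftrightarrow> tmult g k \<notin> ?A"
      using kappa_fibre[OF g(2)] AE_space
    proof eventually_elim
      case (elim k)
      then have k: "k \<in> space (arrs G)" "tgt G k = src G g" using so by (auto simp: kappa_space)
      have e: "tmult g k = gmult G g k" using g k by (simp add: tmult_def)
      have "(AE \<omega> in PL (gmult G g k). P \<omega>) \<longleftrightarrow> (AE \<omega> in PL k. P (\<tau> g \<omega>))"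
        unfolding path_law_translate[OF g(1,2) k]
        using k by (intro AE_distr_iff) (auto simp: measurable_cong_sets[OF sets_path_law refl])
      then show ?case using tmult_in[OF g(1) k(1)] e by auto
    qed
    then show ?thesis by (rule AE_iff_AE)
  qed
  also have "\<dots> \<longleftrightarrow> (AE k in \<kappa> (tgt G g). k \<notin> ?A)" by (rule kappa_translate[OF g A])
  also have "\<dots> \<longleftrightarrow> (AE k in \<kappa> (tgt G g). AE \<omega> in PL k. P \<omega>)"
    by (rule AE_cong) (use to in \<open>auto simp: kappa_space\<close>)
  also have "\<dots> \<longleftrightarrow> (AE \<omega> in Qfib (tgt G g). P \<omega>)"
    by (rule AE_Qfib[OF to, symmetric]) measurable
  finally show ?thesis .
qed

lemma kernel_at_start: "(\<lambda>\<omega>. \<kappa> (tgt G (\<omega> 0))) \<in> measurable PS (subprob_algebra (arrs G))"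
  by measurable

text \<open>Given the object \<open>x\<close>, the path and the arrow \<open>g\<close> are independent, so that Fubini's theorem applies.\<close>

lemma AE_swap:
  assumes R: "Measurable.pred (arrs G \<Otimes>\<^sub>M PS) (\<lambda>p. R (fst p) (snd p))"
  shows "(AE \<omega> in Q. AE g in \<kappa> (tgt G (\<omega> 0)). R g \<omega>) \<longleftrightarrow> (AE x in \<mu>. AE g in \<kappa> x. AE \<omega> in Qfib x. R g \<omega>)"
proof -
  have R': "Measurable.pred (PS \<Otimes>\<^sub>M arrs G) (\<lambda>p. R (snd p) (fst p))"
    using measurable_compose[OF measurable_Pair[OF measurable_snd measurable_fst] R] by simp
  have "(AE \<omega> in Q. AE g in \<kappa> (tgt G (\<omega> 0)). R g \<omega>) \<longleftrightarrow> (AE x in \<mu>. AE \<omega> in Qfib x. AE g in \<kappa> (tgt G (\<omega> 0)). R g \<omega>)"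
    by (rule AE_Q, rule pred_AE_kernel[OF kernel_at_start R'])
  also have "\<dots> \<longleftrightarrow> (AE x in \<mu>. AE g in \<kappa> x. AE \<omega> in Qfib x. R g \<omega>)"
  proof -
    have "AE x in \<mu>. (AE \<omega> in Qfib x. AE g in \<kappa> (tgt G (\<omega> 0)). R g \<omega>) \<longleftrightarrow> (AE g in \<kappa> x. AE \<omega> in Qfib x. R g \<omega>)"
      using AE_mu_U
    proof eventually_elim
      case (elim x)
      note xo = U_objs[OF elim]
      have "(AE \<omega> in Qfib x. AE g in \<kappa> (tgt G (\<omega> 0)). R g \<omega>) \<longleftrightarrow> (AE \<omega> in Qfib x. AE g in \<kappa> x. R g \<omega>)"
      proof -
        have "AE \<omega> in Qfib x. (AE g in \<kappa> (tgt G (\<omega> 0)). R g \<omega>) \<longleftrightarrow> (AE g in \<kappa> x. R g \<omega>)"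
          using AE_Qfib_fibre[OF elim]
        proof eventually_elim
          case (elim \<omega>)
          then have "tgt G (\<omega> 0) = x" by blast
          then show ?case by (simp only:)
        qed
        then show ?thesis by (rule AE_iff_AE)
      qed
      also have "\<dots> \<longleftrightarrow> (AE g in \<kappa> x. AE \<omega> in Qfib x. R g \<omega>)"
        by (rule prob_space_AE_commute[OF kappa_prob[OF xo] Qfib_prob_space[OF xo], symmetric])
           (use R in \<open>simp add: measurable_cong_sets[OF sets_pair_measure_cong[OF kappa_sets[OF xo] Qfib_sets[OF xo]] refl]\<close>)
      finally show ?case .
    qed
    then show ?thesis by (rule AE_iff_AE)
  qed
  finally show ?thesis .
qed

lemma AE_kappa_arrow:
  assumes "AE x in \<mu>. AE g in \<kappa> x. g \<in> space (arrs G) \<and> tgt G g = x \<and> x \<in> U \<and> src G g \<in> U \<longrightarrow> P x g"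
  shows "AE x in \<mu>. AE g in \<kappa> x. P x g"
  using assms base_AE_src[OF AE_mu_U] AE_mu_U
proof eventually_elim
  case (elim x)
  show ?case using elim(1,2) kappa_fibre[OF elim(3)] AE_space
    by eventually_elim (use elim(3) U_objs[OF elim(3)] in \<open>auto simp: kappa_space\<close>)
qed

text \<open>The map \<open>(g, \<omega>) \<mapsto> (g\<^sup>-\<^sup>1, g\<^sup>-\<^sup>1 \<omega>)\<close> is nonsingular: exchange path and arrow, use that inversion
  preserves null sets of arrows, translate the path by \<open>g\<^sup>-\<^sup>1\<close>, and exchange back.\<close>

lemma AE_inverse_translate:
  assumes R[measurable]: "Measurable.pred (arrs G \<Otimes>\<^sub>M PS) (\<lambda>p. R (fst p) (snd p))"
    and ae: "AE \<omega> in Q. AE g in \<kappa> (tgt G (\<omega> 0)). R g \<omega>"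
  shows "AE \<omega> in Q. AE g in \<kappa> (tgt G (\<omega> 0)). R (ginv G g) (\<tau> (ginv G g) \<omega>)"
proof (subst AE_swap)
  have m2: "Measurable.pred N (\<lambda>x. R (f x) (h x))" if "f \<in> measurable N (arrs G)" "h \<in> measurable N PS" for f h and N :: "'z measure"
    using measurable_compose[OF measurable_Pair[OF that] R] by simp
  show "Measurable.pred (arrs G \<Otimes>\<^sub>M PS) (\<lambda>p. R (ginv G (fst p)) (\<tau> (ginv G (fst p)) (snd p)))"
    by (intro m2) measurable
  define S where "S g \<longleftrightarrow> (AE \<omega> in Qfib (tgt G g). R g \<omega>)" for g
  have S: "Measurable.pred (arrs G) S"
    unfolding S_def by (rule pred_AE_kernel[OF measurable_compose[OF measurable_tgt Qfib_sub] R])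
  have "AE x in \<mu>. AE g in \<kappa> x. S g"
  proof (rule AE_kappa_arrow)
    show "AE x in \<mu>. AE g in \<kappa> x. g \<in> space (arrs G) \<and> tgt G g = x \<and> x \<in> U \<and> src G g \<in> U \<longrightarrow> S g"
      using ae unfolding AE_swap[OF R] S_def by eventually_elim (auto elim: eventually_mono)
  qed
  from quasi_pred[OF S this]
  have "AE x in \<mu>. AE g in \<kappa> x. g \<in> space (arrs G) \<and> tgt G g = x \<and> x \<in> U \<and> src G g \<in> U \<longrightarrow> (AE \<omega> in Qfib x. R (ginv G g) (\<tau> (ginv G g) \<omega>))"
  proof eventually_elim
    case (elim x)
    then show ?case
    proof eventually_elim
      case (elim g)
      show ?case
      proof safe
        assume g: "g \<in> space (arrs G)" "tgt G g \<in> U" "x = tgt G g" "src G g \<in> U"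
        have "Measurable.pred PS (R (ginv G g))" using g(1) by (intro m2) (auto intro: inv_in)
        from AE_Qfib_translate[of "ginv G g", OF _ _ _ this, unfolded src_inv[OF g(1)] tgt_inv[OF g(1)]]
          elim[unfolded S_def tgt_inv[OF g(1)]] g
        show "AE \<omega> in Qfib (tgt G g). R (ginv G g) (\<tau> (ginv G g) \<omega>)"
          by (simp add: inv_in)
      qed
    qed
  qed
  then show "AE x in \<mu>. AE g in \<kappa> x. AE \<omega> in Qfib x. R (ginv G g) (\<tau> (ginv G g) \<omega>)"
    by (rule AE_kappa_arrow)
qed

text \<open>Nonsingularity of the shift, which is what adaptedness of the initial measure amounts to.\<close>

lemma AE_time_shift:
  assumes P[measurable]: "Measurable.pred PS P" and ae: "AE \<omega> in Q. P \<omega>"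
  shows "AE \<omega> in Q. P (time_shift \<omega>)"
proof -
  have AEQ2: "(AE \<omega> in Q. P \<omega>) \<longleftrightarrow> (AE x in \<mu>. AE k in \<kappa> x. AE \<omega> in PL k. P \<omega>)" if "Measurable.pred PS P" for P
    unfolding AE_Q[OF that] using that by (intro AE_cong AE_Qfib) (simp add: space_mu)
  have good: "Measurable.pred (arrs G) (\<lambda>k. AE \<omega> in PL k. P \<omega>)"
    by (rule pred_AE_kernel[OF measurable_path_law]) measurable
  let ?A = "{k\<in>space (arrs G). \<not> (AE \<omega> in PL k. P \<omega>)}"
  have A: "?A \<in> sets (arrs G)" using good by measurable
  have "AE x in \<mu>. AE g in \<kappa> x. AE h in \<pi> g. h \<notin> ?A"
    using ae unfolding AEQ2[OF P] by (intro pi_adapted[OF A]) (auto elim!: eventually_mono)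
  then have "AE x in \<mu>. AE k in \<kappa> x. AE \<omega> in PL k. P (time_shift \<omega>)"
    using AE_space
  proof eventually_elim
    case (elim x)
    show ?case using elim(1) AE_space
    proof eventually_elim
      case (elim k)
      then have k: "k \<in> space (arrs G)" using \<open>x \<in> space \<mu>\<close> by (simp add: kappa_space space_mu)
      have "AE y in \<pi> k. AE \<omega> in PL y. P \<omega>"
        using elim(1) AE_space by eventually_elim (use k in \<open>auto simp: pi_space\<close>)
      then show ?case by (simp add: AE_path_law_shift[OF k P])
    qed
  qed
  then show ?thesis by (subst AEQ2) measurable
qed

end

text \<open>\<open>Y0\<close> is a conull standard part of the boundary; as for \<open>U\<close>, it is on \<open>Y0\<close> that equality of
  points is a measurable relation.\<close>

locale boundary_chain = invariant_chain G U \<kappa> \<mu> \<pi> + borel_gspace G X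
  for G :: "('o, 'g) groupoid" and U \<kappa> \<mu> \<pi> and X :: "('o, 'g, 'y) gspace" +
  fixes bnd :: "(nat \<Rightarrow> 'g) \<Rightarrow> 'y" and Y0 :: "'y set"
  assumes bnd[measurable]: "bnd \<in> measurable PS (pts X)"
    and Y0[measurable]: "Y0 \<in> sets (pts X)"
    and diag_Y0: "{(x, y). x \<in> Y0 \<and> x = y} \<in> sets (pts X \<Otimes>\<^sub>M pts X)"
    and AE_bnd_Y0: "AE \<omega> in Q. bnd \<omega> \<in> Y0"
    and AE_proj_bnd: "AE \<omega> in Q. proj X (bnd \<omega>) = tgt G (\<omega> 0)"
    and AE_equivariant: "AE x in \<mu>. AE g in \<kappa> x. AE \<omega> in Qfib (src G g). bnd (\<lambda>n. gmult G g (\<omega> n)) = act X g (bnd \<omega>)"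
begin

declare measurable_proj[measurable]

lemma Y0_pts: "y \<in> Y0 \<Longrightarrow> y \<in> space (pts X)"
  using sets.sets_into_space[OF Y0] by auto

lemma pred_eq_Y0[measurable (raw)]:
  assumes [measurable]: "f \<in> measurable N (pts X)" "g \<in> measurable N (pts X)"
  shows "Measurable.pred N (\<lambda>x. f x \<in> Y0 \<and> f x = g x)"
proof -
  have "(\<lambda>x. (f x, g x)) -` {(x, y). x \<in> Y0 \<and> x = y} \<inter> space N \<in> sets N"
    by (rule measurable_sets[OF _ diag_Y0]) measurable
  also have "(\<lambda>x. (f x, g x)) -` {(x, y). x \<in> Y0 \<and> x = y} \<inter> space N = {x\<in>space N. f x \<in> Y0 \<and> f x = g x}"
    by auto
  finally show ?thesis by (simp add: pred_def)
qed

text \<open>The action made total, like the multiplication.\<close>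

definition tact :: "'g \<Rightarrow> 'y \<Rightarrow> 'y" where
  "tact g y = (if src G g \<in> U \<and> src G g = proj X y then act X g y else y)"

lemma measurable_tact_pair: "(\<lambda>p. tact (fst p) (snd p)) \<in> measurable (arrs G \<Otimes>\<^sub>M pts X) (pts X)"
proof -
  let ?M = "arrs G \<Otimes>\<^sub>M pts X"
  define S where "S = {p\<in>space ?M. src G (fst p) \<in> U \<and> src G (fst p) = proj X (snd p)}"
  have S: "{p\<in>space ?M. p \<in> S} \<in> sets ?M"
  proof -
    have "S \<in> sets ?M" unfolding S_def pred_def[symmetric] by measurable
    also have "S = {p\<in>space ?M. p \<in> S}" by (auto simp: S_def)
    finally show ?thesis .
  qed
  have 1: "(\<lambda>p. act X (fst p) (snd p)) \<in> measurable (restrict_space ?M S) (pts X)"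
  proof -
    have "S \<subseteq> actable G X" by (auto simp: S_def actable_def space_pair_measure)
    from measurable_restrict_mono[OF measurable_act this] show ?thesis by (simp add: split_beta')
  qed
  have "(\<lambda>p. if p \<in> S then act X (fst p) (snd p) else snd p) \<in> measurable ?M (pts X)"
    unfolding measurable_If_restrict_space_iff[OF S]
    using 1 by (auto intro!: measurable_restrict_space1)
  then show ?thesis
    by (rule measurable_cong[THEN iffD1, rotated]) (auto simp: S_def tact_def)
qed

lemma measurable_tact[measurable (raw)]:
  assumes "f \<in> measurable N (arrs G)" "g \<in> measurable N (pts X)"
  shows "(\<lambda>x. tact (f x) (g x)) \<in> measurable N (pts X)"
  using measurable_compose[OF measurable_Pair[OF assms] measurable_tact_pair] by simp

lemma AE_Qfib_bnd_proj: "AE x in \<mu>. AE \<omega> in Qfib x. proj X (bnd \<omega>) = x \<and> bnd \<omega> \<in> Y0"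
proof -
  have t0: "AE \<omega> in Q. tgt G (\<omega> 0) \<in> U"
  proof (subst AE_Q)
    show "AE x in \<mu>. AE \<omega> in Qfib x. tgt G (\<omega> 0) \<in> U"
      using AE_mu_U
    proof eventually_elim
      case (elim x)
      show ?case using AE_Qfib_fibre[OF elim] by eventually_elim (use elim in auto)
    qed
  qed measurable
  have "AE \<omega> in Q. (tgt G (\<omega> 0) \<in> U \<and> tgt G (\<omega> 0) = proj X (bnd \<omega>)) \<and> bnd \<omega> \<in> Y0"
    using t0 AE_proj_bnd AE_bnd_Y0 by eventually_elim auto
  then have "AE x in \<mu>. AE \<omega> in Qfib x. (tgt G (\<omega> 0) \<in> U \<and> tgt G (\<omega> 0) = proj X (bnd \<omega>)) \<and> bnd \<omega> \<in> Y0"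
    by (subst (asm) AE_Q) measurable
  then show ?thesis using AE_mu_U
  proof eventually_elim
    case (elim x)
    show ?case using elim(1) AE_Qfib_fibre[OF elim(2)] by eventually_elim auto
  qed
qed

text \<open>Equivariance of \<open>bnd\<close>, with the quantifiers over path and arrow exchanged.  The additional
  conclusion that the translated boundary point lies in \<open>Y0\<close> makes the equation measurable.\<close>

lemma AE_bnd_translate:
  "AE \<omega> in Q. AE g in \<kappa> (tgt G (\<omega> 0)). bnd (\<tau> (ginv G g) \<omega>) \<in> Y0 \<and> bnd (\<tau> (ginv G g) \<omega>) = tact (ginv G g) (bnd \<omega>)"
proof (subst AE_swap)
  show "Measurable.pred (arrs G \<Otimes>\<^sub>M PS) (\<lambda>p. bnd (\<tau> (ginv G (fst p)) (snd p)) \<in> Y0 \<and>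
      bnd (\<tau> (ginv G (fst p)) (snd p)) = tact (ginv G (fst p)) (bnd (snd p)))"
    by measurable
  define R where "R g \<omega> \<longleftrightarrow> bnd (\<tau> g \<omega>) \<in> Y0 \<and> bnd (\<tau> g \<omega>) = tact g (bnd \<omega>)" for g \<omega>
  have R: "Measurable.pred (arrs G \<Otimes>\<^sub>M PS) (\<lambda>p. R (fst p) (snd p))" unfolding R_def by measurable
  define S where "S g \<longleftrightarrow> (AE \<omega> in Qfib (src G g). R g \<omega>)" for g
  have S: "Measurable.pred (arrs G) S"
    unfolding S_def by (rule pred_AE_kernel[OF measurable_compose[OF measurable_src Qfib_sub] R])
  have "AE x in \<mu>. AE g in \<kappa> x. S g"
  proof (rule AE_kappa_arrow)
    show "AE x in \<mu>. AE g in \<kappa> x. g \<in> space (arrs G) \<and> tgt G g = x \<and> x \<in> U \<and> src G g \<in> U \<longrightarrow> S g"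
      using AE_equivariant base_AE_src[OF AE_Qfib_bnd_proj] base_AE_tgt[OF AE_Qfib_bnd_proj]
    proof eventually_elim
      case (elim x)
      then show ?case
      proof eventually_elim
        case (elim g)
        show ?case
        proof safe
          assume g: "g \<in> space (arrs G)" "tgt G g \<in> U" "x = tgt G g" "src G g \<in> U"
          have "AE \<omega> in Qfib (tgt G g). bnd \<omega> \<in> Y0" using elim(3) by eventually_elim auto
          then have "AE \<omega> in Qfib (src G g). bnd (\<tau> g \<omega>) \<in> Y0"
            by (subst AE_Qfib_translate[OF g(1,4,2)]) measurable
          then have "AE \<omega> in Qfib (src G g). R g \<omega>"
            using elim(1,2) AE_Qfib_fibre[OF g(4)]
          proof eventually_elim
            case (elim \<omega>)
            have "\<tau> g \<omega> = (\<lambda>n. gmult G g (\<omega> n))" using elim(4) g by (auto simp: \<tau>_def tmult_def)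
            then show ?case using elim g by (auto simp: R_def tact_def)
          qed
          then show "S g" by (simp add: S_def)
        qed
      qed
    qed
  qed
  from quasi_pred[OF S this]
  have "AE x in \<mu>. AE g in \<kappa> x. g \<in> space (arrs G) \<and> tgt G g = x \<and> x \<in> U \<and> src G g \<in> U \<longrightarrow> (AE \<omega> in Qfib x. bnd (\<tau> (ginv G g) \<omega>) \<in> Y0 \<and> bnd (\<tau> (ginv G g) \<omega>) = tact (ginv G g) (bnd \<omega>))"
  proof eventually_elim
    case (elim x)
    then show ?case
    proof eventually_elim
      case (elim g)
      show ?case
      proof (intro impI, elim conjE)
        assume g: "g \<in> space (arrs G)" "tgt G g = x"
        show "AE \<omega> in Qfib x. bnd (\<tau> (ginv G g) \<omega>) \<in> Y0 \<and> bnd (\<tau> (ginv G g) \<omega>) = tact (ginv G g) (bnd \<omega>)"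
          using elim unfolding S_def R_def src_inv[OF g(1)] g(2) .
      qed
    qed
  qed
  then show "AE x in \<mu>. AE g in \<kappa> x. AE \<omega> in Qfib x. bnd (\<tau> (ginv G g) \<omega>) \<in> Y0 \<and> bnd (\<tau> (ginv G g) \<omega>) = tact (ginv G g) (bnd \<omega>)"
    by (rule AE_kappa_arrow)
qed

end

section \<open>The weak-star mean\<close>

text \<open>Weak-star limits may be tested against any absolutely continuous finite measure, its density
  being an \<open>L\<^sup>1\<close> function.\<close>

lemma (in finite_measure) weak_star_limit_ac:
  fixes \<phi> :: "nat \<Rightarrow> 'a \<Rightarrow> real"
  assumes lim: "\<And>u. integrable M u \<Longrightarrow> L (\<lambda>n. \<integral>x. u x * \<phi> n x \<partial>M) = (\<integral>x. u x * \<psi> x \<partial>M)"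
    and m[measurable]: "\<And>n. \<phi> n \<in> borel_measurable M" "\<psi> \<in> borel_measurable M"
    and N: "finite_measure N" "sets N = sets M" "absolutely_continuous M N"
  shows "L (\<lambda>n. \<integral>x. \<phi> n x \<partial>N) = (\<integral>x. \<psi> x \<partial>N)"
proof -
  obtain f where f[measurable]: "f \<in> borel_measurable M" and fN: "density M f = N"
    using Radon_Nikodym[OF N(3,2)] by auto
  have "(\<integral>\<^sup>+x. f x \<partial>M) = emeasure N (space N)"
    unfolding fN[symmetric] by (subst emeasure_density) (auto intro!: nn_integral_cong)
  then have fin: "(\<integral>\<^sup>+x. f x \<partial>M) < \<infinity>"
    using finite_measure.emeasure_finite[OF N(1)] by (simp add: less_top)
  then have "AE x in M. f x \<noteq> \<infinity>"
    by (intro nn_integral_PInf_AE) auto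
  then have fg: "AE x in M. f x = ennreal (enn2real (f x))"
    by eventually_elim (simp add: less_top)
  have N': "N = density M (\<lambda>x. ennreal (enn2real (f x)))"
    unfolding fN[symmetric] by (rule density_cong) (use fg in auto)
  have i: "integrable M (\<lambda>x. enn2real (f x))"
    using fin by (intro integrableI_nonneg) (auto simp: nn_integral_cong_AE[OF fg, symmetric])
  have "(\<integral>x. h x \<partial>N) = (\<integral>x. enn2real (f x) * h x \<partial>M)" if "h \<in> borel_measurable M" for h :: "'a \<Rightarrow> real"
    unfolding N' using that by (subst integral_density) auto
  then show ?thesis using lim[OF i] m by simp
qed

lemma integral_measurable_kernel:
  fixes f :: "'a \<Rightarrow> 'b \<Rightarrow> real"
  assumes f[measurable]: "(\<lambda>p. f (fst p) (snd p)) \<in> borel_measurable (M \<Otimes>\<^sub>M N)"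
    and K[measurable]: "K \<in> measurable M (subprob_algebra N)"
  shows "(\<lambda>x. \<integral>y. f x y \<partial>K x) \<in> borel_measurable M"
proof -
  have "(\<lambda>x. distr (K x) (M \<Otimes>\<^sub>M N) (\<lambda>y. (x, y))) \<in> measurable M (subprob_algebra (M \<Otimes>\<^sub>M N))"
    by (rule measurable_distr2[OF _ K]) measurable
  from measurable_compose[OF this integral_measurable_subprob_algebra[OF f]]
  have "(\<lambda>x. \<integral>p. f (fst p) (snd p) \<partial>distr (K x) (M \<Otimes>\<^sub>M N) (\<lambda>y. (x, y))) \<in> borel_measurable M" .
  then show ?thesis
  proof (rule measurable_cong[THEN iffD1, rotated])
    fix x assume x: "x \<in> space M"
    then have "(\<lambda>y. (x, y)) \<in> measurable (K x) (M \<Otimes>\<^sub>M N)"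
      unfolding measurable_cong_sets[OF subprob_measurableD(2)[OF K x] refl] by measurable
    then show "(\<integral>p. f (fst p) (snd p) \<partial>distr (K x) (M \<Otimes>\<^sub>M N) (\<lambda>y. (x, y))) = (\<integral>y. f x y \<partial>K x)"
      by (subst integral_distr) auto
  qed
qed

lemma (in subprob_space) abs_integral_le:
  fixes f :: "'a \<Rightarrow> real"
  assumes "\<And>x. x \<in> space M \<Longrightarrow> \<bar>f x\<bar> \<le> C" shows "\<bar>\<integral>x. f x \<partial>M\<bar> \<le> C"
proof -
  obtain x where "x \<in> space M" using subprob_not_empty by auto
  then have C: "0 \<le> C" using assms[of x] abs_ge_zero[of "f x"] by linarith
  show ?thesis
  proof (cases "integrable M f")
    case True
    have "\<bar>\<integral>x. f x \<partial>M\<bar> \<le> (\<integral>x. \<bar>f x\<bar> \<partial>M)" by (rule integral_abs_bound)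
    also have "\<dots> \<le> (\<integral>x. C \<partial>M)" using True assms by (intro integral_mono) auto
    also have "\<dots> = C * measure M (space M)" by simp
    also have "\<dots> \<le> C * 1" using C by (intro mult_left_mono subprob_measure_le_1)
    finally show ?thesis by simp
  qed (use C in \<open>simp add: not_integrable_integral_eq\<close>)
qed

lemma Fubini_bounded:
  fixes f :: "'a \<Rightarrow> 'b \<Rightarrow> real"
  assumes M: "finite_measure M" and N: "finite_measure N"
    and f: "(\<lambda>p. f (fst p) (snd p)) \<in> borel_measurable (M \<Otimes>\<^sub>M N)" and b: "\<And>x y. \<bar>f x y\<bar> \<le> C"
  shows "(\<integral>x. (\<integral>y. f x y \<partial>N) \<partial>M) = (\<integral>y. (\<integral>x. f x y \<partial>M) \<partial>N)"
proof -
  interpret M: finite_measure M by fact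
  interpret N: finite_measure N by fact
  interpret pair_sigma_finite M N ..
  interpret MN: finite_measure "M \<Otimes>\<^sub>M N" by (rule finite_measure_pair_measure[OF N M])
  have "integrable (M \<Otimes>\<^sub>M N) (case_prod f)"
    using f b by (intro MN.integrable_const_bound[where B=C]) (auto simp: split_beta')
  from Fubini_integral[OF this] show ?thesis by simp
qed

definition clip :: "real \<Rightarrow> real \<Rightarrow> real" where "clip C t = max (- C) (min C t)"

lemma clip_bound: "0 \<le> C \<Longrightarrow> \<bar>clip C t\<bar> \<le> C" by (auto simp: clip_def)
lemma clip_id: "\<bar>t\<bar> \<le> C \<Longrightarrow> clip C t = t" by (auto simp: clip_def)
lemma measurable_clip[measurable]: "clip C \<in> borel_measurable borel" by (simp add: clip_def[abs_def])

locale mean_chain = boundary_chain G U \<kappa> \<mu> \<pi> X bnd Y0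
  for G :: "('o, 'g) groupoid" and U \<kappa> \<mu> \<pi> and X :: "('o, 'g, 'y) gspace" and bnd Y0 +
  fixes L :: "(nat \<Rightarrow> real) \<Rightarrow> real"
  assumes L: "banach_limit L"
    and bnd_shift: "AE \<omega> in Q. bnd (time_shift \<omega>) = bnd \<omega>"
    and bnd_max: "\<And>f :: _ \<Rightarrow> real. f \<in> borel_measurable PS \<Longrightarrow> AE \<omega> in Q. f (time_shift \<omega>) = f \<omega> \<Longrightarrow>
      \<exists>\<Psi>\<in>borel_measurable (pts X). AE \<omega> in Q. f \<omega> = \<Psi> (bnd \<omega>)"
begin

abbreviation jmeas :: "('y \<Rightarrow> 'g \<Rightarrow> real) \<Rightarrow> bool" where
  "jmeas F \<equiv> (\<lambda>p. F (fst p) (snd p)) \<in> borel_measurable (pts X \<Otimes>\<^sub>M arrs G)"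

lemma jmeas_measurable:
  assumes "jmeas F" "f \<in> measurable N (pts X)" "g \<in> measurable N (arrs G)"
  shows "(\<lambda>x. F (f x) (g x)) \<in> borel_measurable N"
  using measurable_compose[OF measurable_Pair[OF assms(2,3)] assms(1)] by simp

text \<open>The functions \<open>\<phi>\<^sub>n\<close> of the introduction.\<close>

definition avg :: "('y \<Rightarrow> 'g \<Rightarrow> real) \<Rightarrow> nat \<Rightarrow> (nat \<Rightarrow> 'g) \<Rightarrow> real" where
  "avg F n \<omega> = (\<integral>k. F (bnd \<omega>) (tmult (\<omega> n) k) \<partial>\<kappa> (src G (\<omega> n)))"

lemma avg_measurable: 
  assumes F: "jmeas F" shows "avg F n \<in> borel_measurable PS"
proof -
  have 1: "(\<lambda>x. bnd (fst x)) \<in> measurable (PS \<Otimes>\<^sub>M arrs G) (pts X)" "(\<lambda>x. tmult (fst x n) (snd x)) \<in> measurable (PS \<Otimes>\<^sub>M arrs G) (arrs G)"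
    and 2: "(\<lambda>x. src G (x n)) \<in> measurable PS (objs G)"
    by measurable
  show ?thesis
    unfolding avg_def[abs_def]
    by (rule integral_measurable_kernel[OF jmeas_measurable[OF F 1] measurable_compose[OF 2 kappa_sub]])
qed

lemma path_in: "\<omega> \<in> space PS \<Longrightarrow> \<omega> n \<in> space (arrs G)"
  by (auto simp: space_PiM)

lemma avg_bound:
  assumes F: "\<And>y k. \<bar>F y k\<bar> \<le> C" and \<omega>: "\<omega> \<in> space PS"
  shows "\<bar>avg F n \<omega>\<bar> \<le> C"
proof -
  interpret prob_space "\<kappa> (src G (\<omega> n))" by (intro kappa_prob src_in path_in \<omega>)
  show ?thesis unfolding avg_def by (rule abs_integral_le) (rule F)
qed

lemma AE_good_path: "AE \<omega> in Q. \<omega> \<in> space PS \<and> tgt G (\<omega> 0) \<in> U \<and> (\<forall>n. tgt G (\<omega> n) = tgt G (\<omega> 0) \<and> src G (\<omega> n) \<in> U)"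
proof -
  have s: "AE \<omega> in Q. src G (\<omega> n) \<in> U" for n
  proof (induction n)
    case 0
    show ?case
    proof (subst AE_Q)
      show "AE x in \<mu>. AE \<omega> in Qfib x. src G (\<omega> 0) \<in> U"
        using base_AE_src[OF AE_mu_U] AE_space
      proof eventually_elim
        case (elim x)
        then have x: "x \<in> space (objs G)" by (simp add: space_mu)
        have "AE k in \<kappa> x. AE \<omega> in PL k. src G (\<omega> 0) \<in> U"
          using elim(1) AE_space
        proof eventually_elim
          case (elim k)
          then have k: "k \<in> space (arrs G)" using x by (simp add: kappa_space)
          show ?case by (subst AE_path_law_start[OF k, where P="\<lambda>k. src G k \<in> U"]) (measurable, fact)
        qed
        then show ?case by (subst AE_Qfib[OF x]) measurable
      qed
    qed measurable
  next
    case (Suc n)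
    have "AE \<omega> in Q. src G (time_shift \<omega> n) \<in> U"
      by (rule AE_time_shift[OF _ Suc]) measurable
    then show ?case by (simp add: time_shift_def)
  qed
  have "AE \<omega> in Q. \<forall>n. tgt G (\<omega> 0) \<in> U \<and> tgt G (\<omega> 0) = tgt G (\<omega> n)"
  proof (subst AE_Q)
    show "AE x in \<mu>. AE \<omega> in Qfib x. \<forall>n. tgt G (\<omega> 0) \<in> U \<and> tgt G (\<omega> 0) = tgt G (\<omega> n)"
      using AE_mu_U
    proof eventually_elim
      case (elim x)
      show ?case using AE_Qfib_fibre[OF elim] by eventually_elim (use elim in auto)
    qed
  qed measurable
  moreover have "AE \<omega> in Q. \<forall>n. src G (\<omega> n) \<in> U" using s by (simp add: AE_all_countable)
  ultimately show ?thesis using AE_space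
  proof eventually_elim
    case (elim \<omega>)
    then show ?case unfolding Q_space by metis
  qed
qed

text \<open>The law of \<open>\<omega>\<^sub>n k\<close> is equivalent to \<open>\<kappa>\<close> over the target of the path, for whatever \<open>\<omega>\<^sub>n\<close>; this is
  why the averages \<open>avg F n\<close> depend on \<open>F\<close> only almost everywhere.\<close>

lemma AE_along_path:
  assumes P: "Measurable.pred (PS \<Otimes>\<^sub>M arrs G) (\<lambda>p. P (fst p) (snd p))"
    and ae: "AE \<omega> in Q. AE k in \<kappa> (tgt G (\<omega> 0)). P \<omega> k"
  shows "AE \<omega> in Q. \<forall>n. AE k in \<kappa> (src G (\<omega> n)). P \<omega> (tmult (\<omega> n) k)"
  using ae AE_good_path
proof eventually_elim
  case (elim \<omega>)
  then have \<omega>: "\<omega> \<in> space PS" "tgt G (\<omega> 0) \<in> U" by auto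
  have Pm: "Measurable.pred (arrs G) (P \<omega>)"
    using measurable_compose[OF measurable_Pair1'[OF \<omega>(1)] P] by simp
  let ?A = "{k\<in>space (arrs G). \<not> P \<omega> k}"
  have A: "?A \<in> sets (arrs G)" using Pm by measurable
  show ?case
  proof
    fix n
    have n: "\<omega> n \<in> space (arrs G)" "src G (\<omega> n) \<in> U" "tgt G (\<omega> n) \<in> U" "tgt G (\<omega> n) = tgt G (\<omega> 0)"
      using elim(2) path_in[of \<omega> n] by metis+
    have "AE k in \<kappa> (tgt G (\<omega> n)). k \<notin> ?A"
      using elim(1) unfolding n(4) by eventually_elim auto
    then have "AE k in \<kappa> (src G (\<omega> n)). tmult (\<omega> n) k \<notin> ?A"
      by (subst kappa_translate[OF n(1,2,3) A])
    then show "AE k in \<kappa> (src G (\<omega> n)). P \<omega> (tmult (\<omega> n) k)"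
      using AE_space
    proof eventually_elim
      case (elim k)
      then show ?case using n(1) tmult_in[of "\<omega> n" k] U_objs[OF n(2)] by (simp add: kappa_space)
    qed
  qed
qed

lemma measurable_tmult_kernel: 
  assumes "jmeas F" "\<omega> \<in> space PS" shows "(\<lambda>k. F (bnd \<omega>) (tmult (\<omega> n) k)) \<in> borel_measurable (\<kappa> (src G (\<omega> n)))"
proof -
  have \<omega>n: "\<omega> n \<in> space (arrs G)" "bnd \<omega> \<in> space (pts X)" using assms path_in measurable_space[OF bnd] by auto
  have "(\<lambda>_. \<omega> n) \<in> measurable (arrs G) (arrs G)" "(\<lambda>_. bnd \<omega>) \<in> measurable (arrs G) (pts X)" using \<omega>n by auto
  then have "(\<lambda>k. F (bnd \<omega>) (tmult (\<omega> n) k)) \<in> borel_measurable (arrs G)"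
    by (intro jmeas_measurable[OF assms(1)] measurable_tmult) auto
  then show ?thesis using src_in[OF \<omega>n(1)] by (simp add: measurable_cong_sets[OF kappa_sets refl])
qed

lemma avg_cong:
  assumes F: "jmeas F" "jmeas F'" and ae: "AE \<omega> in Q. AE k in \<kappa> (tgt G (\<omega> 0)). F (bnd \<omega>) k = F' (bnd \<omega>) k"
  shows "AE \<omega> in Q. \<forall>n. avg F n \<omega> = avg F' n \<omega>"
proof -
  have b: "(\<lambda>x. bnd (fst x)) \<in> measurable (PS \<Otimes>\<^sub>M arrs G) (pts X)" by measurable
  have m: "(\<lambda>p. F (bnd (fst p)) (snd p)) \<in> borel_measurable (PS \<Otimes>\<^sub>M arrs G)"
    "(\<lambda>p. F' (bnd (fst p)) (snd p)) \<in> borel_measurable (PS \<Otimes>\<^sub>M arrs G)"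
    using jmeas_measurable[OF F(1) b measurable_snd] jmeas_measurable[OF F(2) b measurable_snd] by auto
  have "AE \<omega> in Q. \<forall>n. AE k in \<kappa> (src G (\<omega> n)). F (bnd \<omega>) (tmult (\<omega> n) k) = F' (bnd \<omega>) (tmult (\<omega> n) k)"
    by (rule AE_along_path[OF _ ae]) (simp only: pred_def borel_measurable_eq[OF m])
  then show ?thesis using AE_space
    by eventually_elim (auto simp: avg_def Q_space intro!: integral_cong_AE measurable_tmult_kernel F)
qed

definition ess_bdd :: "('y \<Rightarrow> 'g \<Rightarrow> real) \<Rightarrow> real \<Rightarrow> bool" where
  "ess_bdd F C \<longleftrightarrow> 0 \<le> C \<and> (AE \<omega> in Q. AE k in \<kappa> (tgt G (\<omega> 0)). \<bar>F (bnd \<omega>) k\<bar> \<le> C)"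

lemma jmeas_clip: "jmeas F \<Longrightarrow> jmeas (\<lambda>y k. clip C (F y k))" by measurable

lemma avg_clip:
  assumes "jmeas F" "ess_bdd F C"
  shows "AE \<omega> in Q. \<forall>n. avg F n \<omega> = avg (\<lambda>y k. clip C (F y k)) n \<omega>"
proof (rule avg_cong[OF assms(1) jmeas_clip[OF assms(1)]])
  show "AE \<omega> in Q. AE k in \<kappa> (tgt G (\<omega> 0)). F (bnd \<omega>) k = clip C (F (bnd \<omega>) k)"
    using assms(2) unfolding ess_bdd_def by (auto elim!: eventually_mono simp: clip_id)
qed

lemma avg_ebound:
  assumes "jmeas F" "ess_bdd F C" shows "AE \<omega> in Q. \<bar>avg F n \<omega>\<bar> \<le> C"
  using avg_clip[OF assms] AE_space
proof eventually_elim
  case (elim \<omega>)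
  then show ?case using avg_bound[of "\<lambda>y k. clip C (F y k)" C \<omega> n] assms(2) by (simp add: ess_bdd_def clip_bound Q_space)
qed

text \<open>\<open>\<Phi>\<close> represents the Banach limit of the averages of \<open>F\<close>.  Boundedness is demanded everywhere because
  \<open>\<Phi>\<close> will be integrated against measures for which nothing is known about null sets in advance.\<close>

definition mean_lim :: "('y \<Rightarrow> 'g \<Rightarrow> real) \<Rightarrow> ('y \<Rightarrow> real) \<Rightarrow> bool" where
  "mean_lim F \<Phi> \<longleftrightarrow> \<Phi> \<in> borel_measurable (pts X) \<and> (\<exists>C. \<forall>y. \<bar>\<Phi> y\<bar> \<le> C) \<and>
    (\<forall>u. integrable Q u \<longrightarrow> L (\<lambda>n. \<integral>\<omega>. u \<omega> * avg F n \<omega> \<partial>Q) = (\<integral>\<omega>. u \<omega> * \<Phi> (bnd \<omega>) \<partial>Q))"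

lemma avg_Q: "jmeas F \<Longrightarrow> avg F n \<in> borel_measurable Q"
  using avg_measurable by (simp add: measurable_cong_sets[OF Q_sets refl])

lemma mean_lim_cong:
  assumes F: "jmeas F" "jmeas F'" and ae: "AE \<omega> in Q. AE k in \<kappa> (tgt G (\<omega> 0)). F (bnd \<omega>) k = F' (bnd \<omega>) k"
  shows "mean_lim F \<Phi> \<longleftrightarrow> mean_lim F' \<Phi>"
proof -
  have "(\<integral>\<omega>. u \<omega> * avg F n \<omega> \<partial>Q) = (\<integral>\<omega>. u \<omega> * avg F' n \<omega> \<partial>Q)" if "integrable Q u" for u n
    using avg_cong[OF F ae] that
    by (intro integral_cong_AE borel_measurable_times avg_Q F) (auto elim: eventually_mono)
  then show ?thesis by (simp add: mean_lim_def)
qed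

lemma mean_lim_clip: "jmeas F \<Longrightarrow> ess_bdd F C \<Longrightarrow> mean_lim F \<Phi> \<longleftrightarrow> mean_lim (\<lambda>y k. clip C (F y k)) \<Phi>"
  by (rule mean_lim_cong[OF _ jmeas_clip]) (auto simp: ess_bdd_def clip_id elim!: eventually_mono)

text \<open>The operator \<open>\<phi> \<mapsto> \<integral> \<phi> dK\<^sub>\<omega>\<close> on \<open>L\<^sup>\<infinity>\<close> is weak-star continuous for every nonsingular kernel
  \<open>K\<close>: its preadjoint sends the indicator of \<open>A\<close> to the image of \<open>Q\<close> restricted to \<open>A\<close> under \<open>K\<close>.  It is used with the
  shift and with random translations.\<close>

lemma weak_limit_pushforward:
  fixes \<phi> :: "nat \<Rightarrow> (nat \<Rightarrow> 'g) \<Rightarrow> real"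
  assumes lim: "\<And>u. integrable Q u \<Longrightarrow> L (\<lambda>n. \<integral>\<omega>. u \<omega> * \<phi> n \<omega> \<partial>Q) = (\<integral>\<omega>. u \<omega> * \<psi> \<omega> \<partial>Q)"
    and m[measurable]: "\<And>n. \<phi> n \<in> borel_measurable PS" "\<psi> \<in> borel_measurable PS"
    and b: "\<And>n \<omega>. \<omega> \<in> space PS \<Longrightarrow> \<bar>\<phi> n \<omega>\<bar> \<le> C" "\<And>\<omega>. \<omega> \<in> space PS \<Longrightarrow> \<bar>\<psi> \<omega>\<bar> \<le> C"
    and K[measurable]: "K \<in> measurable PS (subprob_algebra PS)"
    and ac: "\<And>P. Measurable.pred PS P \<Longrightarrow> AE \<omega> in Q. P \<omega> \<Longrightarrow> AE \<omega> in Q. AE \<omega>' in K \<omega>. P \<omega>'"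
    and A: "A \<in> sets PS"
  shows "L (\<lambda>n. \<integral>\<omega>. indicator A \<omega> * (\<integral>\<omega>'. \<phi> n \<omega>' \<partial>K \<omega>) \<partial>Q) = (\<integral>\<omega>. indicator A \<omega> * (\<integral>\<omega>'. \<psi> \<omega>' \<partial>K \<omega>) \<partial>Q)"
proof -
  note A' = A[folded Q_sets]
  let ?N = "density Q (\<lambda>\<omega>. ennreal (indicator A \<omega>))"
  let ?B = "?N \<bind> K"
  have sN: "sets ?N = sets PS" using Q_sets by simp
  have spN: "space ?N = space PS" using sN by (rule sets_eq_imp_space_eq)
  have ne: "space ?N \<noteq> {}"
  proof -
    obtain x where "x \<in> space (objs G)" using nonempty by auto
    then have "unit_at G x \<in> space (arrs G)" by (rule unit_in)
    then have "(\<lambda>_. unit_at G x) \<in> space PS" by (auto simp: space_PiM)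
    then show ?thesis unfolding spN by blast
  qed
  have KN: "K \<in> measurable ?N (subprob_algebra PS)"
    using K by (simp add: measurable_cong_sets[OF sN refl])
  have fN: "finite_measure ?N"
  proof (rule finite_measureI)
    have "emeasure ?N (space ?N) = emeasure Q A"
      using A' sets.sets_into_space[OF A'] by (subst emeasure_density) (auto simp: indicator_inter_arith[symmetric] Int_absorb2 Int_absorb1 ennreal_indicator)
    then show "emeasure ?N (space ?N) \<noteq> \<infinity>" by (simp add: Q.emeasure_finite)
  qed
  have sub: "AE \<omega> in ?N. emeasure (K \<omega>) (space (K \<omega>)) \<le> ennreal 1"
    using subprob_space.emeasure_space_le_1[OF subprob_space_kernel[OF KN]] by (auto intro!: AE_I2)
  have sB: "sets ?B = sets Q"
    using subprob_measurableD(2)[OF KN] ne Q_sets by (subst sets_bind[of _ _ PS]) auto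
  have fB: "finite_measure ?B"
  proof (rule finite_measureI)
    have "emeasure ?B (space ?B) = (\<integral>\<^sup>+\<omega>. emeasure (K \<omega>) (space ?B) \<partial>?N)"
      by (rule emeasure_bind[OF ne KN]) (use sB Q_sets in auto)
    also have "\<dots> \<le> (\<integral>\<^sup>+\<omega>. 1 \<partial>?N)"
      using subprob_space.subprob_emeasure_le_1[OF subprob_space_kernel[OF KN]] by (intro nn_integral_mono) auto
    also have "\<dots> < \<infinity>" using finite_measure.emeasure_finite[OF fN] by (simp add: less_top)
    finally show "emeasure ?B (space ?B) \<noteq> \<infinity>" by simp
  qed
  have acB: "absolutely_continuous Q ?B"
    unfolding absolutely_continuous_def
  proof
    fix S assume S: "S \<in> null_sets Q"
    then have [measurable]: "S \<in> sets PS" using Q_sets by auto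
    have "AE \<omega> in Q. AE \<omega>' in K \<omega>. \<omega>' \<notin> S"
      by (rule ac[OF _ AE_not_in[OF S]]) measurable
    then have "AE \<omega> in ?N. AE \<omega>' in K \<omega>. \<omega>' \<notin> S"
      using A' by (subst AE_density) auto
    then have "AE \<omega> in ?B. \<omega> \<notin> S" by (subst AE_bind[OF KN]) measurable
    then show "S \<in> null_sets ?B" using S sB by (subst AE_iff_null_sets) auto
  qed
  have int: "(\<integral>\<omega>. f \<omega> \<partial>?B) = (\<integral>\<omega>. indicator A \<omega> * (\<integral>\<omega>'. f \<omega>' \<partial>K \<omega>) \<partial>Q)"
    if f: "f \<in> borel_measurable PS" "\<And>\<omega>. \<omega> \<in> space PS \<Longrightarrow> \<bar>f \<omega>\<bar> \<le> C" for f :: "_ \<Rightarrow> real"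
  proof -
    have "(\<lambda>\<omega>. \<integral>\<omega>'. f \<omega>' \<partial>K \<omega>) \<in> borel_measurable PS"
      using measurable_compose[OF K integral_measurable_subprob_algebra[OF f(1)]] .
    then have "(\<lambda>\<omega>. \<integral>\<omega>'. f \<omega>' \<partial>K \<omega>) \<in> borel_measurable Q"
      by (simp add: measurable_cong_sets[OF Q_sets refl])
    moreover have "(\<integral>\<omega>. f \<omega> \<partial>?B) = (\<integral>\<omega>. (\<integral>\<omega>'. f \<omega>' \<partial>K \<omega>) \<partial>?N)"
      by (rule integral_bind[OF f KN fN sub])
    ultimately show ?thesis using A' by (simp add: integral_density)
  qed
  have "L (\<lambda>n. \<integral>\<omega>. \<phi> n \<omega> \<partial>?B) = (\<integral>\<omega>. \<psi> \<omega> \<partial>?B)"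
    by (rule Q.weak_star_limit_ac[OF lim _ _ fB sB acB]) (simp_all add: measurable_cong_sets[OF Q_sets refl])
  then show ?thesis by (simp add: int m b)
qed

text \<open>The weak-star limit is shift invariant, by the shift invariance of \<open>L\<close> and the continuity above,
  and hence factors through the boundary.\<close>

lemma mean_lim_exists:
  assumes F: "jmeas F" "ess_bdd F C" shows "\<exists>\<Phi>. mean_lim F \<Phi>"
proof -
  let ?F = "\<lambda>y k. clip C (F y k)"
  have C: "0 \<le> C" using F(2) by (simp add: ess_bdd_def)
  note mf = jmeas_clip[OF F(1), of C]
  \<comment> \<open>averages of the truncated function are bounded on every path, not just on almost every one\<close>
  have bf: "\<bar>avg ?F n \<omega>\<bar> \<le> C" if "\<omega> \<in> space PS" for n \<omega>
    using that C by (intro avg_bound clip_bound)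
  have bAE: "AE \<omega> in Q. \<bar>avg ?F n \<omega>\<bar> \<le> C" for n using bf by (auto intro!: AE_I2 simp: Q_space)
  obtain \<psi> where \<psi>: "\<psi> \<in> borel_measurable Q" "AE \<omega> in Q. \<bar>\<psi> \<omega>\<bar> \<le> C"
    and lim0: "\<And>u. integrable Q u \<Longrightarrow> L (\<lambda>n. \<integral>\<omega>. u \<omega> * avg ?F n \<omega> \<partial>Q) = (\<integral>\<omega>. u \<omega> * \<psi> \<omega> \<partial>Q)"
    by (rule Q.weak_star_limit[OF L avg_Q[OF mf] bAE]) (rule that)
  define \<psi>' where "\<psi>' \<omega> = clip C (\<psi> \<omega>)" for \<omega>
  have \<psi>'[measurable]: "\<psi>' \<in> borel_measurable PS"
    using \<psi>(1) unfolding \<psi>'_def[abs_def] by (simp add: measurable_cong_sets[OF Q_sets refl])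
  have \<psi>'Q: "\<psi>' \<in> borel_measurable Q" using \<psi>' by (simp add: measurable_cong_sets[OF Q_sets refl])
  have b\<psi>': "\<bar>\<psi>' \<omega>\<bar> \<le> C" for \<omega> using C by (simp add: \<psi>'_def clip_bound)
  have e: "AE \<omega> in Q. \<psi> \<omega> = \<psi>' \<omega>" using \<psi>(2) by eventually_elim (simp add: \<psi>'_def clip_id)
  have lim: "L (\<lambda>n. \<integral>\<omega>. u \<omega> * avg ?F n \<omega> \<partial>Q) = (\<integral>\<omega>. u \<omega> * \<psi>' \<omega> \<partial>Q)" if "integrable Q u" for u
    unfolding lim0[OF that] using that e \<psi>(1) \<psi>'Q
    by (intro integral_cong_AE borel_measurable_times) (auto elim: eventually_mono)
  have T[measurable]: "(\<lambda>\<omega>. \<psi>' (time_shift \<omega>)) \<in> borel_measurable PS" by measurable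
  have TQ: "(\<lambda>\<omega>. \<psi>' (time_shift \<omega>)) \<in> borel_measurable Q" using T by (simp add: measurable_cong_sets[OF Q_sets refl])
  have "AE \<omega> in Q. \<psi>' (time_shift \<omega>) = \<psi>' \<omega>"
  proof (rule Q.AE_eq_of_set_integrals)
    show "integrable Q (\<lambda>\<omega>. \<psi>' (time_shift \<omega>))" "integrable Q \<psi>'"
      using b\<psi>' TQ \<psi>'Q by (auto intro!: Q.integrable_AE_bounded[where C=C])
    fix A assume A: "A \<in> sets Q"
    have A': "A \<in> sets PS" using A Q_sets by simp
    have iA: "integrable Q (indicator A :: _ \<Rightarrow> real)" using A by (auto simp: integrable_indicator_iff Q.emeasure_finite less_top[symmetric])
    let ?K = "\<lambda>\<omega>. return PS (time_shift \<omega>)"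
    have K: "?K \<in> measurable PS (subprob_algebra PS)"
      using measurable_compose[OF measurable_time_shift return_measurable] .
    have ret: "(\<integral>\<omega>'. f \<omega>' \<partial>?K \<omega>) = f (time_shift \<omega>)" if "\<omega> \<in> space Q" "f \<in> borel_measurable PS" for f :: "_ \<Rightarrow> real" and \<omega>
      using that measurable_space[OF measurable_time_shift, of \<omega>] by (intro integral_return) (auto simp: Q_space)
    have "L (\<lambda>n. \<integral>\<omega>. indicator A \<omega> * (\<integral>\<omega>'. avg ?F n \<omega>' \<partial>?K \<omega>) \<partial>Q) = (\<integral>\<omega>. indicator A \<omega> * (\<integral>\<omega>'. \<psi>' \<omega>' \<partial>?K \<omega>) \<partial>Q)"
    proof (rule weak_limit_pushforward[OF lim avg_measurable[OF mf] \<psi>' bf b\<psi>' K _ A'])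
      fix P assume P: "Measurable.pred PS P" "AE \<omega> in Q. P \<omega>"
      show "AE \<omega> in Q. AE \<omega>' in ?K \<omega>. P \<omega>'"
        using AE_time_shift[OF P] AE_space
      proof eventually_elim
        case (elim \<omega>)
        then show ?case using P(1) measurable_space[OF measurable_time_shift, of \<omega>]
          by (subst AE_return) (auto simp: Q_space)
      qed
    qed
    also have "(\<integral>\<omega>. indicator A \<omega> * (\<integral>\<omega>'. \<psi>' \<omega>' \<partial>?K \<omega>) \<partial>Q) = (\<integral>\<omega>. indicator A \<omega> * \<psi>' (time_shift \<omega>) \<partial>Q)"
      by (intro Bochner_Integration.integral_cong) (auto simp: ret)
    also have "(\<lambda>n. \<integral>\<omega>. indicator A \<omega> * (\<integral>\<omega>'. avg ?F n \<omega>' \<partial>?K \<omega>) \<partial>Q) = (\<lambda>n. \<integral>\<omega>. indicator A \<omega> * avg ?F (Suc n) \<omega> \<partial>Q)"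
    proof
      fix n
      have "(\<integral>\<omega>. indicator A \<omega> * (\<integral>\<omega>'. avg ?F n \<omega>' \<partial>?K \<omega>) \<partial>Q) = (\<integral>\<omega>. indicator A \<omega> * avg ?F n (time_shift \<omega>) \<partial>Q)"
        by (intro Bochner_Integration.integral_cong) (auto simp: ret avg_measurable[OF mf])
      also have "\<dots> = (\<integral>\<omega>. indicator A \<omega> * avg ?F (Suc n) \<omega> \<partial>Q)"
      proof (rule integral_cong_AE)
        have "(\<lambda>\<omega>. avg ?F n (time_shift \<omega>)) \<in> borel_measurable Q"
          using measurable_compose[OF measurable_time_shift avg_measurable[OF mf]] by (simp add: measurable_cong_sets[OF Q_sets refl])
        then show "(\<lambda>\<omega>. indicator A \<omega> * avg ?F n (time_shift \<omega>)) \<in> borel_measurable Q" using A by measurable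
        show "(\<lambda>\<omega>. indicator A \<omega> * avg ?F (Suc n) \<omega>) \<in> borel_measurable Q" using A avg_Q[OF mf, of "Suc n"] by measurable
        show "AE \<omega> in Q. indicator A \<omega> * avg ?F n (time_shift \<omega>) = indicator A \<omega> * avg ?F (Suc n) \<omega>"
          using bnd_shift by eventually_elim (simp add: avg_def time_shift_def)
      qed
      finally show "(\<integral>\<omega>. indicator A \<omega> * (\<integral>\<omega>'. avg ?F n \<omega>' \<partial>?K \<omega>) \<partial>Q) = (\<integral>\<omega>. indicator A \<omega> * avg ?F (Suc n) \<omega> \<partial>Q)" .
    qed
    also have "L (\<lambda>n. \<integral>\<omega>. indicator A \<omega> * avg ?F (Suc n) \<omega> \<partial>Q) = L (\<lambda>n. \<integral>\<omega>. indicator A \<omega> * avg ?F n \<omega> \<partial>Q)"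
    proof (rule banach_limit_Suc[OF L])
      show "Bseq (\<lambda>n. \<integral>\<omega>. indicator A \<omega> * avg ?F n \<omega> \<partial>Q)"
        by (rule BseqI') (unfold real_norm_def, rule Q.abs_integral_mult_bound(2)[OF iA avg_Q[OF mf] bAE])
    qed
    also have "\<dots> = (\<integral>\<omega>. indicator A \<omega> * \<psi>' \<omega> \<partial>Q)" by (rule lim[OF iA])
    finally show "(\<integral>\<omega>. indicator A \<omega> * \<psi>' (time_shift \<omega>) \<partial>Q) = (\<integral>\<omega>. indicator A \<omega> * \<psi>' \<omega> \<partial>Q)" by simp
  qed
  then obtain \<Psi> where \<Psi>[measurable]: "\<Psi> \<in> borel_measurable (pts X)" and \<Psi>e: "AE \<omega> in Q. \<psi>' \<omega> = \<Psi> (bnd \<omega>)"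
    using bnd_max[OF \<psi>'] by blast
  define \<Phi> where "\<Phi> y = clip C (\<Psi> y)" for y
  have m\<Phi>[measurable]: "\<Phi> \<in> borel_measurable (pts X)" unfolding \<Phi>_def[abs_def] by measurable
  have e2: "AE \<omega> in Q. \<psi>' \<omega> = \<Phi> (bnd \<omega>)"
    using \<Psi>e
  proof eventually_elim
    case (elim \<omega>)
    then show ?case using b\<psi>'[of \<omega>] by (simp add: \<Phi>_def clip_id)
  qed
  have m\<Phi>Q: "(\<lambda>\<omega>. \<Phi> (bnd \<omega>)) \<in> borel_measurable Q" unfolding measurable_cong_sets[OF Q_sets refl] by measurable
  have "mean_lim ?F \<Phi>"
    unfolding mean_lim_def
  proof (intro conjI allI impI exI)
    show "\<bar>\<Phi> y\<bar> \<le> C" for y using C by (simp add: \<Phi>_def clip_bound)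
    fix u :: "(nat \<Rightarrow> 'g) \<Rightarrow> real" assume u: "integrable Q u"
    show "L (\<lambda>n. \<integral>\<omega>. u \<omega> * avg ?F n \<omega> \<partial>Q) = (\<integral>\<omega>. u \<omega> * \<Phi> (bnd \<omega>) \<partial>Q)"
      unfolding lim[OF u] using u e2 m\<Phi>Q \<psi>'Q
      by (intro integral_cong_AE borel_measurable_times) (auto elim: eventually_mono)
  qed measurable
  then show ?thesis using mean_lim_clip[OF F] by blast
qed

lemma mean_limD:
  "mean_lim F \<Phi> \<Longrightarrow> integrable Q u \<Longrightarrow> L (\<lambda>n. \<integral>\<omega>. u \<omega> * avg F n \<omega> \<partial>Q) = (\<integral>\<omega>. u \<omega> * \<Phi> (bnd \<omega>) \<partial>Q)"
  by (simp add: mean_lim_def)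

lemma mean_lim_unique:
  assumes "mean_lim F \<Phi>" "mean_lim F \<Phi>'" shows "AE \<omega> in Q. \<Phi> (bnd \<omega>) = \<Phi>' (bnd \<omega>)"
proof -
  have i: "integrable Q (\<lambda>\<omega>. \<Phi> (bnd \<omega>))" if i: "mean_lim F \<Phi>" for \<Phi>
  proof -
    obtain C where "\<Phi> \<in> borel_measurable (pts X)" "\<And>y. \<bar>\<Phi> y\<bar> \<le> C" using i by (auto simp: mean_lim_def)
    then show ?thesis
      using measurable_compose[OF bnd, of \<Phi> borel] by (intro Q.integrable_AE_bounded[where C=C]) (auto simp: measurable_cong_sets[OF Q_sets refl])
  qed
  show ?thesis
  proof (rule Q.AE_eq_of_set_integrals[OF i[OF assms(1)] i[OF assms(2)]])
    fix A assume A: "A \<in> sets Q"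
    have iA: "integrable Q (indicator A :: _ \<Rightarrow> real)" using A by (auto simp: integrable_indicator_iff Q.emeasure_finite less_top[symmetric])
    show "(\<integral>\<omega>. indicator A \<omega> * \<Phi> (bnd \<omega>) \<partial>Q) = (\<integral>\<omega>. indicator A \<omega> * \<Phi>' (bnd \<omega>) \<partial>Q)"
      using mean_limD[OF assms(1) iA] mean_limD[OF assms(2) iA] by simp
  qed
qed

lemma Bseq_avg:
  assumes "jmeas F" "ess_bdd F C" "integrable Q u" shows "Bseq (\<lambda>n. \<integral>\<omega>. u \<omega> * avg F n \<omega> \<partial>Q)"
  by (rule BseqI') (unfold real_norm_def, rule Q.abs_integral_mult_bound(2)[OF assms(3) avg_Q[OF assms(1)] avg_ebound[OF assms(1,2)]])

lemma integrable_avg: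
  assumes "jmeas F" "ess_bdd F C" "integrable Q u" shows "integrable Q (\<lambda>\<omega>. u \<omega> * avg F n \<omega>)"
  by (rule Q.abs_integral_mult_bound(1)[OF assms(3) avg_Q[OF assms(1)] avg_ebound[OF assms(1,2)]])

lemma ess_bdd_clip': "ess_bdd F C \<Longrightarrow> ess_bdd (\<lambda>y k. clip C (F y k)) C"
  by (auto simp: ess_bdd_def clip_bound intro!: AE_I2)

lemma jmeas_lincomb: "jmeas F \<Longrightarrow> jmeas F' \<Longrightarrow> jmeas (\<lambda>y k. a * F y k + b * F' y k)"
  by (intro borel_measurable_add borel_measurable_times borel_measurable_const)

lemma mean_lim_lincomb:
  assumes F: "jmeas F" "ess_bdd F C" "jmeas F'" "ess_bdd F' C'" and l: "mean_lim F \<Phi>" "mean_lim F' \<Phi>'"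
  shows "mean_lim (\<lambda>y k. a * F y k + b * F' y k) (\<lambda>y. a * \<Phi> y + b * \<Phi>' y)"
proof -
  let ?F = "\<lambda>y k. clip C (F y k)" and ?F' = "\<lambda>y k. clip C' (F' y k)"
  have C: "0 \<le> C" "0 \<le> C'" using F by (auto simp: ess_bdd_def)
  have mf: "jmeas ?F" "jmeas ?F'" using F by (auto intro: jmeas_clip)
  have eb: "ess_bdd ?F C" "ess_bdd ?F' C'" using F by (auto intro: ess_bdd_clip')
  have l': "mean_lim ?F \<Phi>" "mean_lim ?F' \<Phi>'" using l mean_lim_clip F by blast+
  have lin: "avg (\<lambda>y k. a * ?F y k + b * ?F' y k) n \<omega> = a * avg ?F n \<omega> + b * avg ?F' n \<omega>" if \<omega>: "\<omega> \<in> space PS" for n \<omega>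
  proof -
    interpret K: prob_space "\<kappa> (src G (\<omega> n))" by (intro kappa_prob src_in path_in \<omega>)
    have "integrable (\<kappa> (src G (\<omega> n))) (\<lambda>k. ?F (bnd \<omega>) (tmult (\<omega> n) k))"
      using measurable_tmult_kernel[OF mf(1) \<omega>, of n] C by (intro K.integrable_const_bound[where B=C]) (auto simp: clip_bound)
    moreover have "integrable (\<kappa> (src G (\<omega> n))) (\<lambda>k. ?F' (bnd \<omega>) (tmult (\<omega> n) k))"
      using measurable_tmult_kernel[OF mf(2) \<omega>, of n] C by (intro K.integrable_const_bound[where B=C']) (auto simp: clip_bound)
    ultimately show ?thesis unfolding avg_def by simp
  qed
  have "mean_lim (\<lambda>y k. a * ?F y k + b * ?F' y k) (\<lambda>y. a * \<Phi> y + b * \<Phi>' y)"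
    unfolding mean_lim_def
  proof (intro conjI allI impI)
    show "(\<lambda>y. a * \<Phi> y + b * \<Phi>' y) \<in> borel_measurable (pts X)"
      using l by (auto simp: mean_lim_def)
    obtain D D' where D: "\<And>y. \<bar>\<Phi> y\<bar> \<le> D" "\<And>y. \<bar>\<Phi>' y\<bar> \<le> D'" using l by (auto simp: mean_lim_def)
    have "\<bar>a * \<Phi> y + b * \<Phi>' y\<bar> \<le> \<bar>a\<bar> * D + \<bar>b\<bar> * D'" for y
      by (rule order_trans[OF abs_triangle_ineq]) (auto simp: abs_mult intro!: add_mono mult_left_mono D)
    then show "\<exists>C. \<forall>y. \<bar>a * \<Phi> y + b * \<Phi>' y\<bar> \<le> C" by blast
    fix u :: "(nat \<Rightarrow> 'g) \<Rightarrow> real" assume u: "integrable Q u"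
    have iQ: "integrable Q (\<lambda>\<omega>. u \<omega> * \<Phi> (bnd \<omega>))" "integrable Q (\<lambda>\<omega>. u \<omega> * \<Phi>' (bnd \<omega>))"
      using l D measurable_compose[OF bnd, of _ borel]
      by (auto intro!: Q.abs_integral_mult_bound(1)[OF u] simp: mean_lim_def measurable_cong_sets[OF Q_sets refl])
    have "(\<integral>\<omega>. u \<omega> * avg (\<lambda>y k. a * ?F y k + b * ?F' y k) n \<omega> \<partial>Q) = a * (\<integral>\<omega>. u \<omega> * avg ?F n \<omega> \<partial>Q) + b * (\<integral>\<omega>. u \<omega> * avg ?F' n \<omega> \<partial>Q)" for n
    proof -
      have "(\<integral>\<omega>. u \<omega> * avg (\<lambda>y k. a * ?F y k + b * ?F' y k) n \<omega> \<partial>Q) = (\<integral>\<omega>. a * (u \<omega> * avg ?F n \<omega>) + b * (u \<omega> * avg ?F' n \<omega>) \<partial>Q)"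
        by (intro Bochner_Integration.integral_cong) (auto simp: lin Q_space algebra_simps)
      also have "\<dots> = a * (\<integral>\<omega>. u \<omega> * avg ?F n \<omega> \<partial>Q) + b * (\<integral>\<omega>. u \<omega> * avg ?F' n \<omega> \<partial>Q)"
        using integrable_avg[OF mf(1) eb(1) u, of n] integrable_avg[OF mf(2) eb(2) u, of n] by simp
      finally show ?thesis .
    qed
    then have "L (\<lambda>n. \<integral>\<omega>. u \<omega> * avg (\<lambda>y k. a * ?F y k + b * ?F' y k) n \<omega> \<partial>Q)
      = a * L (\<lambda>n. \<integral>\<omega>. u \<omega> * avg ?F n \<omega> \<partial>Q) + b * L (\<lambda>n. \<integral>\<omega>. u \<omega> * avg ?F' n \<omega> \<partial>Q)"
      using Bseq_avg[OF mf(1) eb(1) u] Bseq_avg[OF mf(2) eb(2) u] by (simp add: banach_limit_lincomb[OF L])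
    also have "\<dots> = a * (\<integral>\<omega>. u \<omega> * \<Phi> (bnd \<omega>) \<partial>Q) + b * (\<integral>\<omega>. u \<omega> * \<Phi>' (bnd \<omega>) \<partial>Q)"
      by (simp only: mean_limD[OF l'(1) u] mean_limD[OF l'(2) u])
    also have "\<dots> = (\<integral>\<omega>. a * (u \<omega> * \<Phi> (bnd \<omega>)) + b * (u \<omega> * \<Phi>' (bnd \<omega>)) \<partial>Q)"
      using iQ by simp
    also have "\<dots> = (\<integral>\<omega>. u \<omega> * (a * \<Phi> (bnd \<omega>) + b * \<Phi>' (bnd \<omega>)) \<partial>Q)"
      by (intro Bochner_Integration.integral_cong) (auto simp: algebra_simps)
    finally show "L (\<lambda>n. \<integral>\<omega>. u \<omega> * avg (\<lambda>y k. a * ?F y k + b * ?F' y k) n \<omega> \<partial>Q) = \<dots>" .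
  qed
  moreover have "mean_lim (\<lambda>y k. a * ?F y k + b * ?F' y k) \<Psi> \<longleftrightarrow> mean_lim (\<lambda>y k. a * F y k + b * F' y k) \<Psi>" for \<Psi>
  proof (rule mean_lim_cong[OF jmeas_lincomb[OF mf] jmeas_lincomb[OF F(1,3)]])
    have "AE \<omega> in Q. AE k in \<kappa> (tgt G (\<omega> 0)). \<bar>F (bnd \<omega>) k\<bar> \<le> C" "AE \<omega> in Q. AE k in \<kappa> (tgt G (\<omega> 0)). \<bar>F' (bnd \<omega>) k\<bar> \<le> C'"
      using F by (auto simp: ess_bdd_def)
    then show "AE \<omega> in Q. AE k in \<kappa> (tgt G (\<omega> 0)). a * ?F (bnd \<omega>) k + b * ?F' (bnd \<omega>) k = a * F (bnd \<omega>) k + b * F' (bnd \<omega>) k"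
    proof eventually_elim
      case (elim \<omega>)
      then show ?case by eventually_elim (simp add: clip_id)
    qed
  qed
  ultimately show ?thesis by blast
qed

lemma mean_lim_nonneg:
  assumes F: "jmeas F" "ess_bdd F C" and nn: "AE \<omega> in Q. AE k in \<kappa> (tgt G (\<omega> 0)). 0 \<le> F (bnd \<omega>) k" and l: "mean_lim F \<Phi>"
  shows "AE \<omega> in Q. 0 \<le> \<Phi> (bnd \<omega>)"
proof -
  have b: "(\<lambda>x. bnd (fst x)) \<in> measurable (PS \<Otimes>\<^sub>M arrs G) (pts X)" by measurable
  have "Measurable.pred (PS \<Otimes>\<^sub>M arrs G) (\<lambda>p. 0 \<le> F (bnd (fst p)) (snd p))"
    using jmeas_measurable[OF F(1) b measurable_snd] by simp
  from AE_along_path[OF this nn]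
  have avg0: "AE \<omega> in Q. \<forall>n. 0 \<le> avg F n \<omega>"
    by eventually_elim (auto simp: avg_def intro: integral_nonneg_AE)
  show ?thesis
  proof (rule Q.AE_nonneg_of_set_integrals)
    obtain D where D: "\<Phi> \<in> borel_measurable (pts X)" "\<And>y. \<bar>\<Phi> y\<bar> \<le> D" using l by (auto simp: mean_lim_def)
    then show "integrable Q (\<lambda>\<omega>. \<Phi> (bnd \<omega>))"
      using measurable_compose[OF bnd, of \<Phi> borel] by (intro Q.integrable_AE_bounded[where C=D]) (auto simp: measurable_cong_sets[OF Q_sets refl])
    fix A assume A: "A \<in> sets Q"
    have iA: "integrable Q (indicator A :: _ \<Rightarrow> real)" using A by (auto simp: integrable_indicator_iff Q.emeasure_finite less_top[symmetric])
    have "L (\<lambda>_. 0) \<le> L (\<lambda>n. \<integral>\<omega>. indicator A \<omega> * avg F n \<omega> \<partial>Q)"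
      using avg0 by (intro banach_limit_mono[OF L] Bseq_avg[OF F iA] integral_nonneg_AE Bfun_const)
         (auto elim!: eventually_mono)
    also have "\<dots> = (\<integral>\<omega>. indicator A \<omega> * \<Phi> (bnd \<omega>) \<partial>Q)"
      by (rule mean_limD[OF l iA])
    finally show "0 \<le> (\<integral>\<omega>. indicator A \<omega> * \<Phi> (bnd \<omega>) \<partial>Q)"
      by (simp add: banach_limit_const[OF L])
  qed
qed

lemma mean_lim_one: "mean_lim (\<lambda>_ _. 1) (\<lambda>_. 1)"
proof -
  have "avg (\<lambda>_ _. 1) n \<omega> = 1" if "\<omega> \<in> space Q" for n \<omega>
  proof -
    interpret prob_space "\<kappa> (src G (\<omega> n))" using that by (intro kappa_prob src_in path_in) (simp add: Q_space)
    show ?thesis by (simp add: avg_def prob_space)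
  qed
  then have "(\<integral>\<omega>. u \<omega> * avg (\<lambda>_ _. 1) n \<omega> \<partial>Q) = (\<integral>\<omega>. u \<omega> * 1 \<partial>Q)" for n u
    by (intro Bochner_Integration.integral_cong) auto
  then show ?thesis by (auto simp: mean_lim_def banach_limit_const[OF L])
qed

lemma mean_lim_scale:
  assumes a[measurable]: "a \<in> borel_measurable (pts X)" and ab: "\<And>y. \<bar>a y\<bar> \<le> B" and l: "mean_lim F \<Phi>"
  shows "mean_lim (\<lambda>y k. a y * F y k) (\<lambda>y. a y * \<Phi> y)"
  unfolding mean_lim_def
proof (intro conjI allI impI)
  obtain D where D[measurable]: "\<Phi> \<in> borel_measurable (pts X)" "\<And>y. \<bar>\<Phi> y\<bar> \<le> D" using l by (auto simp: mean_lim_def)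
  show "(\<lambda>y. a y * \<Phi> y) \<in> borel_measurable (pts X)" by measurable
  have "\<bar>a y * \<Phi> y\<bar> \<le> B * D" for y
    using ab[of y] D(2)[of y] order_trans[OF abs_ge_zero ab[of y]] by (auto simp: abs_mult intro!: mult_mono)
  then show "\<exists>C. \<forall>y. \<bar>a y * \<Phi> y\<bar> \<le> C" by blast
  fix u :: "(nat \<Rightarrow> 'g) \<Rightarrow> real" assume u: "integrable Q u"
  have "integrable Q (\<lambda>\<omega>. u \<omega> * a (bnd \<omega>))"
    using measurable_compose[OF bnd a] ab
    by (intro Q.abs_integral_mult_bound(1)[OF u, where C=B]) (auto simp: measurable_cong_sets[OF Q_sets refl])
  then have "L (\<lambda>n. \<integral>\<omega>. (u \<omega> * a (bnd \<omega>)) * avg F n \<omega> \<partial>Q) = (\<integral>\<omega>. (u \<omega> * a (bnd \<omega>)) * \<Phi> (bnd \<omega>) \<partial>Q)"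
    using l unfolding mean_lim_def by blast
  moreover have "avg (\<lambda>y k. a y * F y k) n \<omega> = a (bnd \<omega>) * avg F n \<omega>" for n \<omega>
    by (simp add: avg_def)
  ultimately show "L (\<lambda>n. \<integral>\<omega>. u \<omega> * avg (\<lambda>y k. a y * F y k) n \<omega> \<partial>Q) = (\<integral>\<omega>. u \<omega> * (a (bnd \<omega>) * \<Phi> (bnd \<omega>)) \<partial>Q)"
    by (simp add: mult.assoc)
qed

lemma tmult_assoc:
  assumes "g \<in> space (arrs G)" "h \<in> space (arrs G)" "k \<in> space (arrs G)"
    "src G g \<in> U" "src G g = tgt G h" "src G h \<in> U" "src G h = tgt G k"
  shows "tmult (tmult g h) k = tmult g (tmult h k)" "src G (tmult g h) = src G h" "tgt G (tmult g h) = tgt G g"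
  using assms by (auto simp: tmult_def composable_def mult_assoc src_mult tgt_mult)

text \<open>Equivariance of the limit.  \<open>F'\<close> is the \<open>\<Theta>\<close>-average of the translates of \<open>F\<close>; along almost every
  path, the averages of \<open>F'\<close> are the integrals of those of \<open>F\<close> over the random translate \<open>K\<close> of the path.\<close>

lemma mean_lim_translate:
  assumes \<Theta>[measurable]: "\<Theta> \<in> measurable (pts X) (subprob_algebra (arrs G))"
    and ac: "\<And>y P. y \<in> space (pts X) \<Longrightarrow> proj X y \<in> U \<Longrightarrow> AE h in \<kappa> (proj X y). P h \<Longrightarrow> AE h in \<Theta> y. P h"
    and F: "jmeas F" "\<And>y k. \<bar>F y k\<bar> \<le> C" and F': "jmeas F'"
    and rel: "AE \<omega> in Q. AE k in \<kappa> (tgt G (\<omega> 0)). F' (bnd \<omega>) k = (\<integral>h. F (tact (ginv G h) (bnd \<omega>)) (tmult (ginv G h) k) \<partial>\<Theta> (bnd \<omega>))"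
    and l: "mean_lim F \<Phi>" "mean_lim F' \<Phi>'"
  shows "AE \<omega> in Q. \<Phi>' (bnd \<omega>) = (\<integral>h. \<Phi> (tact (ginv G h) (bnd \<omega>)) \<partial>\<Theta> (bnd \<omega>))"
proof -
  note [measurable] = bnd
  have sub\<Theta>: "subprob_space (\<Theta> y)" "sets (\<Theta> y) = sets (arrs G)" "space (\<Theta> y) = space (arrs G)" if "y \<in> space (pts X)" for y
    using subprob_measurableD[OF \<Theta> that] subprob_space_kernel[OF \<Theta> that] by auto
  have bndp: "bnd \<omega> \<in> space (pts X)" if "\<omega> \<in> space PS" for \<omega> using measurable_space[OF bnd that] .
  define K where "K \<omega> = distr (\<Theta> (bnd \<omega>)) PS (\<lambda>h. \<tau> (ginv G h) \<omega>)" for \<omega>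
  have K: "K \<in> measurable PS (subprob_algebra PS)"
    unfolding K_def[abs_def] by (rule measurable_distr2[where M="arrs G"]) measurable
  have tm: "(\<lambda>h. \<tau> (ginv G h) \<omega>) \<in> measurable (\<Theta> (bnd \<omega>)) PS" if \<omega>: "\<omega> \<in> space PS" for \<omega>
  proof -
    have "(\<lambda>_. \<omega>) \<in> measurable (arrs G) PS" using \<omega> by simp
    then have "(\<lambda>h. \<tau> (ginv G h) \<omega>) \<in> measurable (arrs G) PS" by (intro measurable_\<tau> measurable_inv)
    then show ?thesis unfolding measurable_cong_sets[OF sub\<Theta>(2)[OF bndp[OF \<omega>]] refl] .
  qed
  have intK: "(\<integral>\<omega>'. f \<omega>' \<partial>K \<omega>) = (\<integral>h. f (\<tau> (ginv G h) \<omega>) \<partial>\<Theta> (bnd \<omega>))"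
    if "\<omega> \<in> space PS" "f \<in> borel_measurable PS" for f :: "_ \<Rightarrow> real" and \<omega>
    unfolding K_def using that by (intro integral_distr tm)
  have transfer: "AE \<omega> in Q. AE h in \<Theta> (bnd \<omega>). R \<omega> h" if "AE \<omega> in Q. AE h in \<kappa> (tgt G (\<omega> 0)). R \<omega> h" for R
    using that AE_good_path AE_proj_bnd
  proof eventually_elim
    case (elim \<omega>)
    then have p: "bnd \<omega> \<in> space (pts X)" "proj X (bnd \<omega>) \<in> U" using bndp by auto
    show ?case by (rule ac[OF p]) (use elim(1) in \<open>simp only: elim(3)\<close>)
  qed
  have acK: "AE \<omega> in Q. AE \<omega>' in K \<omega>. P \<omega>'" if P[measurable]: "Measurable.pred PS P" and ae: "AE \<omega> in Q. P \<omega>" for P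
  proof -
    have "AE \<omega> in Q. AE h in \<kappa> (tgt G (\<omega> 0)). P (\<tau> (ginv G h) \<omega>)"
      by (rule AE_inverse_translate[where R="\<lambda>_. P"]) (measurable, use ae in \<open>auto elim!: eventually_mono\<close>)
    from transfer[OF this] AE_space show ?thesis
    proof eventually_elim
      case (elim \<omega>)
      then have "\<omega> \<in> space PS" by (simp add: Q_space)
      then show ?case unfolding K_def using elim(1) P by (subst AE_distr_iff[OF tm]) (auto simp: pred_def)
    qed
  qed
  have b\<Phi>: "\<Phi> \<in> borel_measurable (pts X)" "\<exists>D. \<forall>y. \<bar>\<Phi> y\<bar> \<le> D" "\<Phi>' \<in> borel_measurable (pts X)" "\<exists>D. \<forall>y. \<bar>\<Phi>' y\<bar> \<le> D"
    using l by (auto simp: mean_lim_def)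
  note [measurable] = b\<Phi>(1,3)
  obtain D where D: "\<And>y. \<bar>\<Phi> y\<bar> \<le> D" using b\<Phi> by blast
  obtain D' where D': "\<And>y. \<bar>\<Phi>' y\<bar> \<le> D'" using b\<Phi> by blast
  \<comment> \<open>along almost every path, the averages of F' are the K-averages of those of F\<close>
  have relm: "Measurable.pred (PS \<Otimes>\<^sub>M arrs G) (\<lambda>p. F' (bnd (fst p)) (snd p) = (\<integral>h. F (tact (ginv G h) (bnd (fst p))) (tmult (ginv G h) (snd p)) \<partial>\<Theta> (bnd (fst p))))"
  proof -
    have b: "(\<lambda>x. bnd (fst x)) \<in> measurable (PS \<Otimes>\<^sub>M arrs G) (pts X)" by measurable
    have 1: "(\<lambda>p. F' (bnd (fst p)) (snd p)) \<in> borel_measurable (PS \<Otimes>\<^sub>M arrs G)"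
      by (rule jmeas_measurable[OF F' b measurable_snd])
    have 2: "(\<lambda>q. tact (ginv G (snd q)) (bnd (fst (fst q)))) \<in> measurable ((PS \<Otimes>\<^sub>M arrs G) \<Otimes>\<^sub>M arrs G) (pts X)"
      "(\<lambda>q. tmult (ginv G (snd q)) (snd (fst q))) \<in> measurable ((PS \<Otimes>\<^sub>M arrs G) \<Otimes>\<^sub>M arrs G) (arrs G)" by measurable
    have 3: "(\<lambda>p. \<integral>h. F (tact (ginv G h) (bnd (fst p))) (tmult (ginv G h) (snd p)) \<partial>\<Theta> (bnd (fst p))) \<in> borel_measurable (PS \<Otimes>\<^sub>M arrs G)"
      by (rule integral_measurable_kernel[OF jmeas_measurable[OF F(1) 2] measurable_compose[OF b \<Theta>]])
    show ?thesis unfolding pred_def by (rule borel_measurable_eq[OF 1 3])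
  qed
  have key: "AE \<omega> in Q. \<forall>n. (\<integral>\<omega>'. avg F n \<omega>' \<partial>K \<omega>) = avg F' n \<omega>"
    using AE_along_path[OF relm rel] transfer[OF AE_bnd_translate] AE_good_path AE_proj_bnd
  proof eventually_elim
    case (elim \<omega>)
    then have \<omega>: "\<omega> \<in> space PS" and t0: "tgt G (\<omega> 0) \<in> U" by auto
    note y = bndp[OF \<omega>]
    have py: "proj X (bnd \<omega>) = tgt G (\<omega> 0)" "proj X (bnd \<omega>) \<in> U" using elim(4) t0 by auto
    interpret T: subprob_space "\<Theta> (bnd \<omega>)" by (rule sub\<Theta>(1)[OF y])
    have tfib: "AE h in \<Theta> (bnd \<omega>). tgt G h = tgt G (\<omega> 0)"
      by (rule ac[OF y py(2)]) (use kappa_fibre[OF t0] in \<open>simp only: py(1)\<close>)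
    show ?case
    proof
      fix n
      have n: "\<omega> n \<in> space (arrs G)" "src G (\<omega> n) \<in> U" "tgt G (\<omega> n) = tgt G (\<omega> 0)"
        using elim(3) path_in[OF \<omega>] by auto
      note so = U_objs[OF n(2)]
      interpret Kp: prob_space "\<kappa> (src G (\<omega> n))" by (rule kappa_prob[OF so])
      let ?f = "\<lambda>h k. F (tact (ginv G h) (bnd \<omega>)) (tmult (ginv G h) (tmult (\<omega> n) k))"
      have fm: "(\<lambda>p. ?f (fst p) (snd p)) \<in> borel_measurable (arrs G \<Otimes>\<^sub>M arrs G)"
      proof (rule jmeas_measurable[OF F(1)])
        have [measurable]: "(\<lambda>_. bnd \<omega>) \<in> measurable (arrs G \<Otimes>\<^sub>M arrs G) (pts X)" "(\<lambda>_. \<omega> n) \<in> measurable (arrs G \<Otimes>\<^sub>M arrs G) (arrs G)"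
          using y n(1) by auto
        show "(\<lambda>p. tact (ginv G (fst p)) (bnd \<omega>)) \<in> measurable (arrs G \<Otimes>\<^sub>M arrs G) (pts X)" by measurable
        show "(\<lambda>p. tmult (ginv G (fst p)) (tmult (\<omega> n) (snd p))) \<in> measurable (arrs G \<Otimes>\<^sub>M arrs G) (arrs G)" by measurable
      qed
      have "(\<integral>\<omega>'. avg F n \<omega>' \<partial>K \<omega>) = (\<integral>h. avg F n (\<tau> (ginv G h) \<omega>) \<partial>\<Theta> (bnd \<omega>))"
        by (rule intK[OF \<omega> avg_measurable[OF F(1)]])
      also have "\<dots> = (\<integral>h. (\<integral>k. ?f h k \<partial>\<kappa> (src G (\<omega> n))) \<partial>\<Theta> (bnd \<omega>))"
      proof (rule integral_cong_AE)
        show "(\<lambda>h. avg F n (\<tau> (ginv G h) \<omega>)) \<in> borel_measurable (\<Theta> (bnd \<omega>))"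
          by (rule measurable_compose[OF tm[OF \<omega>] avg_measurable[OF F(1)]])
        have "(\<lambda>_. \<kappa> (src G (\<omega> n))) \<in> measurable (arrs G) (subprob_algebra (arrs G))"
          using measurable_space[OF kappa_sub so] by simp
        from integral_measurable_kernel[OF fm this]
        show "(\<lambda>h. \<integral>k. ?f h k \<partial>\<kappa> (src G (\<omega> n))) \<in> borel_measurable (\<Theta> (bnd \<omega>))"
          by (simp add: measurable_cong_sets[OF sub\<Theta>(2)[OF y] refl])
        show "AE h in \<Theta> (bnd \<omega>). avg F n (\<tau> (ginv G h) \<omega>) = (\<integral>k. ?f h k \<partial>\<kappa> (src G (\<omega> n)))"
          using elim(2) tfib AE_space
        proof eventually_elim
          case (elim h)
          then have h: "h \<in> space (arrs G)" "tgt G h = tgt G (\<omega> 0)" using sub\<Theta>(3)[OF y] by auto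
          have hi: "ginv G h \<in> space (arrs G)" "src G (ginv G h) \<in> U" "src G (ginv G h) = tgt G (\<omega> n)"
            using h t0 n by (auto simp: inv_in src_inv)
          have s: "src G (\<tau> (ginv G h) \<omega> n) = src G (\<omega> n)"
            using hi n by (auto simp: \<tau>_def tmult_def composable_def src_mult)
          have "AE k in \<kappa> (src G (\<omega> n)). F (bnd (\<tau> (ginv G h) \<omega>)) (tmult (\<tau> (ginv G h) \<omega> n) k) = ?f h k"
            using kappa_fibre[OF n(2)] AE_space
          proof eventually_elim
            case (elim k)
            then have k: "k \<in> space (arrs G)" "src G (\<omega> n) = tgt G k" using so by (auto simp: kappa_space)
            show ?case
              using tmult_assoc(1)[OF hi(1) n(1) k(1) hi(2,3) n(2) k(2)] \<open>bnd (\<tau> (ginv G h) \<omega>) \<in> Y0 \<and> _\<close>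
              by (simp add: \<tau>_def)
          qed
          moreover have "\<tau> (ginv G h) \<omega> \<in> space PS"
            using hi \<omega> by (auto simp: \<tau>_def space_PiM intro!: tmult_in)
          ultimately show ?case
            unfolding avg_def s
            using measurable_tmult_kernel[OF F(1), of "\<tau> (ginv G h) \<omega>" n] measurable_compose[OF measurable_Pair1'[OF h(1)] fm] s
            by (intro integral_cong_AE) (auto simp: measurable_cong_sets[OF kappa_sets[OF so] refl])
        qed
      qed
      also have "\<dots> = (\<integral>k. (\<integral>h. ?f h k \<partial>\<Theta> (bnd \<omega>)) \<partial>\<kappa> (src G (\<omega> n)))"
      proof (rule Fubini_bounded)
        show "(\<lambda>p. ?f (fst p) (snd p)) \<in> borel_measurable (\<Theta> (bnd \<omega>) \<Otimes>\<^sub>M \<kappa> (src G (\<omega> n)))"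
          using fm by (simp add: measurable_cong_sets[OF sets_pair_measure_cong[OF sub\<Theta>(2)[OF y] kappa_sets[OF so]] refl])
      qed (use F(2) T.finite_measure_axioms Kp.finite_measure_axioms in auto)
      also have "\<dots> = avg F' n \<omega>"
        unfolding avg_def
      proof (rule integral_cong_AE)
        show "(\<lambda>k. F' (bnd \<omega>) (tmult (\<omega> n) k)) \<in> borel_measurable (\<kappa> (src G (\<omega> n)))" by (rule measurable_tmult_kernel[OF F' \<omega>])
        have fm2: "(\<lambda>p. ?f (snd p) (fst p)) \<in> borel_measurable (arrs G \<Otimes>\<^sub>M arrs G)"
          using measurable_compose[OF measurable_Pair[OF measurable_snd measurable_fst] fm] by simp
        have "(\<lambda>_. \<Theta> (bnd \<omega>)) \<in> measurable (arrs G) (subprob_algebra (arrs G))"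
          using measurable_space[OF \<Theta> y] by simp
        from integral_measurable_kernel[OF fm2 this]
        show "(\<lambda>k. \<integral>h. ?f h k \<partial>\<Theta> (bnd \<omega>)) \<in> borel_measurable (\<kappa> (src G (\<omega> n)))"
          by (simp add: measurable_cong_sets[OF kappa_sets[OF so] refl])
        show "AE k in \<kappa> (src G (\<omega> n)). (\<integral>h. ?f h k \<partial>\<Theta> (bnd \<omega>)) = F' (bnd \<omega>) (tmult (\<omega> n) k)"
          using elim(1) by (auto elim!: eventually_mono allE[of _ n])
      qed
      finally show "(\<integral>\<omega>'. avg F n \<omega>' \<partial>K \<omega>) = avg F' n \<omega>" .
    qed
  qed
  have key2: "AE \<omega> in Q. (\<integral>\<omega>'. \<Phi> (bnd \<omega>') \<partial>K \<omega>) = (\<integral>h. \<Phi> (tact (ginv G h) (bnd \<omega>)) \<partial>\<Theta> (bnd \<omega>))"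
    using transfer[OF AE_bnd_translate] AE_space
  proof eventually_elim
    case (elim \<omega>)
    then have \<omega>: "\<omega> \<in> space PS" by (simp add: Q_space)
    note y = bndp[OF \<omega>]
    have m\<Phi>b: "(\<lambda>\<omega>. \<Phi> (bnd \<omega>)) \<in> borel_measurable PS" by measurable
    have "(\<integral>\<omega>'. \<Phi> (bnd \<omega>') \<partial>K \<omega>) = (\<integral>h. \<Phi> (bnd (\<tau> (ginv G h) \<omega>)) \<partial>\<Theta> (bnd \<omega>))"
      by (rule intK[OF \<omega> m\<Phi>b])
    also have "\<dots> = (\<integral>h. \<Phi> (tact (ginv G h) (bnd \<omega>)) \<partial>\<Theta> (bnd \<omega>))"
    proof (rule integral_cong_AE)
      show "(\<lambda>h. \<Phi> (bnd (\<tau> (ginv G h) \<omega>))) \<in> borel_measurable (\<Theta> (bnd \<omega>))"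
        by (rule measurable_compose[OF tm[OF \<omega>] m\<Phi>b])
      have "(\<lambda>_. bnd \<omega>) \<in> measurable (arrs G) (pts X)" using y by simp
      then have "(\<lambda>h. tact (ginv G h) (bnd \<omega>)) \<in> measurable (arrs G) (pts X)" by (intro measurable_tact measurable_inv)
      then have "(\<lambda>h. \<Phi> (tact (ginv G h) (bnd \<omega>))) \<in> borel_measurable (arrs G)" by (rule measurable_compose) measurable
      then show "(\<lambda>h. \<Phi> (tact (ginv G h) (bnd \<omega>))) \<in> borel_measurable (\<Theta> (bnd \<omega>))"
        by (simp add: measurable_cong_sets[OF sub\<Theta>(2)[OF y] refl])
      show "AE h in \<Theta> (bnd \<omega>). \<Phi> (bnd (\<tau> (ginv G h) \<omega>)) = \<Phi> (tact (ginv G h) (bnd \<omega>))"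
        using elim(1) by eventually_elim simp
    qed
    finally show ?case .
  qed
  have m\<Phi>: "(\<lambda>\<omega>. \<Phi> (bnd \<omega>)) \<in> borel_measurable PS" "(\<lambda>\<omega>. \<Phi>' (bnd \<omega>)) \<in> borel_measurable PS" by measurable
  have mK: "(\<lambda>\<omega>. \<integral>\<omega>'. f \<omega>' \<partial>K \<omega>) \<in> borel_measurable Q" if "f \<in> borel_measurable PS" for f :: "_ \<Rightarrow> real"
    using measurable_compose[OF K integral_measurable_subprob_algebra[OF that]] by (simp add: measurable_cong_sets[OF Q_sets refl])
  have bK: "\<bar>\<integral>\<omega>'. \<Phi> (bnd \<omega>') \<partial>K \<omega>\<bar> \<le> D" if "\<omega> \<in> space PS" for \<omega>
    by (rule subprob_space.abs_integral_le[OF subprob_space_kernel[OF K that]]) (rule D)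
  have "AE \<omega> in Q. \<Phi>' (bnd \<omega>) = (\<integral>\<omega>'. \<Phi> (bnd \<omega>') \<partial>K \<omega>)"
  proof (rule Q.AE_eq_of_set_integrals)
    show "integrable Q (\<lambda>\<omega>. \<Phi>' (bnd \<omega>))"
      using m\<Phi> D' by (intro Q.integrable_AE_bounded[where C=D']) (auto simp: measurable_cong_sets[OF Q_sets refl])
    show "integrable Q (\<lambda>\<omega>. \<integral>\<omega>'. \<Phi> (bnd \<omega>') \<partial>K \<omega>)"
      using bK by (intro Q.integrable_AE_bounded[where C=D] mK m\<Phi>) (auto intro!: AE_I2 simp: Q_space)
    fix A assume A: "A \<in> sets Q"
    have A': "A \<in> sets PS" using A Q_sets by simp
    have iA: "integrable Q (indicator A :: _ \<Rightarrow> real)" using A by (auto simp: integrable_indicator_iff Q.emeasure_finite less_top[symmetric])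
    have "L (\<lambda>n. \<integral>\<omega>. indicator A \<omega> * (\<integral>\<omega>'. avg F n \<omega>' \<partial>K \<omega>) \<partial>Q) = (\<integral>\<omega>. indicator A \<omega> * (\<integral>\<omega>'. \<Phi> (bnd \<omega>') \<partial>K \<omega>) \<partial>Q)"
    proof (rule weak_limit_pushforward[where C="max C D", OF _ avg_measurable[OF F(1)] m\<Phi>(1) _ _ K acK A'])
      show "L (\<lambda>n. \<integral>\<omega>. u \<omega> * avg F n \<omega> \<partial>Q) = (\<integral>\<omega>. u \<omega> * \<Phi> (bnd \<omega>) \<partial>Q)" if "integrable Q u" for u
        by (rule mean_limD[OF l(1) that])
      show "\<bar>avg F n \<omega>\<bar> \<le> max C D" if "\<omega> \<in> space PS" for n \<omega>
        using avg_bound[of F C, OF F(2) that, of n] by simp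
      show "\<bar>\<Phi> (bnd \<omega>)\<bar> \<le> max C D" for \<omega> using D[of "bnd \<omega>"] by simp
    qed
    also have "(\<lambda>n. \<integral>\<omega>. indicator A \<omega> * (\<integral>\<omega>'. avg F n \<omega>' \<partial>K \<omega>) \<partial>Q) = (\<lambda>n. \<integral>\<omega>. indicator A \<omega> * avg F' n \<omega> \<partial>Q)"
    proof
      fix n
      show "(\<integral>\<omega>. indicator A \<omega> * (\<integral>\<omega>'. avg F n \<omega>' \<partial>K \<omega>) \<partial>Q) = (\<integral>\<omega>. indicator A \<omega> * avg F' n \<omega> \<partial>Q)"
      proof (rule integral_cong_AE)
        show "(\<lambda>\<omega>. indicator A \<omega> * (\<integral>\<omega>'. avg F n \<omega>' \<partial>K \<omega>)) \<in> borel_measurable Q"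
          using A mK[OF avg_measurable[OF F(1)]] by simp
        show "(\<lambda>\<omega>. indicator A \<omega> * avg F' n \<omega>) \<in> borel_measurable Q" using A avg_Q[OF F'] by simp
        show "AE \<omega> in Q. indicator A \<omega> * (\<integral>\<omega>'. avg F n \<omega>' \<partial>K \<omega>) = indicator A \<omega> * avg F' n \<omega>"
          using key
        proof eventually_elim
          case (elim \<omega>)
          then have "(\<integral>\<omega>'. avg F n \<omega>' \<partial>K \<omega>) = avg F' n \<omega>" by blast
          then show ?case by simp
        qed
      qed
    qed
    also have "L (\<lambda>n. \<integral>\<omega>. indicator A \<omega> * avg F' n \<omega> \<partial>Q) = (\<integral>\<omega>. indicator A \<omega> * \<Phi>' (bnd \<omega>) \<partial>Q)"
      by (rule mean_limD[OF l(2) iA])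
    finally show "(\<integral>\<omega>. indicator A \<omega> * \<Phi>' (bnd \<omega>) \<partial>Q) = (\<integral>\<omega>. indicator A \<omega> * (\<integral>\<omega>'. \<Phi> (bnd \<omega>') \<partial>K \<omega>) \<partial>Q)" .
  qed
  with key2 show ?thesis by eventually_elim simp
qed

end

section \<open>The semi-direct product\<close>

lemma completion_measurable_AE:
  fixes f g :: "'a \<Rightarrow> real"
  assumes g: "g \<in> borel_measurable M" and ae: "AE x in M. f x = g x"
  shows "f \<in> borel_measurable (completion M)"
proof (rule measurableI)
  fix B :: "real set" assume B: "B \<in> sets borel"
  show "f -` B \<inter> space (completion M) \<in> sets (completion M)"
  proof (rule completion.in_sets_AE)
    show "AE x in completion M. x \<in> g -` B \<inter> space M \<longleftrightarrow> x \<in> f -` B \<inter> space (completion M)"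
      by (rule AE_completion) (use ae in \<open>auto elim: eventually_mono\<close>)
    show "g -` B \<inter> space M \<in> sets (completion M)"
      using measurable_sets[OF g B] by auto
  qed auto
qed auto

text \<open>Convolutions are integrals over completions of functions that are measurable only up to a null
  set.\<close>

lemma integral_completion_AE:
  fixes f g :: "'a \<Rightarrow> real"
  assumes g: "g \<in> borel_measurable M" and ae: "AE x in M. f x = g x"
  shows "(\<integral>x. f x \<partial>completion M) = (\<integral>x. g x \<partial>M)"
proof -
  have "(\<integral>x. f x \<partial>completion M) = (\<integral>x. g x \<partial>completion M)"
    by (intro integral_cong_AE completion_measurable_AE[OF g ae] measurable_completion[OF g] AE_completion ae)
  also have "\<dots> = (\<integral>x. g x \<partial>M)" by (rule integral_completion[OF g])
  finally show ?thesis .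
qed

lemma (in groupoid) inv_inv:
  assumes g: "g \<in> space (arrs G)" shows "ginv G (ginv G g) = g"
proof -
  let ?i = "ginv G g" let ?j = "ginv G (ginv G g)"
  have i: "?i \<in> space (arrs G)" "?j \<in> space (arrs G)" using g by (auto intro: inv_in)
  have "?j = gmult G ?j (unit_at G (src G ?j))" using unit_right[OF i(2)] by simp
  also have "src G ?j = src G g" using g i by (simp add: src_inv tgt_inv)
  also have "unit_at G (src G g) = gmult G ?i g" using inv_left[OF g] by simp
  also have "gmult G ?j (gmult G ?i g) = gmult G (gmult G ?j ?i) g"
    using g i by (intro mult_assoc[symmetric]) (auto simp: composable_def src_inv tgt_inv)
  also have "gmult G ?j ?i = unit_at G (tgt G g)" using inv_left[OF i(1)] g by (simp add: src_inv)
  also have "gmult G (unit_at G (tgt G g)) g = g" by (rule unit_left[OF g])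
  finally show ?thesis .
qed

context borel_gspace
begin

lemma act_in: "g \<in> space (arrs G) \<Longrightarrow> x \<in> space (pts X) \<Longrightarrow> src G g = proj X x \<Longrightarrow> act X g x \<in> space (pts X)"
  using measurable_space[OF measurable_act, of "(g, x)"] by (auto simp: space_restrict_space space_pair_measure actable_def)

lemma proj_act': "g \<in> space (arrs G) \<Longrightarrow> x \<in> space (pts X) \<Longrightarrow> src G g = proj X x \<Longrightarrow> proj X (act X g x) = tgt G g"
  by (rule proj_act) (simp add: actable_def)

lemma act_act': "(g, h) \<in> composable G \<Longrightarrow> h \<in> space (arrs G) \<Longrightarrow> x \<in> space (pts X) \<Longrightarrow> src G h = proj X x \<Longrightarrow>
    act X g (act X h x) = act X (gmult G g h) x"
  by (rule act_act) (simp_all add: actable_def)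

lemma act_inverse:
  assumes "g \<in> space (arrs G)" "x \<in> space (pts X)" "src G g = proj X x"
  shows "act X (ginv G g) (act X g x) = x"
proof -
  have "act X (ginv G g) (act X g x) = act X (gmult G (ginv G g) g) x"
    using assms by (intro act_act) (auto simp: composable_def actable_def src_inv inv_in)
  then show ?thesis using assms by (simp add: inv_left act_unit)
qed

lemma act_inverse':
  assumes "g \<in> space (arrs G)" "y \<in> space (pts X)" "tgt G g = proj X y"
  shows "act X g (act X (ginv G g) y) = y"
  using act_inverse[of "ginv G g" y] assms by (simp add: inv_in inv_inv src_inv)

abbreviation "H \<equiv> semidirect G X"

lemma semidirect_sel:
  "objs H = pts X" "src H z = snd (snd z)" "tgt H z = fst z" "unit_at H x = (x, unit_at G (proj X x), x)"
  "gmult H z z' = (fst z, gmult G (fst (snd z)) (fst (snd z')), snd (snd z'))" "ginv H z = (snd (snd z), ginv G (fst (snd z)), fst z)"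
  by (auto simp: semidirect_def split: prod.split)

lemma semidirect_fun:
  "src H = (\<lambda>z. snd (snd z))" "tgt H = fst" "unit_at H = (\<lambda>x. (x, unit_at G (proj X x), x))"
  "ginv H = (\<lambda>z. (snd (snd z), ginv G (fst (snd z)), fst z))"
  by (auto simp: semidirect_def fun_eq_iff split: prod.split)

abbreviation "AM \<equiv> pts X \<Otimes>\<^sub>M (arrs G \<Otimes>\<^sub>M pts X)"
definition "SA = {(y, g, x). g \<in> space (arrs G) \<and> x \<in> space (pts X) \<and> src G g = proj X x \<and> y = act X g x}"

lemma arrs_semidirect: "arrs H = restrict_space AM SA"
proof -
  have "(\<lambda>(g, x). (act X g x, g, x)) ` actable G X = SA"
    by (auto simp: SA_def actable_def image_iff)
  then show ?thesis by (simp add: semidirect_def)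
qed

lemma space_semidirect: "space (arrs H) = SA"
  unfolding arrs_semidirect by (auto simp: space_restrict_space space_pair_measure SA_def act_in)

lemma measurable_SA_fst: "fst \<in> measurable (arrs H) (pts X)"
  and measurable_SA_mid: "(\<lambda>z. fst (snd z)) \<in> measurable (arrs H) (arrs G)"
  and measurable_SA_snd: "(\<lambda>z. snd (snd z)) \<in> measurable (arrs H) (pts X)"
  unfolding arrs_semidirect by (intro measurable_restrict_space1; measurable)+

lemma semidirect_borel_groupoid: "borel_groupoid H"
proof (rule borel_groupoid.intro)
  have SA: "z \<in> SA \<longleftrightarrow> fst (snd z) \<in> space (arrs G) \<and> snd (snd z) \<in> space (pts X) \<and> src G (fst (snd z)) = proj X (snd (snd z)) \<and> fst z = act X (fst (snd z)) (snd (snd z))" for z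
    by (auto simp: SA_def split: prod.split)
  have comp: "(z, z') \<in> composable H \<longleftrightarrow> z \<in> SA \<and> z' \<in> SA \<and> snd (snd z) = fst z'" for z z'
    by (simp add: composable_def space_semidirect semidirect_sel)
  have compG: "(fst (snd z), fst (snd z')) \<in> composable G" if "(z, z') \<in> composable H" for z z'
    using that unfolding comp SA by (auto simp: composable_def proj_act')
  show "groupoid H"
  proof (rule groupoid.intro)
    fix z assume "z \<in> space (arrs H)"
    then have z: "fst (snd z) \<in> space (arrs G)" "snd (snd z) \<in> space (pts X)" "src G (fst (snd z)) = proj X (snd (snd z))" "fst z = act X (fst (snd z)) (snd (snd z))"
      by (auto simp: space_semidirect SA)
    have pf: "proj X (fst z) = tgt G (fst (snd z))" using z by (simp add: proj_act')
    show "src H z \<in> space (objs H)" "tgt H z \<in> space (objs H)"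
      using z by (auto simp: semidirect_sel act_in)
    show "gmult H (unit_at H (tgt H z)) z = z" "gmult H z (unit_at H (src H z)) = z"
      using z pf by (auto simp: semidirect_sel unit_left unit_right[of "fst (snd z)", unfolded z(3)] prod_eq_iff)
    show "ginv H z \<in> space (arrs H)"
      using z pf act_inverse[OF z(1-3)] by (auto simp: space_semidirect SA semidirect_sel inv_in src_inv act_in)
    show "src H (ginv H z) = tgt H z" "tgt H (ginv H z) = src H z"
      by (auto simp: semidirect_sel)
    show "gmult H (ginv H z) z = unit_at H (src H z)" "gmult H z (ginv H z) = unit_at H (tgt H z)"
      using z pf by (auto simp: semidirect_sel inv_left inv_right)
  next
    fix x assume "x \<in> space (objs H)"
    then have x: "x \<in> space (pts X)" by (simp add: semidirect_sel)
    show "unit_at H x \<in> space (arrs H)"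
      using x measurable_space[OF measurable_proj x] by (auto simp: space_semidirect SA semidirect_sel unit_in src_unit act_unit)
    show "src H (unit_at H x) = x" "tgt H (unit_at H x) = x" by (auto simp: semidirect_sel)
  next
    fix z z' assume zz: "(z, z') \<in> composable H"
    then show "gmult H z z' \<in> space (arrs H)"
      using compG[OF zz] unfolding comp SA
      by (auto simp: space_semidirect SA semidirect_sel mult_in src_mult act_act')
    show "src H (gmult H z z') = src H z'" "tgt H (gmult H z z') = tgt H z"
      by (auto simp: semidirect_sel)
    fix z'' assume zz': "(z', z'') \<in> composable H"
    show "gmult H (gmult H z z') z'' = gmult H z (gmult H z' z'')"
      using mult_assoc[OF compG[OF zz] compG[OF zz']] by (simp add: semidirect_sel)
  qed
  show "borel_groupoid_axioms H"
  proof
    show "src H \<in> measurable (arrs H) (objs H)" "tgt H \<in> measurable (arrs H) (objs H)"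
      using measurable_SA_fst measurable_SA_snd by (simp_all add: semidirect_fun semidirect_sel(1))
    have u: "x \<in> space (pts X) \<Longrightarrow> (x, unit_at G (proj X x), x) \<in> SA" for x
      using measurable_space[OF measurable_proj, of x] by (auto simp: SA unit_in src_unit act_unit)
    have um: "(\<lambda>x. unit_at G (proj X x)) \<in> measurable (pts X) (arrs G)"
      by (rule measurable_compose[OF measurable_proj measurable_unit])
    show "unit_at H \<in> measurable (objs H) (arrs H)"
      unfolding semidirect_fun semidirect_sel(1) arrs_semidirect
      using um u by (intro measurable_restrict_space2 measurable_Pair) auto
    show "ginv H \<in> measurable (arrs H) (arrs H)"
    proof -
      have 1: "(\<lambda>z. (snd (snd z), ginv G (fst (snd z)), fst z)) \<in> measurable (arrs H) AM"
        using measurable_SA_fst measurable_SA_snd measurable_compose[OF measurable_SA_mid measurable_inv] by (intro measurable_Pair) auto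
      have 2: "(\<lambda>z. (snd (snd z), ginv G (fst (snd z)), fst z)) \<in> space (arrs H) \<rightarrow> SA"
        by (auto simp: space_semidirect SA_def inv_in act_in src_inv proj_act actable_def act_inverse)
      from measurable_restrict_space2[OF 2 1] show ?thesis unfolding semidirect_fun arrs_semidirect .
    qed
    show "(\<lambda>(z, z'). gmult H z z') \<in> measurable (restrict_space (arrs H \<Otimes>\<^sub>M arrs H) (composable H)) (arrs H)"
    proof -
      let ?R = "restrict_space (arrs H \<Otimes>\<^sub>M arrs H) (composable H)"
      have spR: "space ?R \<subseteq> composable H" by (simp add: space_restrict_space)
      have c: "(\<lambda>p. (fst (snd (fst p)), fst (snd (snd p)))) \<in> measurable ?R (restrict_space (arrs G \<Otimes>\<^sub>M arrs G) (composable G))"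
      proof (rule measurable_restrict_space3)
        show "(\<lambda>p. (fst (snd (fst p)), fst (snd (snd p)))) \<in> measurable (arrs H \<Otimes>\<^sub>M arrs H) (arrs G \<Otimes>\<^sub>M arrs G)"
          by (intro measurable_Pair measurable_compose[OF measurable_fst measurable_SA_mid] measurable_compose[OF measurable_snd measurable_SA_mid])
      qed (use compG in auto)
      have m: "(\<lambda>p. gmult G (fst (snd (fst p))) (fst (snd (snd p)))) \<in> measurable ?R (arrs G)"
        using measurable_compose[OF c measurable_mult] by simp
      have 1: "(\<lambda>p. (fst (fst p), gmult G (fst (snd (fst p))) (fst (snd (snd p))), snd (snd (snd p)))) \<in> measurable ?R AM"
        by (intro measurable_Pair m measurable_restrict_space1 measurable_compose[OF measurable_fst measurable_SA_fst] measurable_compose[OF measurable_snd measurable_SA_snd])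
      have 2: "(\<lambda>p. (fst (fst p), gmult G (fst (snd (fst p))) (fst (snd (snd p))), snd (snd (snd p)))) \<in> space ?R \<rightarrow> SA"
      proof
        fix p assume "p \<in> space ?R"
        then have p: "(fst p, snd p) \<in> composable H" using spR by auto
        from compG[OF p] p show "(fst (fst p), gmult G (fst (snd (fst p))) (fst (snd (snd p))), snd (snd (snd p))) \<in> SA"
          unfolding comp SA by (auto simp: mult_in src_mult act_act')
      qed
      from measurable_restrict_space2[OF 2 1] show ?thesis
        by (simp add: arrs_semidirect split_beta' semidirect_sel)
    qed
  qed
qed

end

text \<open>The density \<open>d\<close> is needed to integrate functions on \<open>\<Gamma> \<times> G\<close> over the fibres: \<open>\<lambda>\<^sup>x\<close> itself
  need not be finite.\<close>

locale poisson_chain = mean_chain G U \<kappa> \<mu> \<pi> X bnd Y0 L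
  for G :: "('o, 'g) groupoid" and U \<kappa> \<mu> \<pi> and X :: "('o, 'g, 'y) gspace" and bnd Y0 L +
  fixes lam :: "'o \<Rightarrow> 'g measure" and d :: "'g \<Rightarrow> ennreal" and \<nu> :: "'y measure"
  assumes lam_sets: "\<And>x. x \<in> space (objs G) \<Longrightarrow> sets (lam x) = sets (arrs G)"
    and lam_kappa: "\<And>x P. x \<in> U \<Longrightarrow> (AE g in \<kappa> x. P g) \<longleftrightarrow> (AE g in lam x. P g)"
    and d[measurable]: "d \<in> borel_measurable (arrs G)"
    and lam_density: "\<And>x. x \<in> U \<Longrightarrow> lam x = density (\<kappa> x) d"
    and nu_sets[measurable_cong]: "sets \<nu> = sets (pts X)"
    and nu_AE: "\<And>P. Measurable.pred (pts X) P \<Longrightarrow> (AE y in \<nu>. P y) \<longleftrightarrow> (AE \<omega> in Q. P (bnd \<omega>))"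
begin

declare measurable_inv[measurable]

lemma nu_space: "space \<nu> = space (pts X)" using nu_sets by (rule sets_eq_imp_space_eq)

lemma AE_nu_good: "AE y in \<nu>. proj X y \<in> U \<and> y \<in> Y0"
proof (subst nu_AE)
  show "AE \<omega> in Q. proj X (bnd \<omega>) \<in> U \<and> bnd \<omega> \<in> Y0"
    using AE_good_path AE_proj_bnd AE_bnd_Y0 by eventually_elim auto
qed measurable

text \<open>\<open>D\<close> is \<open>H\<close> seen through the identification \<open>(y, g) \<leftrightarrow> (y, g, g\<^sup>-\<^sup>1 y)\<close>, over \<open>U\<close>.\<close>

definition D :: "('y \<times> 'g) set" where
  "D = {(y, g). y \<in> space (pts X) \<and> g \<in> space (arrs G) \<and> proj X y \<in> U \<and> proj X y = tgt G g}"

definition emb :: "'y \<Rightarrow> 'g \<Rightarrow> 'y \<times> 'g \<times> 'y" where "emb y g = (y, g, tact (ginv G g) y)"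

lemma D_sets: "{p\<in>space (pts X \<Otimes>\<^sub>M arrs G). p \<in> D} \<in> sets (pts X \<Otimes>\<^sub>M arrs G)"
proof -
  have "{p\<in>space (pts X \<Otimes>\<^sub>M arrs G). proj X (fst p) \<in> U \<and> proj X (fst p) = tgt G (snd p)} \<in> sets (pts X \<Otimes>\<^sub>M arrs G)"
    unfolding pred_def[symmetric] by measurable
  also have "{p\<in>space (pts X \<Otimes>\<^sub>M arrs G). proj X (fst p) \<in> U \<and> proj X (fst p) = tgt G (snd p)} = {p\<in>space (pts X \<Otimes>\<^sub>M arrs G). p \<in> D}"
    by (auto simp: D_def space_pair_measure)
  finally show ?thesis .
qed

lemma tact_D: "(y, g) \<in> D \<Longrightarrow> tact (ginv G g) y = act X (ginv G g) y"
  by (auto simp: D_def tact_def src_inv)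

lemma emb_SA: "(y, g) \<in> D \<Longrightarrow> emb y g \<in> SA"
  by (auto simp: D_def emb_def SA_def tact_def src_inv inv_in act_in proj_act actable_def tgt_inv act_inverse')

lemma measurable_emb: "(\<lambda>p. emb (fst p) (snd p)) \<in> measurable (restrict_space (pts X \<Otimes>\<^sub>M arrs G) D) (arrs H)"
proof -
  have 1: "(\<lambda>p. emb (fst p) (snd p)) \<in> measurable (restrict_space (pts X \<Otimes>\<^sub>M arrs G) D) AM"
    unfolding emb_def by (intro measurable_restrict_space1) measurable
  have 2: "(\<lambda>p. emb (fst p) (snd p)) \<in> space (restrict_space (pts X \<Otimes>\<^sub>M arrs G) D) \<rightarrow> SA"
    by (auto simp: space_restrict_space emb_SA)
  from measurable_restrict_space2[OF 2 1] show ?thesis unfolding arrs_semidirect .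
qed

text \<open>The function \<open>F\<close> of the introduction, for functions \<open>f\<close> with arbitrary values; \<open>c\<close> is the
  value off \<open>D\<close>, so \<open>pull True P\<close> states \<open>P\<close> on \<open>D\<close>.\<close>

definition pull :: "'c \<Rightarrow> ('y \<times> 'g \<times> 'y \<Rightarrow> 'c) \<Rightarrow> 'y \<Rightarrow> 'g \<Rightarrow> 'c" where
  "pull c f y g = (if (y, g) \<in> D then f (emb y g) else c)"

lemma measurable_pull:
  assumes f: "f \<in> measurable (arrs H) N" and c: "c \<in> space N"
  shows "(\<lambda>p. pull c f (fst p) (snd p)) \<in> measurable (pts X \<Otimes>\<^sub>M arrs G) N"
proof -
  have "(\<lambda>p. if p \<in> D then f (emb (fst p) (snd p)) else c) \<in> measurable (pts X \<Otimes>\<^sub>M arrs G) N"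
    unfolding measurable_If_restrict_space_iff[OF D_sets]
    using measurable_compose[OF measurable_emb f] c by simp
  then show ?thesis by (simp add: pull_def)
qed

lemma pred_pull: "Measurable.pred (arrs H) P \<Longrightarrow> Measurable.pred (pts X \<Otimes>\<^sub>M arrs G) (\<lambda>p. pull True P (fst p) (snd p))"
  by (rule measurable_pull) auto

lemma AE_kappa_D:
  assumes "y \<in> space (pts X)" "proj X y \<in> U" shows "AE g in \<kappa> (proj X y). (y, g) \<in> D"
  using kappa_fibre[OF assms(2)] AE_space
  by eventually_elim (use assms U_objs[OF assms(2)] in \<open>auto simp: D_def kappa_space\<close>)

abbreviation "lamH \<equiv> lift_haar G X lam"

lemma sets_lift: "sets (lamH y) = sets (arrs H)" by (simp add: lift_haar_def)

lemma emeasure_lift: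
  assumes y: "y \<in> space (pts X)" "proj X y \<in> U" and A: "A \<in> sets (arrs H)"
  shows "emeasure (lamH y) A = (\<integral>\<^sup>+g. d g * pull 0 (indicator A) y g \<partial>\<kappa> (proj X y))"
proof -
  let ?x = "proj X y" let ?F = "fibre G ?x" let ?e = "\<lambda>g. (y, g, act X (ginv G g) y)"
  note xo = U_objs[OF y(2)]
  have sl: "sets (lam ?x) = sets (arrs G)" by (rule lam_sets[OF xo])
  have spl: "space (lam ?x) = space (arrs G)" using sl by (rule sets_eq_imp_space_eq)
  have F: "?F \<in> sets (arrs G)" by (rule fibre_sets[OF y(2)])
  have FD: "g \<in> ?F \<longleftrightarrow> (y, g) \<in> D" if "g \<in> space (arrs G)" for g
    using that y by (auto simp: fibre_def D_def)
  have Fs: "?F \<subseteq> space (arrs G)" by (auto simp: fibre_def)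
  have e: "?e g = emb y g" if "g \<in> ?F" for g
    using that Fs by (auto simp: emb_def tact_D FD[THEN iffD1])
  have m0: "(\<lambda>g. pull 0 (indicator A :: _ \<Rightarrow> ennreal) y g) \<in> borel_measurable (arrs G)"
  proof -
    have "(\<lambda>p. pull 0 (indicator A :: _ \<Rightarrow> ennreal) (fst p) (snd p)) \<in> borel_measurable (pts X \<Otimes>\<^sub>M arrs G)"
      using A by (intro measurable_pull) auto
    from measurable_compose[OF measurable_Pair1'[OF y(1)] this] show ?thesis by simp
  qed
  let ?B = "{g\<in>?F. emb y g \<in> A}"
  have Bp: "pull 0 (indicator A) y g = (indicator ?B g :: ennreal)" if "g \<in> space (arrs G)" for g
    using FD[OF that] by (auto simp: pull_def indicator_def)
  have B: "?B \<in> sets (arrs G)"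
  proof -
    have "{g\<in>space (arrs G). pull 0 (indicator A) y g = (1::ennreal)} \<in> sets (arrs G)" using m0 by measurable
    also have "{g\<in>space (arrs G). pull 0 (indicator A) y g = (1::ennreal)} = ?B"
      using Fs by (auto simp: Bp indicator_def)
    finally show ?thesis .
  qed
  have em: "?e \<in> measurable (restrict_space (completion (lam ?x)) ?F) (arrs H)"
  proof (rule measurable_cong[THEN iffD2])
    show "g \<in> space (restrict_space (completion (lam ?x)) ?F) \<Longrightarrow> ?e g = emb y g" for g
      by (auto simp: space_restrict_space e)
    have p: "(\<lambda>g. (y, g)) \<in> measurable (restrict_space (completion (lam ?x)) ?F) (restrict_space (pts X \<Otimes>\<^sub>M arrs G) D)"
    proof (rule measurable_restrict_space2)
      show "(\<lambda>g. (y, g)) \<in> space (restrict_space (completion (lam ?x)) ?F) \<rightarrow> D"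
        using FD Fs by (auto simp: space_restrict_space)
      show "(\<lambda>g. (y, g)) \<in> measurable (restrict_space (completion (lam ?x)) ?F) (pts X \<Otimes>\<^sub>M arrs G)"
        by (intro measurable_restrict_space1 measurable_completion)
           (simp add: measurable_cong_sets[OF sl refl] measurable_Pair1'[OF y(1)])
    qed
    show "emb y \<in> measurable (restrict_space (completion (lam ?x)) ?F) (arrs H)"
      using measurable_compose[OF p measurable_emb] by simp
  qed
  have "emeasure (lamH y) A = emeasure (restrict_space (completion (lam ?x)) ?F) (?e -` A \<inter> space (restrict_space (completion (lam ?x)) ?F))"
    unfolding lift_haar_def by (rule emeasure_distr[OF em A])
  also have "?e -` A \<inter> space (restrict_space (completion (lam ?x)) ?F) = ?B"
    using Fs e by (auto simp: space_restrict_space spl)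
  also have "emeasure (restrict_space (completion (lam ?x)) ?F) ?B = emeasure (completion (lam ?x)) ?B"
    using F Fs by (intro emeasure_restrict_space) (auto simp: spl sl Int_absorb2)
  also have "\<dots> = emeasure (lam ?x) ?B" using B sl by simp
  also have "\<dots> = (\<integral>\<^sup>+g. d g * indicator ?B g \<partial>\<kappa> ?x)"
    unfolding lam_density[OF y(2)] using B kappa_sets[OF xo]
    by (intro emeasure_density) (auto simp: measurable_cong_sets[OF kappa_sets[OF xo] refl])
  also have "\<dots> = (\<integral>\<^sup>+g. d g * pull 0 (indicator A) y g \<partial>\<kappa> ?x)"
    by (intro nn_integral_cong) (simp add: Bp kappa_space[OF xo])
  finally show ?thesis .
qed

lemma null_lift:
  assumes y: "y \<in> space (pts X)" "proj X y \<in> U" and A: "A \<in> sets (arrs H)"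
  shows "emeasure (lamH y) A = 0 \<longleftrightarrow> (AE g in \<kappa> (proj X y). pull True (\<lambda>z. z \<notin> A) y g)"
proof -
  note xo = U_objs[OF y(2)]
  have m0: "(\<lambda>g. pull 0 (indicator A :: _ \<Rightarrow> ennreal) y g) \<in> borel_measurable (arrs G)"
  proof -
    have "(\<lambda>p. pull 0 (indicator A :: _ \<Rightarrow> ennreal) (fst p) (snd p)) \<in> borel_measurable (pts X \<Otimes>\<^sub>M arrs G)"
      using A by (intro measurable_pull) auto
    from measurable_compose[OF measurable_Pair1'[OF y(1)] this] show ?thesis by simp
  qed
  have dpos: "AE g in \<kappa> (proj X y). 0 < d g"
  proof -
    have dm: "d \<in> borel_measurable (\<kappa> (proj X y))" using d by (simp add: measurable_cong_sets[OF kappa_sets[OF xo] refl])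
    have "AE g in lam (proj X y). 0 < d g" unfolding lam_density[OF y(2)] by (subst AE_density[OF dm]) auto
    then show ?thesis by (simp only: lam_kappa[OF y(2)])
  qed
  have "emeasure (lamH y) A = 0 \<longleftrightarrow> (AE g in \<kappa> (proj X y). d g * pull 0 (indicator A) y g = (0 :: ennreal))"
    unfolding emeasure_lift[OF assms] using m0 d
    by (intro nn_integral_0_iff_AE) (simp add: measurable_cong_sets[OF kappa_sets[OF xo] refl])
  also have "\<dots> \<longleftrightarrow> (AE g in \<kappa> (proj X y). pull True (\<lambda>z. z \<notin> A) y g)"
    by (rule AE_iff_AE) (use dpos in \<open>eventually_elim, auto simp: pull_def indicator_def\<close>)
  finally show ?thesis .
qed

abbreviation "MH \<equiv> haar_star H lamH \<nu>"

lemma sets_MH: "sets MH = sets (arrs H)" and space_MH: "space MH = space (arrs H)"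
  by (simp_all add: haar_star_def)

lemma kappa_proj: "(\<lambda>y. \<kappa> (proj X y)) \<in> measurable (pts X) (subprob_algebra (arrs G))"
  by measurable

text \<open>The measure of the fibres over exceptional boundary points may depend on them in a nonmeasurable
  way; countable additivity survives since they form a null set.\<close>

lemma emeasure_MH:
  assumes A: "A \<in> sets (arrs H)"
  shows "emeasure MH A = (\<integral>\<^sup>+y. emeasure (lamH y) A \<partial>\<nu>)"
  unfolding haar_star_def
proof (rule emeasure_measure_of_sigma)
  show "sigma_algebra (space (arrs H)) (sets (arrs H))" ..
  show "positive (sets (arrs H)) (\<lambda>A. \<integral>\<^sup>+ y. emeasure (lamH y) A \<partial>\<nu>)"
    by (simp add: positive_def)
  show "countably_additive (sets (arrs H)) (\<lambda>A. \<integral>\<^sup>+ y. emeasure (lamH y) A \<partial>\<nu>)"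
  proof (rule countably_additiveI)
    fix B :: "nat \<Rightarrow> ('y \<times> 'g \<times> 'y) set" assume B: "range B \<subseteq> sets (arrs H)" "disjoint_family B"
    let ?J = "\<lambda>i y. \<integral>\<^sup>+g. d g * pull 0 (indicator (B i)) y g \<partial>\<kappa> (proj X y)"
    have J: "AE y in \<nu>. emeasure (lamH y) (B i) = ?J i y" for i
      using AE_nu_good AE_space by eventually_elim (use B in \<open>auto simp: nu_space intro!: emeasure_lift\<close>)
    have Jm: "?J i \<in> borel_measurable \<nu>" for i
    proof -
      have [measurable]: "B i \<in> sets (arrs H)" using B by auto
      have p: "(\<lambda>p. pull 0 (indicator (B i) :: _ \<Rightarrow> ennreal) (fst p) (snd p)) \<in> borel_measurable (pts X \<Otimes>\<^sub>M arrs G)"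
        by (intro measurable_pull) auto
      have "(\<lambda>p. d (snd p) * pull 0 (indicator (B i)) (fst p) (snd p)) \<in> borel_measurable (pts X \<Otimes>\<^sub>M arrs G)"
        using p by measurable
      then have "?J i \<in> borel_measurable (pts X)"
        by (intro nn_integral_measurable_subprob_algebra2[OF _ kappa_proj]) (simp add: split_beta')
      then show ?thesis by (simp add: measurable_cong_sets[OF nu_sets refl])
    qed
    have "(\<Sum>i. \<integral>\<^sup>+ y. emeasure (lamH y) (B i) \<partial>\<nu>) = (\<Sum>i. \<integral>\<^sup>+ y. ?J i y \<partial>\<nu>)"
      by (intro suminf_cong nn_integral_cong_AE J)
    also have "\<dots> = (\<integral>\<^sup>+ y. (\<Sum>i. ?J i y) \<partial>\<nu>)" by (rule nn_integral_suminf[symmetric]) (rule Jm)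
    also have "\<dots> = (\<integral>\<^sup>+ y. emeasure (lamH y) (\<Union>i. B i) \<partial>\<nu>)"
    proof (rule nn_integral_cong_AE)
      have "AE y in \<nu>. \<forall>i. emeasure (lamH y) (B i) = ?J i y" using J by (simp add: AE_all_countable)
      then show "AE y in \<nu>. (\<Sum>i. ?J i y) = emeasure (lamH y) (\<Union>i. B i)"
      proof eventually_elim
        case (elim y)
        then have "(\<Sum>i. ?J i y) = (\<Sum>i. emeasure (lamH y) (B i))" by simp
        also have "\<dots> = emeasure (lamH y) (\<Union>i. B i)" using B by (intro suminf_emeasure) (auto simp: sets_lift)
        finally show ?case .
      qed
    qed
    finally show "(\<Sum>i. \<integral>\<^sup>+ y. emeasure (lamH y) (B i) \<partial>\<nu>) = (\<integral>\<^sup>+ y. emeasure (lamH y) (\<Union>i. B i) \<partial>\<nu>)" .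
  qed
  show "A \<in> sets (arrs H)" by fact
qed

lemma pred_pull_path:
  assumes "Measurable.pred (arrs H) P"
  shows "Measurable.pred (PS \<Otimes>\<^sub>M arrs G) (\<lambda>p. pull True P (bnd (fst p)) (snd p))"
proof -
  have "(\<lambda>p. (bnd (fst p), snd p)) \<in> measurable (PS \<Otimes>\<^sub>M arrs G) (pts X \<Otimes>\<^sub>M arrs G)" by measurable
  from measurable_compose[OF this pred_pull[OF assms]] show ?thesis by simp
qed

text \<open>Null sets of \<open>H\<close>, described on the path space, where the nonsingularity theorem applies.\<close>

lemma null_sets_MH:
  assumes A: "A \<in> sets (arrs H)"
  shows "A \<in> null_sets MH \<longleftrightarrow> (AE \<omega> in Q. AE g in \<kappa> (tgt G (\<omega> 0)). pull True (\<lambda>z. z \<notin> A) (bnd \<omega>) g)"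
proof -
  have P: "Measurable.pred (arrs H) (\<lambda>z. z \<notin> A)" using A by measurable
  let ?J = "\<lambda>y. \<integral>\<^sup>+g. d g * pull 0 (indicator A) y g \<partial>\<kappa> (proj X y)"
  have J: "AE y in \<nu>. emeasure (lamH y) A = ?J y"
    using AE_nu_good AE_space by eventually_elim (use A in \<open>auto simp: nu_space intro!: emeasure_lift\<close>)
  have Jm: "?J \<in> borel_measurable \<nu>"
  proof -
    have p: "(\<lambda>p. pull 0 (indicator A :: _ \<Rightarrow> ennreal) (fst p) (snd p)) \<in> borel_measurable (pts X \<Otimes>\<^sub>M arrs G)"
      using A by (intro measurable_pull) auto
    have "(\<lambda>p. d (snd p) * pull 0 (indicator A) (fst p) (snd p)) \<in> borel_measurable (pts X \<Otimes>\<^sub>M arrs G)"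
      using p by measurable
    then have "?J \<in> borel_measurable (pts X)"
      by (intro nn_integral_measurable_subprob_algebra2[OF _ kappa_proj]) (simp add: split_beta')
    then show ?thesis by (simp add: measurable_cong_sets[OF nu_sets refl])
  qed
  have "A \<in> null_sets MH \<longleftrightarrow> (\<integral>\<^sup>+y. ?J y \<partial>\<nu>) = 0"
    using A nn_integral_cong_AE[OF J] by (simp add: null_sets_def sets_MH emeasure_MH)
  also have "\<dots> \<longleftrightarrow> (AE y in \<nu>. ?J y = 0)" by (rule nn_integral_0_iff_AE[OF Jm])
  also have "\<dots> \<longleftrightarrow> (AE y in \<nu>. AE g in \<kappa> (proj X y). pull True (\<lambda>z. z \<notin> A) y g)"
  proof (rule AE_iff_AE)
    show "AE y in \<nu>. ?J y = 0 \<longleftrightarrow> (AE g in \<kappa> (proj X y). pull True (\<lambda>z. z \<notin> A) y g)"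
      using AE_nu_good AE_space
    proof eventually_elim
      case (elim y)
      then have y: "y \<in> space (pts X)" "proj X y \<in> U" by (auto simp: nu_space)
      show ?case using null_lift[OF y A] emeasure_lift[OF y A] by simp
    qed
  qed
  also have "\<dots> \<longleftrightarrow> (AE \<omega> in Q. AE g in \<kappa> (proj X (bnd \<omega>)). pull True (\<lambda>z. z \<notin> A) (bnd \<omega>) g)"
    by (rule nu_AE[OF pred_AE_kernel[OF kappa_proj pred_pull[OF P]]])
  also have "\<dots> \<longleftrightarrow> (AE \<omega> in Q. AE g in \<kappa> (tgt G (\<omega> 0)). pull True (\<lambda>z. z \<notin> A) (bnd \<omega>) g)"
  proof (rule AE_iff_AE)
    show "AE \<omega> in Q. (AE g in \<kappa> (proj X (bnd \<omega>)). pull True (\<lambda>z. z \<notin> A) (bnd \<omega>) g) \<longleftrightarrow>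
        (AE g in \<kappa> (tgt G (\<omega> 0)). pull True (\<lambda>z. z \<notin> A) (bnd \<omega>) g)"
      using AE_proj_bnd by eventually_elim (simp only:)
  qed
  finally show ?thesis .
qed

lemma AE_MH:
  assumes "AE z in MH. P z"
  shows "AE \<omega> in Q. AE g in \<kappa> (tgt G (\<omega> 0)). pull True P (bnd \<omega>) g"
proof -
  obtain N where N: "{z\<in>space MH. \<not> P z} \<subseteq> N" "N \<in> null_sets MH" using assms by (auto simp: eventually_ae_filter)
  then have "N \<in> sets (arrs H)" using sets_MH by auto
  from null_sets_MH[OF this] N(2) have "AE \<omega> in Q. AE g in \<kappa> (tgt G (\<omega> 0)). pull True (\<lambda>z. z \<notin> N) (bnd \<omega>) g" by simp
  then show ?thesis
  proof eventually_elim
    case (elim \<omega>)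
    then show ?case
      by eventually_elim (use N(1) emb_SA in \<open>auto simp: pull_def space_MH space_semidirect split: if_splits\<close>)
  qed
qed

text \<open>The properties of a typical path and a typical arrow over it that allow \<open>g\<^sup>-\<^sup>1\<close> to act on the
  boundary point through the totalized operations.\<close>

lemma AE_inverse_good:
  "AE \<omega> in Q. bnd \<omega> \<in> space (pts X) \<and> bnd \<omega> \<in> Y0 \<and> proj X (bnd \<omega>) = tgt G (\<omega> 0) \<and> tgt G (\<omega> 0) \<in> U \<and>
    (AE g in \<kappa> (tgt G (\<omega> 0)). (bnd \<omega>, g) \<in> D \<and> src G g \<in> U \<and> bnd (\<tau> (ginv G g) \<omega>) = tact (ginv G g) (bnd \<omega>))"
proof -
  have s: "AE \<omega> in Q. AE g in \<kappa> (tgt G (\<omega> 0)). src G g \<in> U"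
    by (subst AE_swap[where R="\<lambda>g _. src G g \<in> U"]) (measurable, use base_AE_src[OF AE_mu_U] in \<open>auto elim!: eventually_mono\<close>)
  show ?thesis
    using AE_good_path AE_proj_bnd AE_bnd_Y0 AE_bnd_translate s
  proof eventually_elim
    case (elim \<omega>)
    then have y: "bnd \<omega> \<in> space (pts X)" "proj X (bnd \<omega>) \<in> U" using measurable_space[OF bnd] by auto
    have "AE g in \<kappa> (tgt G (\<omega> 0)). (bnd \<omega>, g) \<in> D"
      using AE_kappa_D[OF y] by (simp only: elim(2))
    then have "AE g in \<kappa> (tgt G (\<omega> 0)). (bnd \<omega>, g) \<in> D \<and> src G g \<in> U \<and> bnd (\<tau> (ginv G g) \<omega>) = tact (ginv G g) (bnd \<omega>)"
      using elim(4,5) by eventually_elim auto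
    then show ?case using elim y by auto
  qed
qed

lemma D_inverse:
  assumes "(y, g) \<in> D" "src G g \<in> U"
  shows "tact (ginv G g) y \<in> space (pts X)" "proj X (tact (ginv G g) y) = src G g" "(tact (ginv G g) y, ginv G g) \<in> D"
    "emb (tact (ginv G g) y) (ginv G g) = ginv H (emb y g)"
proof -
  have y: "y \<in> space (pts X)" "g \<in> space (arrs G)" "proj X y = tgt G g" "proj X y \<in> U" using assms by (auto simp: D_def)
  note tact = tact_D[OF assms(1)]
  show 1: "tact (ginv G g) y \<in> space (pts X)" unfolding tact using y by (intro act_in) (auto simp: inv_in src_inv)
  show 2: "proj X (tact (ginv G g) y) = src G g" unfolding tact using y by (subst proj_act) (auto simp: actable_def inv_in src_inv tgt_inv)
  show 3: "(tact (ginv G g) y, ginv G g) \<in> D" using 1 2 y assms(2) by (auto simp: D_def inv_in tgt_inv)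
  have "tact g (tact (ginv G g) y) = act X g (act X (ginv G g) y)"
    using 2 assms(2) unfolding tact_def[of g] by (simp add: tact)
  then have "tact g (tact (ginv G g) y) = y" using act_inverse'[OF y(2,1) y(3)[symmetric]] by simp
  then show "emb (tact (ginv G g) y) (ginv G g) = ginv H (emb y g)"
    using y by (simp add: emb_def semidirect_sel inv_inv)
qed

text \<open>Inversion of \<open>H\<close> is \<open>(g, \<omega>) \<mapsto> (g\<^sup>-\<^sup>1, g\<^sup>-\<^sup>1 \<omega>)\<close> seen on the boundary.\<close>

lemma AE_pull_inverse:
  assumes P: "Measurable.pred (arrs H) P" and ae: "AE \<omega> in Q. AE g in \<kappa> (tgt G (\<omega> 0)). pull True P (bnd \<omega>) g"
  shows "AE \<omega> in Q. AE g in \<kappa> (tgt G (\<omega> 0)). pull True (\<lambda>z. P (ginv H z)) (bnd \<omega>) g"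
proof -
  have "Measurable.pred (arrs G \<Otimes>\<^sub>M PS) (\<lambda>p. pull True P (bnd (snd p)) (fst p))"
    using measurable_compose[OF measurable_Pair[OF measurable_snd measurable_fst] pred_pull_path[OF P]] by simp
  from AE_inverse_translate[OF this ae] AE_inverse_good show ?thesis
  proof eventually_elim
    case (elim \<omega>)
    then have "AE g in \<kappa> (tgt G (\<omega> 0)). (bnd \<omega>, g) \<in> D \<and> src G g \<in> U \<and> bnd (\<tau> (ginv G g) \<omega>) = tact (ginv G g) (bnd \<omega>)" by blast
    with elim(1) show ?case
      by eventually_elim (auto simp: pull_def D_inverse)
  qed
qed

lemma quasi_invariant_H: "quasi_invariant H lamH \<nu>"
proof -
  interpret H: borel_groupoid H by (rule semidirect_borel_groupoid)
  have im: "ginv H \<in> measurable MH (arrs H)" using H.measurable_inv by (simp add: measurable_cong_sets[OF sets_MH refl])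
  have *: "ginv H -` A \<inter> space (arrs H) \<in> null_sets MH" if A: "A \<in> null_sets MH" for A
  proof -
    have As: "A \<in> sets (arrs H)" using A sets_MH by auto
    have iA: "ginv H -` A \<inter> space (arrs H) \<in> sets (arrs H)" by (rule measurable_sets[OF H.measurable_inv As])
    have "AE \<omega> in Q. AE g in \<kappa> (tgt G (\<omega> 0)). pull True (\<lambda>z. z \<notin> A) (bnd \<omega>) g" using A null_sets_MH[OF As] by simp
    then have "AE \<omega> in Q. AE g in \<kappa> (tgt G (\<omega> 0)). pull True (\<lambda>z. ginv H z \<notin> A) (bnd \<omega>) g"
      by (rule AE_pull_inverse[rotated]) (use As in measurable)
    then have "AE \<omega> in Q. AE g in \<kappa> (tgt G (\<omega> 0)). pull True (\<lambda>z. z \<notin> ginv H -` A \<inter> space (arrs H)) (bnd \<omega>) g"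
      by (auto elim!: eventually_mono simp: pull_def)
    then show ?thesis using null_sets_MH[OF iA] by simp
  qed
  show ?thesis
    unfolding quasi_invariant_def mutually_ac_def absolutely_continuous_def
  proof (intro conjI subsetI)
    fix A assume A: "A \<in> null_sets MH"
    then show "A \<in> null_sets (distr MH (arrs H) (ginv H))"
      using *[OF A] sets_MH by (subst null_sets_distr_iff[OF im]) (auto simp: space_MH)
  next
    fix A assume "A \<in> null_sets (distr MH (arrs H) (ginv H))"
    then have A: "ginv H -` A \<inter> space (arrs H) \<in> null_sets MH" "A \<in> sets (arrs H)"
      by (auto simp: null_sets_distr_iff[OF im] space_MH)
    have "ginv H -` (ginv H -` A \<inter> space (arrs H)) \<inter> space (arrs H) = A"
    proof (intro set_eqI iffI)
      fix z assume "z \<in> A"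
      moreover have "z \<in> space (arrs H)" using sets.sets_into_space[OF A(2)] \<open>z \<in> A\<close> by blast
      ultimately show "z \<in> ginv H -` (ginv H -` A \<inter> space (arrs H)) \<inter> space (arrs H)"
        by (simp add: H.inv_in H.inv_inv)
    next
      fix z assume "z \<in> ginv H -` (ginv H -` A \<inter> space (arrs H)) \<inter> space (arrs H)"
      then show "z \<in> A" using H.inv_inv[of z] by simp
    qed
    then show "A \<in> null_sets MH" using *[OF A(1)] by simp
  qed
qed

lemma jmeas_pull: "f \<in> borel_measurable (arrs H) \<Longrightarrow> jmeas (pull 0 f)" for f :: "_ \<Rightarrow> real"
  by (rule measurable_pull) auto

lemma AE_D: "AE \<omega> in Q. AE g in \<kappa> (tgt G (\<omega> 0)). (bnd \<omega>, g) \<in> D"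
  using AE_inverse_good
proof eventually_elim
  case (elim \<omega>)
  then have "AE g in \<kappa> (tgt G (\<omega> 0)). (bnd \<omega>, g) \<in> D \<and> src G g \<in> U \<and> bnd (\<tau> (ginv G g) \<omega>) = tact (ginv G g) (bnd \<omega>)" by blast
  then show ?case by eventually_elim simp
qed

lemma Linf_MH:
  assumes "f \<in> Linf MH"
  obtains C where "f \<in> borel_measurable (arrs H)" "jmeas (pull 0 f)" "ess_bdd (pull 0 f) C" "AE z in MH. \<bar>f z\<bar> \<le> C"
proof -
  obtain C where f: "f \<in> borel_measurable MH" "AE z in MH. \<bar>f z\<bar> \<le> C" using assms by (auto simp: Linf_def)
  have fH: "f \<in> borel_measurable (arrs H)" using f(1) by (simp add: measurable_cong_sets[OF sets_MH refl])
  have C: "AE z in MH. \<bar>f z\<bar> \<le> \<bar>C\<bar>" using f(2) by eventually_elim auto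
  have "ess_bdd (pull 0 f) \<bar>C\<bar>"
    unfolding ess_bdd_def using AE_MH[OF C]
    by (auto elim!: eventually_mono simp: pull_def split: if_splits)
  then show ?thesis using that[OF fH jmeas_pull[OF fH] _ C] by blast
qed

text \<open>The choice is harmless: limits are unique up to null sets.\<close>

definition Mean :: "('y \<times> 'g \<times> 'y \<Rightarrow> real) \<Rightarrow> 'y \<Rightarrow> real" where
  "Mean f = (SOME \<Phi>. mean_lim (pull 0 f) \<Phi>)"

lemma mean_lim_Mean: "f \<in> Linf MH \<Longrightarrow> mean_lim (pull 0 f) (Mean f)"
proof -
  assume "f \<in> Linf MH"
  then obtain C where "jmeas (pull 0 f)" "ess_bdd (pull 0 f) C" using Linf_MH by metis
  from mean_lim_exists[OF this] show ?thesis unfolding Mean_def by (rule someI_ex)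
qed

lemma Mean_measurable: "f \<in> Linf MH \<Longrightarrow> Mean f \<in> borel_measurable (pts X)"
  using mean_lim_Mean by (simp add: mean_lim_def)

lemma Mean_bounded: "f \<in> Linf MH \<Longrightarrow> \<exists>C. \<forall>y. \<bar>Mean f y\<bar> \<le> C"
  using mean_lim_Mean unfolding mean_lim_def by blast

lemma mean_lim_AE_nu:
  assumes "mean_lim F \<Phi>" "mean_lim F \<Phi>'" shows "AE y in \<nu>. \<Phi> y = \<Phi>' y"
proof (subst nu_AE)
  have "\<Phi> \<in> borel_measurable (pts X)" "\<Phi>' \<in> borel_measurable (pts X)" using assms by (auto simp: mean_lim_def)
  then show "Measurable.pred (pts X) (\<lambda>y. \<Phi> y = \<Phi>' y)" by measurable
qed (rule mean_lim_unique[OF assms])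

lemma Linf_lincomb:
  assumes "f \<in> Linf MH" "f' \<in> Linf MH" shows "(\<lambda>g. a * f g + b * f' g) \<in> Linf MH"
proof -
  obtain C C' where C: "AE z in MH. \<bar>f z\<bar> \<le> C" "AE z in MH. \<bar>f' z\<bar> \<le> C'"
    using assms by (auto simp: Linf_def)
  have "AE z in MH. \<bar>a * f z + b * f' z\<bar> \<le> \<bar>a\<bar> * C + \<bar>b\<bar> * C'"
    using C
  proof eventually_elim
    case (elim z)
    have "\<bar>a * f z + b * f' z\<bar> \<le> \<bar>a * f z\<bar> + \<bar>b * f' z\<bar>" by (rule abs_triangle_ineq)
    also have "\<dots> \<le> \<bar>a\<bar> * C + \<bar>b\<bar> * C'"
      using elim unfolding abs_mult by (intro add_mono mult_left_mono) auto
    finally show ?case .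
  qed
  moreover have "(\<lambda>g. a * f g + b * f' g) \<in> borel_measurable MH"
    using assms by (intro borel_measurable_add borel_measurable_times borel_measurable_const) (auto simp: Linf_def)
  ultimately show ?thesis unfolding Linf_def by blast
qed

lemma Linf_one: "(\<lambda>_. 1) \<in> Linf MH"
  by (auto simp: Linf_def intro!: exI[of _ 1])

context
  fixes \<theta> :: "'y \<Rightarrow> ('y \<times> 'g \<times> 'y) measure"
  assumes \<theta>: "ac_system H lamH \<theta>"
begin

lemma theta_sets: "y \<in> space (pts X) \<Longrightarrow> sets (\<theta> y) = sets (arrs H)"
  and theta_finite: "y \<in> space (pts X) \<Longrightarrow> finite_measure (\<theta> y)"
  and theta_ac: "y \<in> space (pts X) \<Longrightarrow> absolutely_continuous (lamH y) (\<theta> y)"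
  and theta_measurable: "A \<in> sets (arrs H) \<Longrightarrow> (\<lambda>y. emeasure (\<theta> y) A) \<in> borel_measurable (pts X)"
  using \<theta> by (auto simp: ac_system_def semidirect_sel)

lemma theta_space: "y \<in> space (pts X) \<Longrightarrow> space (\<theta> y) = space (arrs H)"
  using theta_sets by (rule sets_eq_imp_space_eq)

text \<open>The masses of the measures \<open>\<theta>\<^sup>y\<close> may be unbounded.  Division by \<open>1 + |\<theta>\<^sup>y|\<close> gives a subprobability
  kernel; the factor depends on the boundary point only and can be cancelled at the end.\<close>

definition weight :: "'y \<Rightarrow> real" where "weight y = 1 / (1 + measure (\<theta> y) (space (arrs H)))"

definition Theta :: "'y \<Rightarrow> 'g measure" where
  "Theta y = density (distr (\<theta> y) (arrs G) (\<lambda>z. fst (snd z))) (\<lambda>_. ennreal (weight y))"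

lemma weight_bounds: "0 < weight y" "weight y \<le> 1"
  by (auto simp: weight_def add_pos_nonneg)

lemma mid_measurable: "y \<in> space (pts X) \<Longrightarrow> (\<lambda>z. fst (snd z)) \<in> measurable (\<theta> y) (arrs G)"
  using measurable_SA_mid by (simp add: measurable_cong_sets[OF theta_sets refl])

lemma emeasure_Theta:
  assumes y: "y \<in> space (pts X)" and A: "A \<in> sets (arrs G)"
  shows "emeasure (Theta y) A = ennreal (weight y) * emeasure (\<theta> y) ((\<lambda>z. fst (snd z)) -` A \<inter> space (arrs H))"
  unfolding Theta_def using A
  by (simp add: emeasure_density nn_integral_cmult emeasure_distr[OF mid_measurable[OF y]] theta_space[OF y])

lemma measurable_weight: "weight \<in> borel_measurable (pts X)"
proof -
  have [measurable]: "(\<lambda>y. emeasure (\<theta> y) (space (arrs H))) \<in> borel_measurable (pts X)"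
    by (rule theta_measurable) auto
  show ?thesis unfolding weight_def[abs_def] measure_def by measurable
qed

lemma measurable_Theta: "Theta \<in> measurable (pts X) (subprob_algebra (arrs G))"
proof (rule measurable_subprob_algebra)
  fix y assume y: "y \<in> space (pts X)"
  interpret finite_measure "\<theta> y" by (rule theta_finite[OF y])
  show "sets (Theta y) = sets (arrs G)" by (simp add: Theta_def)
  have spT: "space (Theta y) = space (arrs G)" by (simp add: Theta_def)
  have "emeasure (Theta y) (space (Theta y)) = ennreal (weight y) * emeasure (\<theta> y) ((\<lambda>z. fst (snd z)) -` space (arrs G) \<inter> space (arrs H))"
    unfolding spT by (rule emeasure_Theta[OF y]) auto
  also have "(\<lambda>z. fst (snd z)) -` space (arrs G) \<inter> space (arrs H) = space (arrs H)"
    using measurable_space[OF measurable_SA_mid] by auto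
  also have "ennreal (weight y) * emeasure (\<theta> y) (space (arrs H)) = ennreal (weight y * measure (\<theta> y) (space (arrs H)))"
    using weight_bounds[of y] by (simp add: emeasure_eq_measure ennreal_mult)
  also have "\<dots> \<le> 1"
    by (simp add: weight_def divide_le_eq add_pos_nonneg)
  finally show "subprob_space (Theta y)"
  proof (rule subprob_spaceI)
    have "proj X y \<in> space (objs G)" using measurable_space[OF measurable_proj y] .
    then show "space (Theta y) \<noteq> {}" using unit_in unfolding spT by blast
  qed
next
  fix A assume A[measurable]: "A \<in> sets (arrs G)"
  have "(\<lambda>y. emeasure (\<theta> y) ((\<lambda>z. fst (snd z)) -` A \<inter> space (arrs H))) \<in> borel_measurable (pts X)"
    by (rule theta_measurable[OF measurable_sets[OF measurable_SA_mid A]])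
  then have "(\<lambda>y. ennreal (weight y) * emeasure (\<theta> y) ((\<lambda>z. fst (snd z)) -` A \<inter> space (arrs H))) \<in> borel_measurable (pts X)"
    using measurable_weight by measurable
  then show "(\<lambda>y. emeasure (Theta y) A) \<in> borel_measurable (pts X)"
    by (rule measurable_cong[THEN iffD1, rotated]) (simp add: emeasure_Theta A)
qed

lemma AE_Theta:
  assumes y: "y \<in> space (pts X)" "proj X y \<in> U" and ae: "AE h in \<kappa> (proj X y). P h"
  shows "AE h in Theta y. P h"
proof -
  note xo = U_objs[OF y(2)]
  obtain N where N: "{h\<in>space (\<kappa> (proj X y)). \<not> P h} \<subseteq> N" "N \<in> null_sets (\<kappa> (proj X y))"
    using ae by (auto simp: eventually_ae_filter)
  have Ns: "N \<in> sets (arrs G)" using N(2) kappa_sets[OF xo] by auto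
  let ?A = "(\<lambda>z. fst (snd z)) -` N \<inter> space (arrs H)"
  have A: "?A \<in> sets (arrs H)" by (rule measurable_sets[OF measurable_SA_mid Ns])
  have "AE g in \<kappa> (proj X y). pull True (\<lambda>z. z \<notin> ?A) y g"
    using AE_not_in[OF N(2)] by eventually_elim (auto simp: pull_def emb_def)
  then have "?A \<in> null_sets (lamH y)" using null_lift[OF y A] A by (auto simp: null_sets_def sets_lift)
  then have "emeasure (\<theta> y) ?A = 0" using theta_ac[OF y(1)] by (auto simp: absolutely_continuous_def)
  then have "N \<in> null_sets (Theta y)" using emeasure_Theta[OF y(1) Ns] Ns by (auto simp: null_sets_def Theta_def)
  then show ?thesis
    by (rule AE_I') (use N(1) kappa_space[OF xo] in \<open>auto simp: Theta_def\<close>)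
qed

lemma singleton_Y0: "y \<in> Y0 \<Longrightarrow> {z\<in>space (arrs H). fst z = y} \<in> sets (arrs H)"
proof -
  assume y: "y \<in> Y0"
  have "(\<lambda>_. y) \<in> measurable (arrs H) (pts X)" using y by (simp add: Y0_pts)
  from pred_eq_Y0[OF this measurable_SA_fst] have "{z\<in>space (arrs H). y \<in> Y0 \<and> y = fst z} \<in> sets (arrs H)" by (simp add: pred_def)
  also have "{z\<in>space (arrs H). y \<in> Y0 \<and> y = fst z} = {z\<in>space (arrs H). fst z = y}" using y by auto
  finally show ?thesis .
qed

text \<open>Singletons of points of \<open>Y0\<close> are measurable, so absolute continuity forces \<open>\<theta>\<^sup>y\<close> to live on the
  fibre over \<open>y\<close>.\<close>

lemma AE_theta_fibre:
  assumes y: "y \<in> Y0" "proj X y \<in> U"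
  shows "AE z in \<theta> y. (y, fst (snd z)) \<in> D \<and> z = emb y (fst (snd z))"
proof -
  have yp: "y \<in> space (pts X)" using y by (simp add: Y0_pts)
  let ?A = "space (arrs H) - {z\<in>space (arrs H). fst z = y}"
  have A: "?A \<in> sets (arrs H)" using singleton_Y0[OF y(1)] by auto
  have "AE g in \<kappa> (proj X y). pull True (\<lambda>z. z \<notin> ?A) y g"
    by (auto intro!: AE_I2 simp: pull_def emb_def)
  then have "?A \<in> null_sets (lamH y)" using null_lift[OF yp y(2) A] A by (auto simp: null_sets_def sets_lift)
  then have "?A \<in> null_sets (\<theta> y)" using theta_ac[OF yp] by (auto simp: absolutely_continuous_def)
  then have "AE z in \<theta> y. z \<notin> ?A" by (rule AE_not_in)
  then show ?thesis using AE_space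
  proof eventually_elim
    case (elim z)
    then have z: "z \<in> SA" "fst z = y" by (auto simp: theta_space[OF yp] space_semidirect)
    obtain g x where zz: "z = (y, g, x)" using z(2) by (metis prod.collapse)
    have zS: "g \<in> space (arrs G)" "x \<in> space (pts X)" "src G g = proj X x" "y = act X g x"
      using z(1) unfolding zz by (auto simp: SA_def)
    have "proj X y = tgt G g" unfolding zS(4) by (rule proj_act'[OF zS(1-3)])
    then have d: "(y, g) \<in> D" using y yp zS by (auto simp: D_def)
    have "tact (ginv G g) y = x" unfolding tact_D[OF d] unfolding zS(4) by (rule act_inverse[OF zS(1-3)])
    then show ?case using d by (simp add: zz emb_def)
  qed
qed

lemma integral_Theta:
  fixes f :: "'g \<Rightarrow> real"
  assumes y: "y \<in> space (pts X)" and f: "f \<in> borel_measurable (arrs G)"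
  shows "(\<integral>h. f h \<partial>Theta y) = weight y * (\<integral>z. f (fst (snd z)) \<partial>\<theta> y)"
proof -
  have "(\<integral>h. f h \<partial>Theta y) = (\<integral>h. weight y *\<^sub>R f h \<partial>distr (\<theta> y) (arrs G) (\<lambda>z. fst (snd z)))"
    unfolding Theta_def using f weight_bounds[of y] by (intro integral_density) auto
  also have "\<dots> = weight y * (\<integral>z. f (fst (snd z)) \<partial>\<theta> y)"
    using f by (simp add: integral_distr[OF mid_measurable[OF y]])
  finally show ?thesis .
qed

lemma conv_objs_eq:
  assumes \<Phi>: "\<Phi> \<in> borel_measurable (pts X)" and y: "y \<in> Y0" "proj X y \<in> U"
  shows "weight y * conv_objs H \<theta> \<Phi> y = (\<integral>h. \<Phi> (tact (ginv G h) y) \<partial>Theta y)"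
proof -
  have yp: "y \<in> space (pts X)" using y by (simp add: Y0_pts)
  have "(\<lambda>_. y) \<in> measurable (arrs G) (pts X)" using yp by simp
  then have tact: "(\<lambda>h. tact (ginv G h) y) \<in> measurable (arrs G) (pts X)" by (intro measurable_tact measurable_inv)
  have f: "(\<lambda>h. \<Phi> (tact (ginv G h) y)) \<in> borel_measurable (arrs G)" by (rule measurable_compose[OF tact \<Phi>])
  have "conv_objs H \<theta> \<Phi> y = (\<integral>z. \<Phi> (tact (ginv G (fst (snd z))) y) \<partial>\<theta> y)"
    unfolding conv_objs_def
  proof (rule integral_completion_AE)
    show "(\<lambda>z. \<Phi> (tact (ginv G (fst (snd z))) y)) \<in> borel_measurable (\<theta> y)"
      by (rule measurable_compose[OF mid_measurable[OF yp] f])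
    show "AE z in \<theta> y. \<Phi> (src H z) = \<Phi> (tact (ginv G (fst (snd z))) y)"
      using AE_theta_fibre[OF y]
    proof eventually_elim
      case (elim z)
      then have "snd (snd z) = tact (ginv G (fst (snd z))) y" by (metis emb_def snd_conv)
      then show ?case by (simp add: semidirect_sel)
    qed
  qed
  then show ?thesis by (simp add: integral_Theta[OF yp f])
qed

text \<open>In the coordinates \<open>(y, k)\<close> left multiplication by \<open>(y, h, h\<^sup>-\<^sup>1 y)\<^sup>-\<^sup>1\<close> is \<open>(y, k) \<mapsto> (h\<^sup>-\<^sup>1 y, h\<^sup>-\<^sup>1 k)\<close>.\<close>

lemma conv_arrs_eq:
  assumes f: "f \<in> borel_measurable (arrs H)" and y: "y \<in> Y0" "proj X y \<in> U" and k: "(y, k) \<in> D"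
    and s: "AE h in Theta y. src G h \<in> U"
  shows "weight y * conv_arrs H \<theta> f (emb y k) = (\<integral>h. pull 0 f (tact (ginv G h) y) (tmult (ginv G h) k) \<partial>Theta y)"
proof -
  have yp: "y \<in> space (pts X)" using y by (simp add: Y0_pts)
  have kp: "k \<in> space (arrs G)" "tgt G k = proj X y" using k by (auto simp: D_def)
  let ?f = "\<lambda>h. pull 0 f (tact (ginv G h) y) (tmult (ginv G h) k)"
  have c: "(\<lambda>_. y) \<in> measurable (arrs G) (pts X)" "(\<lambda>_. k) \<in> measurable (arrs G) (arrs G)" using yp kp by simp_all
  have fm: "?f \<in> borel_measurable (arrs G)"
    by (rule jmeas_measurable[OF jmeas_pull[OF f]]) (intro measurable_tact measurable_tmult measurable_inv c)+
  have s': "AE z in \<theta> y. src G (fst (snd z)) \<in> U"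
  proof -
    have "{h\<in>space (arrs G). \<not> src G h \<in> U} \<in> null_sets (Theta y)"
      using s by (subst AE_iff_null_sets) (auto simp: Theta_def)
    then have "emeasure (Theta y) {h\<in>space (arrs G). \<not> src G h \<in> U} = 0" by auto
    then have "emeasure (\<theta> y) ((\<lambda>z. fst (snd z)) -` {h\<in>space (arrs G). \<not> src G h \<in> U} \<inter> space (arrs H)) = 0"
      using weight_bounds[of y] by (subst (asm) emeasure_Theta[OF yp]) (auto simp: ennreal_eq_0_iff)
    moreover have "(\<lambda>z. fst (snd z)) -` {h\<in>space (arrs G). \<not> src G h \<in> U} \<inter> space (arrs H) \<in> sets (\<theta> y)"
      unfolding theta_sets[OF yp] by (rule measurable_sets[OF measurable_SA_mid]) measurable
    ultimately show ?thesis
      by (intro AE_I[where N="(\<lambda>z. fst (snd z)) -` {h\<in>space (arrs G). \<not> src G h \<in> U} \<inter> space (arrs H)"])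
         (use measurable_space[OF measurable_SA_mid] in \<open>auto simp: theta_space[OF yp]\<close>)
  qed
  have "conv_arrs H \<theta> f (emb y k) = (\<integral>z. ?f (fst (snd z)) \<partial>\<theta> y)"
    unfolding conv_arrs_def semidirect_sel(3)
  proof -
    have e: "fst (emb y k) = y" by (simp add: emb_def)
    show "(\<integral>z. f (gmult H (ginv H z) (emb y k)) \<partial>completion (\<theta> (fst (emb y k)))) = (\<integral>z. ?f (fst (snd z)) \<partial>\<theta> y)"
      unfolding e
    proof (rule integral_completion_AE)
      show "(\<lambda>z. ?f (fst (snd z))) \<in> borel_measurable (\<theta> y)"
        by (rule measurable_compose[OF mid_measurable[OF yp] fm])
      show "AE z in \<theta> y. f (gmult H (ginv H z) (emb y k)) = ?f (fst (snd z))"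
        using AE_theta_fibre[OF y] s'
      proof eventually_elim
        case (elim z)
        define h where "h = fst (snd z)"
        have h: "(y, h) \<in> D" "z = emb y h" "src G h \<in> U" using elim by (auto simp: h_def)
        then have hp: "h \<in> space (arrs G)" "proj X y = tgt G h" "tgt G h \<in> U" by (auto simp: D_def)
        have hk: "tmult (ginv G h) k = gmult G (ginv G h) k" using hp kp by (simp add: tmult_def src_inv)
        have comp: "(ginv G h, k) \<in> composable G" using hp kp by (simp add: composable_def src_inv inv_in)
        have thk: "tgt G (gmult G (ginv G h) k) = src G h" "src G (gmult G (ginv G h) k) = src G k"
          using comp hp by (simp_all add: tgt_mult src_mult tgt_inv)
        have Dh: "(tact (ginv G h) y, tmult (ginv G h) k) \<in> D"
          unfolding hk using D_inverse[OF h(1,3)] thk h(3) comp by (auto simp: D_def mult_in)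
        have inverse_mult: "gmult G h (gmult G (ginv G h) k) = k"
        proof -
          have "gmult G h (gmult G (ginv G h) k) = gmult G (gmult G h (ginv G h)) k"
            using hp comp by (intro mult_assoc[symmetric]) (auto simp: composable_def tgt_inv inv_in)
          then show ?thesis using hp kp unit_left[of k] by (simp add: inv_right)
        qed
        have "tact (ginv G (tmult (ginv G h) k)) (tact (ginv G h) y) = tact (ginv G k) y"
        proof -
          let ?x = "act X (ginv G k) y"
          have xp: "?x \<in> space (pts X)" "proj X ?x = src G k" "act X k ?x = y"
            using kp yp by (auto simp: act_in inv_in src_inv tgt_inv proj_act' act_inverse')
          have "act X (ginv G h) y = act X (ginv G h) (act X k ?x)" using xp by simp
          also have "\<dots> = act X (gmult G (ginv G h) k) ?x" using comp kp xp by (intro act_act') auto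
          finally have "act X (ginv G (gmult G (ginv G h) k)) (act X (ginv G h) y) = ?x"
            using xp thk mult_in[OF comp] by (simp add: act_inverse)
          then show ?thesis
            using tact_D[OF Dh] tact_D[OF h(1)] tact_D[OF k] by (simp add: hk)
        qed
        then have "emb (tact (ginv G h) y) (tmult (ginv G h) k) = gmult H (ginv H z) (emb y k)"
          unfolding h(2) by (simp add: emb_def semidirect_sel hk)
        then show ?case using Dh by (simp add: pull_def h_def[symmetric])
      qed
    qed
  qed
  then show ?thesis by (simp add: integral_Theta[OF yp fm])
qed

text \<open>An essential bound for \<open>f\<close> survives translation by almost every \<open>h\<close>; hence \<open>f\<close> may be truncated
  inside the convolution.\<close>

lemma AE_clip_translate:
  assumes f: "f \<in> borel_measurable (arrs H)" and b: "ess_bdd (pull 0 f) C"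
  shows "AE \<omega> in Q. AE k in \<kappa> (tgt G (\<omega> 0)). AE h in Theta (bnd \<omega>).
    pull 0 f (tact (ginv G h) (bnd \<omega>)) (tmult (ginv G h) k) = clip C (pull 0 f (tact (ginv G h) (bnd \<omega>)) (tmult (ginv G h) k))"
proof -
  let ?E = "\<lambda>y k. \<bar>pull 0 f y k\<bar> \<le> C"
  have mf: "jmeas (pull 0 f)" by (rule jmeas_pull[OF f])
  have R: "Measurable.pred (arrs G \<Otimes>\<^sub>M PS) (\<lambda>p. AE k in \<kappa> (tgt G (snd p 0)). ?E (bnd (snd p)) k)"
  proof (rule pred_AE_kernel[where K="\<lambda>p. \<kappa> (tgt G (snd p 0))" and P="\<lambda>p k. ?E (bnd (snd p)) k"])
    show "(\<lambda>p. \<kappa> (tgt G (snd p 0))) \<in> measurable (arrs G \<Otimes>\<^sub>M PS) (subprob_algebra (arrs G))" by measurable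
    have b: "(\<lambda>q. bnd (snd (fst q))) \<in> measurable ((arrs G \<Otimes>\<^sub>M PS) \<Otimes>\<^sub>M arrs G) (pts X)" by measurable
    show "Measurable.pred ((arrs G \<Otimes>\<^sub>M PS) \<Otimes>\<^sub>M arrs G) (\<lambda>q. ?E (bnd (snd (fst q))) (snd q))"
      using jmeas_measurable[OF mf b measurable_snd] by simp
  qed
  have "AE \<omega> in Q. AE g in \<kappa> (tgt G (\<omega> 0)). AE k in \<kappa> (tgt G (\<omega> 0)). ?E (bnd \<omega>) k"
    using b[unfolded ess_bdd_def, THEN conjunct2]
  proof eventually_elim
    case (elim \<omega>)
    show ?case by (rule always_eventually, rule allI, rule elim)
  qed
  from AE_inverse_translate[OF R this] AE_inverse_good AE_good_path show ?thesis
  proof eventually_elim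
    case (elim \<omega>)
    then have \<omega>: "\<omega> \<in> space PS" "tgt G (\<omega> 0) \<in> U" by auto
    have y: "bnd \<omega> \<in> space (pts X)" "proj X (bnd \<omega>) = tgt G (\<omega> 0)" using elim by auto
    note to = U_objs[OF \<omega>(2)]
    have good: "AE g in \<kappa> (tgt G (\<omega> 0)). (bnd \<omega>, g) \<in> D \<and> src G g \<in> U \<and> bnd (\<tau> (ginv G g) \<omega>) = tact (ginv G g) (bnd \<omega>)"
      using elim by blast
    let ?R = "\<lambda>h k. ?E (tact (ginv G h) (bnd \<omega>)) (tmult (ginv G h) k)"
    have 1: "AE h in \<kappa> (tgt G (\<omega> 0)). AE k in \<kappa> (tgt G (\<omega> 0)). ?R h k"
      using elim(1) good
    proof eventually_elim
      case (elim h)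
      then have h: "h \<in> space (arrs G)" "tgt G h = tgt G (\<omega> 0)" "src G h \<in> U" "(bnd \<omega>, h) \<in> D" using y by (auto simp: D_def)
      have hi: "ginv G h \<in> space (arrs G)" "src G (ginv G h) \<in> U" "tgt G (ginv G h) \<in> U"
        using h \<omega> by (auto simp: inv_in src_inv tgt_inv)
      have t: "tgt G (\<tau> (ginv G h) \<omega> 0) = tgt G (ginv G h)"
        using hi h \<omega> path_in[of \<omega> 0] by (auto simp: \<tau>_def tmult_def composable_def tgt_mult src_inv)
      let ?A = "{k\<in>space (arrs G). \<not> ?E (tact (ginv G h) (bnd \<omega>)) k}"
      have "(\<lambda>_. tact (ginv G h) (bnd \<omega>)) \<in> measurable (arrs G) (pts X)" using D_inverse(1)[OF h(4,3)] by simp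
      from jmeas_measurable[OF mf this measurable_ident]
      have [measurable]: "pull 0 f (tact (ginv G h) (bnd \<omega>)) \<in> borel_measurable (arrs G)" by simp
      have A: "?A \<in> sets (arrs G)" by measurable
      have "AE k in \<kappa> (tgt G (\<tau> (ginv G h) \<omega> 0)). ?E (bnd (\<tau> (ginv G h) \<omega>)) k" by (rule elim(1))
      then have "AE k in \<kappa> (tgt G (ginv G h)). ?E (tact (ginv G h) (bnd \<omega>)) k"
        using elim(2) unfolding t by simp
      then have "AE k in \<kappa> (tgt G (ginv G h)). k \<notin> ?A" by eventually_elim simp
      then have "AE k in \<kappa> (src G (ginv G h)). tmult (ginv G h) k \<notin> ?A"
        by (subst kappa_translate[OF hi A])
      then have "AE k in \<kappa> (tgt G (\<omega> 0)). tmult (ginv G h) k \<notin> ?A"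
        using src_inv[OF h(1)] h(2) by (simp only:)
      then show ?case using AE_space
      proof eventually_elim
        case (elim k)
        then show ?case using tmult_in[OF hi(1), of k] kappa_space[OF to] by auto
      qed
    qed
    have "AE k in \<kappa> (tgt G (\<omega> 0)). AE h in \<kappa> (tgt G (\<omega> 0)). ?R h k"
    proof (subst prob_space_AE_commute[OF kappa_prob[OF to] kappa_prob[OF to], symmetric])
      have c: "(\<lambda>_. bnd \<omega>) \<in> measurable (arrs G \<Otimes>\<^sub>M arrs G) (pts X)" using y by simp
      have "(\<lambda>p. pull 0 f (tact (ginv G (fst p)) (bnd \<omega>)) (tmult (ginv G (fst p)) (snd p))) \<in> borel_measurable (arrs G \<Otimes>\<^sub>M arrs G)"
        by (rule jmeas_measurable[OF mf measurable_tact[OF _ c]]) measurable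
      then have "Measurable.pred (arrs G \<Otimes>\<^sub>M arrs G) (\<lambda>p. ?R (fst p) (snd p))" by simp
      then show "Measurable.pred (\<kappa> (tgt G (\<omega> 0)) \<Otimes>\<^sub>M \<kappa> (tgt G (\<omega> 0))) (\<lambda>p. ?R (fst p) (snd p))"
        by (simp only: measurable_cong_sets[OF sets_pair_measure_cong[OF kappa_sets[OF to] kappa_sets[OF to]] refl])
    qed (rule 1)
    then show ?case
    proof eventually_elim
      case (elim k)
      have "AE h in Theta (bnd \<omega>). ?R h k"
        by (rule AE_Theta[OF y(1)]) (use elim \<omega> in \<open>simp_all only: y(2)\<close>)
      then show ?case by eventually_elim (simp add: clip_id)
    qed
  qed
qed

text \<open>Equivariance of the limit, applied to the truncation of \<open>F\<close> and to the weighted convolution.\<close>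

lemma Mean_conv:
  assumes f: "f \<in> Linf MH" and cf: "conv_arrs H \<theta> f \<in> Linf MH"
  shows "AE y in \<nu>. Mean (conv_arrs H \<theta> f) y = conv_objs H \<theta> (Mean f) y"
proof -
  obtain C where fH: "f \<in> borel_measurable (arrs H)" and mf: "jmeas (pull 0 f)" and eb: "ess_bdd (pull 0 f) C" using Linf_MH[OF f] by metis
  obtain C' where cH: "conv_arrs H \<theta> f \<in> borel_measurable (arrs H)" and mc: "jmeas (pull 0 (conv_arrs H \<theta> f))"
    using Linf_MH[OF cf] by metis
  have C: "0 \<le> C" using eb by (simp add: ess_bdd_def)
  let ?F = "\<lambda>y k. clip C (pull 0 f y k)" and ?F' = "\<lambda>y k. weight y * pull 0 (conv_arrs H \<theta> f) y k"
  have mF': "jmeas ?F'"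
    using mc measurable_compose[OF measurable_fst measurable_weight] by (intro borel_measurable_times) auto
  have lF: "mean_lim ?F (Mean f)" using mean_lim_Mean[OF f] mean_lim_clip[OF mf eb] by blast
  have lF': "mean_lim ?F' (\<lambda>y. weight y * Mean (conv_arrs H \<theta> f) y)"
  proof (rule mean_lim_scale[OF measurable_weight _ mean_lim_Mean[OF cf]])
    show "\<bar>weight y\<bar> \<le> 1" for y using weight_bounds[of y] by simp
  qed
  have "AE \<omega> in Q. weight (bnd \<omega>) * Mean (conv_arrs H \<theta> f) (bnd \<omega>) = (\<integral>h. Mean f (tact (ginv G h) (bnd \<omega>)) \<partial>Theta (bnd \<omega>))"
  proof (rule mean_lim_translate[OF measurable_Theta AE_Theta jmeas_clip[OF mf] _ mF' _ lF lF'])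
    show "\<bar>?F y k\<bar> \<le> C" for y k using C by (rule clip_bound)
    show "AE \<omega> in Q. AE k in \<kappa> (tgt G (\<omega> 0)). ?F' (bnd \<omega>) k = (\<integral>h. ?F (tact (ginv G h) (bnd \<omega>)) (tmult (ginv G h) k) \<partial>Theta (bnd \<omega>))"
      using AE_clip_translate[OF fH eb] AE_inverse_good
    proof eventually_elim
      case (elim \<omega>)
      then have y: "bnd \<omega> \<in> space (pts X)" "bnd \<omega> \<in> Y0" "proj X (bnd \<omega>) = tgt G (\<omega> 0)" "proj X (bnd \<omega>) \<in> U" by auto
      have good: "AE g in \<kappa> (tgt G (\<omega> 0)). (bnd \<omega>, g) \<in> D \<and> src G g \<in> U \<and> bnd (\<tau> (ginv G g) \<omega>) = tact (ginv G g) (bnd \<omega>)"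
        using elim by blast
      have "AE g in \<kappa> (proj X (bnd \<omega>)). src G g \<in> U" unfolding y(3) using good by eventually_elim simp
      then have s: "AE h in Theta (bnd \<omega>). src G h \<in> U" by (rule AE_Theta[OF y(1,4)])
      show ?case using elim(1) good
      proof eventually_elim
        case (elim k)
        then have k: "(bnd \<omega>, k) \<in> D" by simp
        have kp: "k \<in> space (arrs G)" using k by (simp add: D_def)
        let ?f = "\<lambda>h. pull 0 f (tact (ginv G h) (bnd \<omega>)) (tmult (ginv G h) k)"
        have c: "(\<lambda>_. bnd \<omega>) \<in> measurable (arrs G) (pts X)" "(\<lambda>_. k) \<in> measurable (arrs G) (arrs G)" using y kp by simp_all
        have fm: "?f \<in> borel_measurable (arrs G)"
          by (rule jmeas_measurable[OF mf]) (intro measurable_tact measurable_tmult measurable_inv c)+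
        have fmT: "?f \<in> borel_measurable (Theta (bnd \<omega>))" using fm by (simp add: Theta_def)
        have "?F' (bnd \<omega>) k = weight (bnd \<omega>) * conv_arrs H \<theta> f (emb (bnd \<omega>) k)" using k by (simp add: pull_def)
        also have "\<dots> = (\<integral>h. ?f h \<partial>Theta (bnd \<omega>))" by (rule conv_arrs_eq[OF fH y(2,4) k s])
        also have "\<dots> = (\<integral>h. clip C (?f h) \<partial>Theta (bnd \<omega>))"
          using elim(1) fmT by (intro integral_cong_AE measurable_compose[OF _ measurable_clip]) auto
        finally show ?case .
      qed
    qed
  qed
  then have "AE y in \<nu>. weight y * Mean (conv_arrs H \<theta> f) y = (\<integral>h. Mean f (tact (ginv G h) y) \<partial>Theta y)"
  proof (subst nu_AE)
    have 1: "(\<lambda>y. weight y * Mean (conv_arrs H \<theta> f) y) \<in> borel_measurable (pts X)"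
      using measurable_weight Mean_measurable[OF cf] by measurable
    have a: "(\<lambda>p. tact (ginv G (snd p)) (fst p)) \<in> measurable (pts X \<Otimes>\<^sub>M arrs G) (pts X)" by measurable
    have 2: "(\<lambda>y. \<integral>h. Mean f (tact (ginv G h) y) \<partial>Theta y) \<in> borel_measurable (pts X)"
      by (rule integral_measurable_kernel[OF measurable_compose[OF a Mean_measurable[OF f]] measurable_Theta])
    show "Measurable.pred (pts X) (\<lambda>y. weight y * Mean (conv_arrs H \<theta> f) y = (\<integral>h. Mean f (tact (ginv G h) y) \<partial>Theta y))"
      unfolding pred_def by (rule borel_measurable_eq[OF 1 2])
  qed
  then show ?thesis using AE_nu_good
  proof eventually_elim
    case (elim y)
    then have "weight y * Mean (conv_arrs H \<theta> f) y = weight y * conv_objs H \<theta> (Mean f) y"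
      by (simp add: conv_objs_eq[OF Mean_measurable[OF f]])
    then show ?case using weight_bounds[of y] by simp
  qed
qed

end

lemma amenable_H: "amenable H lamH \<nu>"
  unfolding amenable_def invariant_mean_def
proof (intro exI[of _ Mean] conjI ballI allI impI)
  fix f assume f: "f \<in> Linf MH"
  show "Mean f \<in> Linf \<nu>"
    using Mean_measurable[OF f] Mean_bounded[OF f] by (auto simp: Linf_def measurable_cong_sets[OF nu_sets refl])
  { assume "AE z in MH. 0 \<le> f z"
    from AE_MH[OF this] have nn: "AE \<omega> in Q. AE g in \<kappa> (tgt G (\<omega> 0)). 0 \<le> pull 0 f (bnd \<omega>) g"
      by (auto elim!: eventually_mono simp: pull_def split: if_splits)
    obtain C where "jmeas (pull 0 f)" "ess_bdd (pull 0 f) C" using Linf_MH[OF f] by metis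
    from mean_lim_nonneg[OF this nn mean_lim_Mean[OF f]] Mean_measurable[OF f]
    show "AE y in \<nu>. 0 \<le> Mean f y" by (subst nu_AE) auto }
  fix f' a b assume f': "f' \<in> Linf MH"
  show "AE y in \<nu>. Mean (\<lambda>g. a * f g + b * f' g) y = a * Mean f y + b * Mean f' y"
  proof (rule mean_lim_AE_nu)
    show "mean_lim (pull 0 (\<lambda>g. a * f g + b * f' g)) (Mean (\<lambda>g. a * f g + b * f' g))"
      by (rule mean_lim_Mean[OF Linf_lincomb[OF f f']])
    obtain C where C: "jmeas (pull 0 f)" "ess_bdd (pull 0 f) C" using Linf_MH[OF f] by metis
    obtain C' where C': "jmeas (pull 0 f')" "ess_bdd (pull 0 f') C'" using Linf_MH[OF f'] by metis
    have "pull 0 (\<lambda>g. a * f g + b * f' g) = (\<lambda>y k. a * pull 0 f y k + b * pull 0 f' y k)"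
      by (auto simp: pull_def fun_eq_iff)
    then show "mean_lim (pull 0 (\<lambda>g. a * f g + b * f' g)) (\<lambda>y. a * Mean f y + b * Mean f' y)"
      using mean_lim_lincomb[OF C C' mean_lim_Mean[OF f] mean_lim_Mean[OF f']] by simp
  qed
next
  show "AE y in \<nu>. Mean (\<lambda>_. 1) y = 1"
  proof (rule mean_lim_AE_nu[OF mean_lim_Mean[OF Linf_one]])
    have "mean_lim (pull 0 (\<lambda>_. 1)) \<Phi> \<longleftrightarrow> mean_lim (\<lambda>_ _. 1) \<Phi>" for \<Phi>
      by (rule mean_lim_cong[OF jmeas_pull]) (use AE_D in \<open>auto elim!: eventually_mono simp: pull_def\<close>)
    then show "mean_lim (pull 0 (\<lambda>_. 1)) (\<lambda>_. 1)" using mean_lim_one by simp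
  qed
next
  fix \<theta> f assume "ac_system H lamH \<theta>" "f \<in> Linf MH" "conv_arrs H \<theta> f \<in> Linf MH"
  then show "AE y in \<nu>. Mean (conv_arrs H \<theta> f) y = conv_objs H \<theta> (Mean f) y" by (rule Mean_conv)
qed

end

section \<open>Amenability of the Poisson extension\<close>

lemma AE_eq_of_null_sets:
  assumes "\<And>A. A \<in> null_sets M \<longleftrightarrow> A \<in> null_sets N" "space M = space N"
  shows "(AE x in M. P x) \<longleftrightarrow> (AE x in N. P x)"
  using assms by (auto simp: eventually_ae_filter)

text \<open>A conull set whose diagonal is measurable, the preimage of the diagonal of the line.\<close>

lemma lebesgue_space_diagonal:
  assumes leb: "lebesgue_space M"
  obtains Y0 where "Y0 \<in> sets M" "AE x in M. x \<in> Y0" "{(x, y). x \<in> Y0 \<and> x = y} \<in> sets (M \<Otimes>\<^sub>M M)"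
proof -
  obtain Y0 and e :: "'a \<Rightarrow> real" where Y0[measurable]: "Y0 \<in> sets M" and ae: "AE x in M. x \<in> Y0"
    and e[measurable]: "e \<in> borel_measurable M" and inj: "inj_on e Y0"
    using lebesgue_space_coordinate[OF leb] by metis
  have "{p\<in>space (M \<Otimes>\<^sub>M M). fst p \<in> Y0 \<and> snd p \<in> Y0 \<and> e (fst p) = e (snd p)} \<in> sets (M \<Otimes>\<^sub>M M)"
    by measurable
  also have "{p\<in>space (M \<Otimes>\<^sub>M M). fst p \<in> Y0 \<and> snd p \<in> Y0 \<and> e (fst p) = e (snd p)} = {(x, y). x \<in> Y0 \<and> x = y}"
    using sets.sets_into_space[OF Y0] inj by (auto simp: space_pair_measure inj_on_def)
  finally show ?thesis using that Y0 ae by blast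
qed

lemma amenable_empty:
  assumes "space M = {}" shows "amenable G lam M"
  unfolding amenable_def invariant_mean_def
  by (intro exI[of _ "\<lambda>_ _. 0"]) (auto simp: Linf_def intro!: AE_I2 simp: assms)

theorem theorem5p2:
  fixes G :: "('o, 'g) groupoid"
    and lam :: "'o \<Rightarrow> 'g measure"
    and \<mu> :: "'o measure"
    and \<pi> :: "'g \<Rightarrow> 'g measure"
    and X :: "('o, 'g, 'y) gspace"
    and bnd :: "(nat \<Rightarrow> 'g) \<Rightarrow> 'y"
    and \<nu> :: "'y measure"
  assumes "measured_groupoid G lam \<mu>"
    and "lebesgue_space (haar_star G lam \<mu>)"
    and "invariant_markov G lam \<mu> \<pi>"
    and "poisson_boundary (arrs G) (haar_star G lam \<mu>) \<pi> (pts X) bnd \<nu>"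
    and "boundary_action G lam \<mu> \<pi> X bnd"
  shows "borel_groupoid (semidirect G X) \<and>
    quasi_invariant (semidirect G X) (lift_haar G X lam) \<nu> \<and>
    amenable (semidirect G X) (lift_haar G X lam) \<nu>"
proof -
  note mg = assms(1)
  let ?m = "haar_star G lam \<mu>"
  interpret X: borel_gspace G X using assms(5) by (simp add: boundary_action_def)
  have bg: "borel_groupoid (semidirect G X)" by (rule X.semidirect_borel_groupoid)
  have \<nu>s: "sets \<nu> = sets (pts X)" using assms(4) by (simp add: poisson_boundary_def)
  have \<nu>sp: "space \<nu> = space (pts X)" using \<nu>s by (rule sets_eq_imp_space_eq)
  show ?thesis
  proof (cases "space (arrs G) = {}")
    case True
    \<comment> \<open>without arrows there are neither objects nor boundary points, and every measure involved is zero\<close>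
    have sp: "space \<nu> = {}"
      using True X.unit_in measurable_space[OF X.measurable_proj] unfolding \<nu>sp by blast
    have "space (arrs (semidirect G X)) = {}"
      using True by (auto simp: X.space_semidirect X.SA_def)
    then have "sets (arrs (semidirect G X)) = {{}}" by (simp add: space_empty_iff)
    moreover have "sets (haar_star (semidirect G X) (lift_haar G X lam) \<nu>) = sets (arrs (semidirect G X))"
      by (simp add: haar_star_def)
    moreover have ac: "absolutely_continuous M N" if "sets M = {{}}" for M N :: "('y \<times> 'g \<times> 'y) measure"
      unfolding absolutely_continuous_def
    proof
      fix A assume "A \<in> null_sets M"
      then have "A = {}" using that by (auto simp: null_sets_def)
      then show "A \<in> null_sets N" by simp
    qed
    ultimately have "quasi_invariant (semidirect G X) (lift_haar G X lam) \<nu>"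
      unfolding quasi_invariant_def mutually_ac_def
      using \<open>sets (arrs (semidirect G X)) = {{}}\<close> by (intro conjI ac) simp_all
    then show ?thesis using bg amenable_empty[OF sp] by blast
  next
    case False
    have inv: "\<pi> \<in> measurable (arrs G) (prob_algebra (arrs G))" "\<And>g. g \<in> space (arrs G) \<Longrightarrow> AE h in \<pi> g. tgt G h = tgt G g"
      "\<And>g k. (g, k) \<in> composable G \<Longrightarrow> \<pi> (gmult G g k) = translate G g (\<pi> k)" "absolutely_continuous ?m (?m \<bind> \<pi>)"
      using assms(3) unfolding invariant_markov_def P_adapted_def by blast+
    obtain U \<kappa> \<mu>' where NG: "normalized_groupoid G U \<kappa> \<mu>'"
      and \<kappa>: "\<And>x P. x \<in> U \<Longrightarrow> (AE g in \<kappa> x. P g) \<longleftrightarrow> (AE g in lam x. P g)"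
      and \<mu>': "\<And>P. (AE x in \<mu>'. P x) \<longleftrightarrow> (AE x in \<mu>. P x)"
      and dex: "\<exists>d\<in>borel_measurable (arrs G). \<forall>x\<in>U. lam x = density (\<kappa> x) d"
      by (rule normalization[OF mg assms(2)]) (rule that)
    obtain d where d: "d \<in> borel_measurable (arrs G)" "\<And>x. x \<in> U \<Longrightarrow> lam x = density (\<kappa> x) d" using dex by blast
    interpret N: normalized_groupoid G U \<kappa> \<mu>' by (rule NG)
    note sm = sets_haar_star[OF mg] and spm = space_haar_star[OF mg]
    \<comment> \<open>almost everything for the Haar measure is almost everything for the normalized system\<close>
    have null: "A \<in> null_sets ?m \<longleftrightarrow> (AE x in \<mu>'. AE g in \<kappa> x. g \<notin> A)" if "A \<in> sets (arrs G)" for A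
    proof -
      have "A \<in> null_sets ?m \<longleftrightarrow> (AE x in \<mu>'. AE g in lam x. g \<notin> A)"
        unfolding \<mu>' by (rule null_sets_haar_star[OF mg that])
      also have "\<dots> \<longleftrightarrow> (AE x in \<mu>'. AE g in \<kappa> x. g \<notin> A)"
        by (rule AE_iff_AE) (use N.AE_mu_U in \<open>eventually_elim, simp add: \<kappa>\<close>)
      finally show ?thesis .
    qed
    have AE_m: "AE x in \<mu>'. AE g in \<kappa> x. P g" if P: "AE g in ?m. P g" for P
    proof -
      obtain A where A: "{g\<in>space ?m. \<not> P g} \<subseteq> A" "A \<in> null_sets ?m" using P by (auto simp: eventually_ae_filter)
      then have As: "A \<in> sets (arrs G)" using sm by auto
      have "AE x in \<mu>'. AE g in \<kappa> x. g \<notin> A" using null[OF As] A(2) by simp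
      then show ?thesis using N.AE_mu_U
      proof eventually_elim
        case (elim x)
        have "AE g in \<kappa> x. g \<in> space (arrs G)"
        proof -
          have "space (\<kappa> x) = space (arrs G)"
            using subprob_measurableD(1)[OF measurable_prob_algebraD[OF N.kappa] N.U_objs[OF elim(2)]] .
          then show ?thesis using AE_space[of "\<kappa> x"] by simp
        qed
        with elim(1) show ?case by eventually_elim (use A(1) spm in auto)
      qed
    qed
    have m_sub: "\<pi> \<in> measurable ?m (subprob_algebra (arrs G))"
      using measurable_prob_algebraD[OF inv(1)] by (simp add: measurable_cong_sets[OF sm refl])
    interpret C: invariant_chain G U \<kappa> \<mu>' \<pi>
    proof (rule invariant_chain.intro[OF NG invariant_chain_axioms.intro])
      show "space (objs G) \<noteq> {}" using False X.src_in by blast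
      show "\<pi> \<in> measurable (arrs G) (prob_algebra (arrs G))" "\<And>g. g \<in> space (arrs G) \<Longrightarrow> AE h in \<pi> g. tgt G h = tgt G g"
        by (fact inv)+
      fix g k assume g: "g \<in> space (arrs G)" "k \<in> space (arrs G)" "src G g = tgt G k" "src G g \<in> U"
      have "sets (\<pi> k) = sets (arrs G)" using subprob_measurableD(2)[OF measurable_prob_algebraD[OF inv(1)] g(2)] .
      moreover have "AE h in \<pi> k. tgt G h = src G g" using inv(2)[OF g(2)] g(3) by simp
      ultimately have "translate G g (\<pi> k) = distr (\<pi> k) (arrs G) (N.tmult g)"
        by (rule N.translate_eq_distr[OF g(1,4)])
      then show "\<pi> (gmult G g k) = distr (\<pi> k) (arrs G) (N.tmult g)"
        using inv(3)[of g k] g by (simp add: composable_def)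
    next
      fix A assume A: "A \<in> sets (arrs G)" "AE x in \<mu>'. AE g in \<kappa> x. g \<notin> A"
      then have "A \<in> null_sets (?m \<bind> \<pi>)"
        using null[OF A(1)] inv(4) by (auto simp: absolutely_continuous_def)
      then have "AE g in ?m \<bind> \<pi>. g \<notin> A" by (rule AE_not_in)
      then have "AE g in ?m. AE h in \<pi> g. h \<notin> A"
        using A by (subst (asm) AE_bind[OF m_sub]) auto
      then show "AE x in \<mu>'. AE g in \<kappa> x. AE h in \<pi> g. h \<notin> A" by (rule AE_m)
    qed
    have PLm: "C.PL \<in> measurable M (subprob_algebra C.PS)" if "sets M = sets (arrs G)" for M
      using C.measurable_path_law by (simp add: measurable_cong_sets[OF that refl])
    have sets_PM: "sets (path_measure (arrs G) \<pi> M) = sets C.PS" if "sets M = sets (arrs G)" for M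
      unfolding path_measure_def using False sets_eq_imp_space_eq[OF that]
      by (intro sets_bind) (auto simp: C.sets_path_law)
    have spPM: "space (path_measure (arrs G) \<pi> M) = space C.PS" if "sets M = sets (arrs G)" for M
      using sets_PM[OF that] by (rule sets_eq_imp_space_eq)
    have AE_PM: "(AE \<omega> in path_measure (arrs G) \<pi> M. P \<omega>) \<longleftrightarrow> (AE g in M. AE \<omega> in C.PL g. P \<omega>)"
      if "sets M = sets (arrs G)" "Measurable.pred C.PS P" for M P
      unfolding path_measure_def by (rule AE_bind[OF PLm[OF that(1)] that(2)])
    let ?P = "path_measure (arrs G) \<pi> ?m"
    have PQ: "(AE \<omega> in ?P. P \<omega>) \<longleftrightarrow> (AE \<omega> in C.Q. P \<omega>)" for P
    proof (rule AE_eq_of_null_sets)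
      show "space ?P = space C.Q" by (simp add: spPM[OF sm] C.Q_space)
      fix A
      show "A \<in> null_sets ?P \<longleftrightarrow> A \<in> null_sets C.Q"
      proof (cases "A \<in> sets C.PS")
        case True
        then have p: "Measurable.pred C.PS (\<lambda>\<omega>. \<omega> \<notin> A)" by measurable
        have good: "Measurable.pred (arrs G) (\<lambda>g. AE \<omega> in C.PL g. \<omega> \<notin> A)"
          by (rule pred_AE_kernel[OF C.measurable_path_law]) (use p in simp)
        let ?B = "{g\<in>space (arrs G). \<not> (AE \<omega> in C.PL g. \<omega> \<notin> A)}"
        have B: "?B \<in> sets (arrs G)" using good by measurable
        have "A \<in> null_sets ?P \<longleftrightarrow> (AE \<omega> in ?P. \<omega> \<notin> A)" using True by (intro AE_iff_null_sets) (simp add: sets_PM[OF sm])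
        also have "\<dots> \<longleftrightarrow> (AE g in ?m. AE \<omega> in C.PL g. \<omega> \<notin> A)" by (rule AE_PM[OF sm p])
        also have "\<dots> \<longleftrightarrow> (AE g in ?m. g \<notin> ?B)" by (rule AE_cong) (simp add: spm)
        also have "\<dots> \<longleftrightarrow> ?B \<in> null_sets ?m" using B by (intro AE_iff_null_sets[symmetric]) (simp add: sm)
        also have "\<dots> \<longleftrightarrow> (AE x in \<mu>'. AE g in \<kappa> x. g \<notin> ?B)" by (rule null[OF B])
        also have "\<dots> \<longleftrightarrow> (AE x in \<mu>'. AE g in \<kappa> x. AE \<omega> in C.PL g. \<omega> \<notin> A)"
          by (intro AE_cong) (simp add: C.space_mu C.kappa_space)
        also have "\<dots> \<longleftrightarrow> (AE x in \<mu>'. AE \<omega> in C.Qfib x. \<omega> \<notin> A)"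
          by (intro AE_cong C.AE_Qfib[symmetric] p) (simp add: C.space_mu)
        also have "\<dots> \<longleftrightarrow> (AE \<omega> in C.Q. \<omega> \<notin> A)" by (rule C.AE_Q[OF p, symmetric])
        also have "\<dots> \<longleftrightarrow> A \<in> null_sets C.Q" using True by (intro AE_iff_null_sets[symmetric]) (simp add: C.Q_sets)
        finally show ?thesis .
      next
        case False
        then show ?thesis using sets_PM[OF sm] C.Q_sets by (auto simp: null_sets_def)
      qed
    qed
    have PQx: "(AE \<omega> in path_measure (arrs G) \<pi> (lam x). P \<omega>) \<longleftrightarrow> (AE \<omega> in C.Qfib x. P \<omega>)" if x: "x \<in> U" for x P
    proof (rule AE_eq_of_null_sets)
      note xo = N.U_objs[OF x]
      note sl = haar_sets[OF mg xo]
      show "space (path_measure (arrs G) \<pi> (lam x)) = space (C.Qfib x)" by (simp add: spPM[OF sl] C.Qfib_space[OF xo])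
      fix A
      show "A \<in> null_sets (path_measure (arrs G) \<pi> (lam x)) \<longleftrightarrow> A \<in> null_sets (C.Qfib x)"
      proof (cases "A \<in> sets C.PS")
        case True
        then have p: "Measurable.pred C.PS (\<lambda>\<omega>. \<omega> \<notin> A)" by measurable
        have "A \<in> null_sets (path_measure (arrs G) \<pi> (lam x)) \<longleftrightarrow> (AE \<omega> in path_measure (arrs G) \<pi> (lam x). \<omega> \<notin> A)"
          using True by (intro AE_iff_null_sets) (simp add: sets_PM[OF sl])
        also have "\<dots> \<longleftrightarrow> (AE g in lam x. AE \<omega> in C.PL g. \<omega> \<notin> A)" by (rule AE_PM[OF sl p])
        also have "\<dots> \<longleftrightarrow> (AE g in \<kappa> x. AE \<omega> in C.PL g. \<omega> \<notin> A)" by (rule \<kappa>[OF x, symmetric])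
        also have "\<dots> \<longleftrightarrow> (AE \<omega> in C.Qfib x. \<omega> \<notin> A)" by (rule C.AE_Qfib[OF xo p, symmetric])
        also have "\<dots> \<longleftrightarrow> A \<in> null_sets (C.Qfib x)"
          using True by (intro AE_iff_null_sets[symmetric]) (simp add: C.Qfib_sets[OF xo])
        finally show ?thesis .
      next
        case False
        then show ?thesis using sets_PM[OF sl] C.Qfib_sets[OF xo] by (auto simp: null_sets_def)
      qed
    qed
    have bnd: "bnd \<in> measurable C.PS (pts X)"
      and shift: "AE \<omega> in ?P. bnd (time_shift \<omega>) = bnd \<omega>"
      and max: "\<And>f :: _ \<Rightarrow> real. f \<in> borel_measurable C.PS \<Longrightarrow> AE \<omega> in ?P. f (time_shift \<omega>) = f \<omega> \<Longrightarrow>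
        \<exists>F\<in>borel_measurable (pts X). AE \<omega> in ?P. f \<omega> = F (bnd \<omega>)"
      and leb: "lebesgue_space \<nu>" and cls: "mutually_ac (distr ?P (pts X) bnd) \<nu>"
      using assms(4) by (auto simp: poisson_boundary_def)
    have bndP: "bnd \<in> measurable ?P (pts X)" using bnd by (simp add: measurable_cong_sets[OF sets_PM[OF sm] refl])
    have nu: "(AE y in \<nu>. P y) \<longleftrightarrow> (AE \<omega> in C.Q. P (bnd \<omega>))" if P: "Measurable.pred (pts X) P" for P
    proof -
      have "(AE y in \<nu>. P y) \<longleftrightarrow> (AE y in distr ?P (pts X) bnd. P y)"
        using cls by (intro AE_eq_of_null_sets) (auto simp: mutually_ac_def absolutely_continuous_def \<nu>sp)
      also have "\<dots> \<longleftrightarrow> (AE \<omega> in ?P. P (bnd \<omega>))"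
        using P by (intro AE_distr_iff[OF bndP]) (simp add: pred_def)
      also have "\<dots> \<longleftrightarrow> (AE \<omega> in C.Q. P (bnd \<omega>))" by (rule PQ)
      finally show ?thesis .
    qed
    obtain Y0 where Y0: "Y0 \<in> sets \<nu>" "AE y in \<nu>. y \<in> Y0" and dY0: "{(x, y). x \<in> Y0 \<and> x = y} \<in> sets (\<nu> \<Otimes>\<^sub>M \<nu>)"
      using lebesgue_space_diagonal[OF leb] by blast
    obtain L where L: "banach_limit L" using banach_limit_exists by blast
    interpret B: poisson_chain G U \<kappa> \<mu>' \<pi> X bnd Y0 L lam d \<nu>
    proof (intro poisson_chain.intro mean_chain.intro boundary_chain.intro)
      show "invariant_chain G U \<kappa> \<mu>' \<pi>" by (rule C.invariant_chain_axioms)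
      show "borel_gspace G X" by (rule X.borel_gspace_axioms)
      show "boundary_chain_axioms G \<kappa> \<mu>' \<pi> X bnd Y0"
      proof
        show "bnd \<in> measurable C.PS (pts X)" by (rule bnd)
        show Y0s: "Y0 \<in> sets (pts X)" using Y0 \<nu>s by simp
        show "{(x, y). x \<in> Y0 \<and> x = y} \<in> sets (pts X \<Otimes>\<^sub>M pts X)"
          using dY0 by (simp only: sets_pair_measure_cong[OF \<nu>s \<nu>s])
        show "AE \<omega> in C.Q. bnd \<omega> \<in> Y0" using Y0(2) Y0s by (subst (asm) nu) auto
        show "AE \<omega> in C.Q. proj X (bnd \<omega>) = tgt G (\<omega> 0)"
          using assms(5) unfolding boundary_action_def PQ by blast
        have "AE g in ?m. AE \<omega> in path_measure (arrs G) \<pi> (lam (src G g)). bnd (\<lambda>n. gmult G g (\<omega> n)) = act X g (bnd \<omega>)"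
          using assms(5) unfolding boundary_action_def by blast
        from AE_m[OF this] C.base_AE_src[OF N.AE_mu_U]
        show "AE x in \<mu>'. AE g in \<kappa> x. AE \<omega> in C.Qfib (src G g). bnd (\<lambda>n. gmult G g (\<omega> n)) = act X g (bnd \<omega>)"
        proof eventually_elim
          case (elim x)
          then show ?case by eventually_elim (simp only: PQx)
        qed
      qed
      show "mean_chain_axioms G \<kappa> \<mu>' \<pi> X bnd L"
      proof
        show "banach_limit L" by (rule L)
        show "AE \<omega> in C.Q. bnd (time_shift \<omega>) = bnd \<omega>" using shift unfolding PQ .
        show "\<exists>\<Psi>\<in>borel_measurable (pts X). AE \<omega> in C.Q. f \<omega> = \<Psi> (bnd \<omega>)"
          if "f \<in> borel_measurable C.PS" "AE \<omega> in C.Q. f (time_shift \<omega>) = f \<omega>" for f :: "_ \<Rightarrow> real"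
          using max that unfolding PQ by blast
      qed
      show "poisson_chain_axioms G U \<kappa> \<mu>' \<pi> X bnd lam d \<nu>"
        by standard (use haar_sets[OF mg] \<kappa> d \<nu>s nu in auto)
    qed
    show ?thesis using bg B.quasi_invariant_H B.amenable_H by blast
  qed
qed

end
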